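(* Let $G$ be a graph with $\operatorname{mad}(G)<\frac{5}{2}$. Let $L$ be a $4$-assignment for $G$ and let $\alpha$ and $\beta$ be $L$-colorings of $G$. Then there exists an $L$-recoloring sequence that transforms $\alpha$ into $\beta$ such that each vertex of $G$ is recolored at most $18$ times. In particular, this holds for every planar graph $G$ with girth at least $10$.
   Context: Graphs are finite and simple. The maximum average degree $\operatorname{mad}(G)$ is the maximum of $2|E(H)|/|V(H)|$ over all nonempty subgraphs $H$ of $G$. A $k$-assignment $L$ for $G$ assigns to each vertex $v$ a list $L(v)$ of $k$ colors. An $L$-coloring is a proper coloring of $G$ in which each vertex $v$ receives a color from $L(v)$. An $L$-recoloring sequence transforming $\alpha$ into $\beta$ is a finite sequence of (proper) $L$-colorings of $G$ starting at $\alpha$ and ending at $\beta$ such that consecutive colorings differ at exactly one vertex; that vertex is said to be recolored at that step. *)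

theory Defs
  imports "HOL-Analysis.Analysis"
begin

definition simple_graph :: "'a set \<Rightarrow> 'a set set \<Rightarrow> bool" where
  "simple_graph V E \<longleftrightarrow>
     finite V \<and> (\<forall>e\<in>E. \<exists>u\<in>V. \<exists>v\<in>V. u \<noteq> v \<and> e = {u, v})"

definition is_subgraph :: "'a set \<Rightarrow> 'a set set \<Rightarrow> 'a set \<Rightarrow> 'a set set \<Rightarrow> bool" where
  "is_subgraph W F V E \<longleftrightarrow> simple_graph W F \<and> W \<subseteq> V \<and> F \<subseteq> E"

(* For a finite nonempty V this is the maximum of a finite nonempty set. For V = {} the
   maximum does not exist and the value is unspecified. *)
definition mad :: "'a set \<Rightarrow> 'a set set \<Rightarrow> real" where
  "mad V E =
     Max {2 * real (card F) / real (card W) | W F. is_subgraph W F V E \<and> W \<noteq> {}}"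

(* A cycle is given by the cyclic list of its vertices; it has as many edges as vertices. *)
definition is_cycle :: "'a set \<Rightarrow> 'a set set \<Rightarrow> 'a list \<Rightarrow> bool" where
  "is_cycle V E c \<longleftrightarrow>
     3 \<le> length c \<and> distinct c \<and> set c \<subseteq> V \<and>
     (\<forall>i<length c. {c ! i, c ! (Suc i mod length c)} \<in> E)"

(* The infimum of the empty set is \<infinity>, so a forest has infinite girth. *)
definition girth :: "'a set \<Rightarrow> 'a set set \<Rightarrow> enat" where
  "girth V E = (INF c\<in>{c. is_cycle V E c}. enat (length c))"

(* A drawing in the plane (identified with the complex numbers): p places the vertices at
   distinct points, and each edge e is drawn as a simple non-closed curve \<gamma> e that joins the
   ends of e and meets no other vertex; distinct edges meet only in common ends. *)
definition plane_drawing ::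
  "'a set \<Rightarrow> 'a set set \<Rightarrow> ('a \<Rightarrow> complex) \<Rightarrow> ('a set \<Rightarrow> real \<Rightarrow> complex) \<Rightarrow> bool" where
  "plane_drawing V E p \<gamma> \<longleftrightarrow>
     inj_on p V \<and>
     (\<forall>e\<in>E. arc (\<gamma> e) \<and> {pathstart (\<gamma> e), pathfinish (\<gamma> e)} = p ` e \<and>
        path_image (\<gamma> e) \<inter> p ` V = p ` e) \<and>
     (\<forall>e\<in>E. \<forall>f\<in>E. e \<noteq> f \<longrightarrow>
        path_image (\<gamma> e) \<inter> path_image (\<gamma> f) = p ` (e \<inter> f))"

definition planar :: "'a set \<Rightarrow> 'a set set \<Rightarrow> bool" where
  "planar V E \<longleftrightarrow> (\<exists>p \<gamma>. plane_drawing V E p \<gamma>)"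

definition list_assignment :: "nat \<Rightarrow> 'a set \<Rightarrow> ('a \<Rightarrow> 'c set) \<Rightarrow> bool" where
  "list_assignment k V L \<longleftrightarrow> (\<forall>v\<in>V. finite (L v) \<and> card (L v) = k)"

(* Colorings are extensional functions (undefined outside V), so that two colorings are equal
   iff they agree on all vertices. *)
definition list_coloring ::
  "'a set \<Rightarrow> 'a set set \<Rightarrow> ('a \<Rightarrow> 'c set) \<Rightarrow> ('a \<Rightarrow> 'c) \<Rightarrow> bool" where
  "list_coloring V E L \<phi> \<longleftrightarrow>
     \<phi> \<in> (\<Pi>\<^sub>E v\<in>V. L v) \<and> (\<forall>u v. {u, v} \<in> E \<longrightarrow> \<phi> u \<noteq> \<phi> v)"

definition recoloring_sequence ::
  "'a set \<Rightarrow> 'a set set \<Rightarrow> ('a \<Rightarrow> 'c set) \<Rightarrow> ('a \<Rightarrow> 'c) \<Rightarrow> ('a \<Rightarrow> 'c) \<Rightarrow> ('a \<Rightarrow> 'c) list \<Rightarrow> bool"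
where
  "recoloring_sequence V E L \<alpha> \<beta> s \<longleftrightarrow>
     s \<noteq> [] \<and> hd s = \<alpha> \<and> last s = \<beta> \<and> (\<forall>\<phi>\<in>set s. list_coloring V E L \<phi>) \<and>
     (\<forall>i. Suc i < length s \<longrightarrow> (\<exists>!v. v \<in> V \<and> (s ! i) v \<noteq> (s ! Suc i) v))"

definition recolor_count :: "('a \<Rightarrow> 'c) list \<Rightarrow> 'a \<Rightarrow> nat" where
  "recolor_count s v = card {i. Suc i < length s \<and> (s ! i) v \<noteq> (s ! Suc i) v}"

end

theory Submission
  imports Defs
begin

text \<open>A minimal sparse graph contains a vertex of degree at most 1, two adjacent vertices of degree 2,
  or a vertex of degree 3 with three neighbors of degree 2. Delete these vertices, recolor the rest
  by induction, and let the deleted vertices react to the moves of their outer neighbors.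
  A deleted vertex of degree 2 never has to move more often than its outer neighbor, because four
  colors leave it a choice avoiding its inner neighbor. Moving to its final color may cost it two
  further moves, so two moves have to be saved. Since the future of the outer neighbor is known, any
  three of its moves allow one to be saved; serving the vertex whose third move comes first costs
  three leaves at most \<open>6 \<cdot> 3 = 18\<close> outer moves.

  For planar graphs of girth at least 10 one needs \<open>4 |E| < 5 |V|\<close>. If the graph is not cut by a
  vertex, build it from a cycle by adding ears. By the Jordan curve theorem each ear splits a face
  into two faces that are again bounded by cycles.\<close>

section \<open>Two adjacent vertices of degree 2\<close>

text \<open>The bound has to reproduce itself: an outer neighbor may already use all 18 moves, so
  the closing moves of a deleted vertex must be financed by savings. The unit of saving is a round,
  a stretch of time with three changes of one outer color. In the star a round costs the center at
  most one move and no other leaf anything. On the edge the partner may have to pay one move, but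
  then the saving is two; each round is thus booked as raising the total surplus by one, and a total
  of five always suffices. So it is the star, with two moves for each of three leaves, that dictates
  18. The induction runs on \<open>4 |E[W]| < 5 |W|\<close> for all nonempty vertex sets
  \<open>W\<close>: both hypotheses of the theorem imply it, and deletion preserves it. In the
  planar half, Euler's formula is not applied to a finished drawing but carried along as an
  invariant of the ear construction, so a face enters only as the inside or outside of its boundary
  cycle. At a cut vertex two strict inequalities would not add up; the sharper
  \<open>4 |E| + 5 <= 5 |V|\<close> does.\<close>

definition changes :: "(nat \<Rightarrow> 'c) \<Rightarrow> nat \<Rightarrow> nat \<Rightarrow> nat" where
  "changes A t u = card {s \<in> {t..<u}. A s \<noteq> A (Suc s)}"

lemma changes_refl [simp]: "changes A t t = 0"
  by (simp add: changes_def)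

lemma changes_Suc:
  assumes "t \<le> u"
  shows "changes A t (Suc u) = changes A t u + of_bool (A u \<noteq> A (Suc u))"
proof -
  have "{s \<in> {t..<Suc u}. A s \<noteq> A (Suc s)}
      = {s \<in> {t..<u}. A s \<noteq> A (Suc s)} \<union> (if A u \<noteq> A (Suc u) then {u} else {})"
    using assms by (auto simp: less_Suc_eq)
  then show ?thesis
    unfolding changes_def by (simp add: card_insert_if)
qed

lemma changes_add:
  assumes "t \<le> u" "u \<le> w"
  shows "changes A t w = changes A t u + changes A u w"
  using assms(2) assms(1) by (induction rule: dec_induct) (auto simp: changes_Suc)

text \<open>Isolates the next change of color. Three applications yield the times and colors of the
  next three changes, which is all of the future that a round looks at.\<close>

lemma changes_pos_first:
  assumes "changes A t u > 0" "t \<le> u"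
  obtains t' where "t \<le> t'" "t' < u" "\<And>s. t \<le> s \<Longrightarrow> s \<le> t' \<Longrightarrow> A s = A t" "A (Suc t') \<noteq> A t"
    "changes A t (Suc t') = 1" "changes A t u = Suc (changes A (Suc t') u)"
proof -
  define P where "P s \<longleftrightarrow> t \<le> s \<and> s < u \<and> A s \<noteq> A (Suc s)" for s
  have "{s \<in> {t..<u}. A s \<noteq> A (Suc s)} \<noteq> {}"
    using assms(1) unfolding changes_def by (metis card.empty less_numeral_extra(3))
  then have ex: "\<exists>s. P s" by (auto simp: P_def)
  define t' where "t' = (LEAST s. P s)"
  have P: "P t'" unfolding t'_def using ex by (rule LeastI_ex)
  have least: "\<not> P s" if "s < t'" for s
    using that not_less_Least unfolding t'_def by blast
  have const: "A s = A t" if "t \<le> s" "s \<le> t'" for s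
    using that
  proof (induction rule: dec_induct)
    case (step n)
    have "\<not> P n" using step by (intro least) auto
    then show ?case using step P by (auto simp: P_def)
  qed simp
  have c0: "changes A t t' = 0"
    using P least by (auto simp: changes_def P_def)
  have c1: "changes A t (Suc t') = 1"
    using changes_Suc[of t t' A] c0 P by (simp add: P_def)
  have "changes A t u = Suc (changes A (Suc t') u)"
    using changes_add[of t "Suc t'" u A] c1 P by (simp add: P_def)
  then show thesis
    using that[OF _ _ const _ c1] P const[of t'] by (auto simp: P_def)
qed

lemma ex_not_in_three:
  assumes "card L = 4"
  obtains d where "d \<in> L" "d \<noteq> a" "d \<noteq> b" "d \<noteq> c"
proof -
  have "\<not> L \<subseteq> {a, b, c}"
  proof
    assume "L \<subseteq> {a, b, c}"
    then have "card L \<le> card {a, b, c}" by (intro card_mono) auto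
    also have "\<dots> \<le> 3" by (simp add: card_insert_if)
    finally show False using assms by simp
  qed
  then show thesis using that by auto
qed

lemma four_eq:
  assumes "card L = 4" "L \<subseteq> {a, b, c, d}"
  shows "L = {a, b, c, d}" "distinct [a, b, c, d]"
proof -
  have fin: "finite {a, b, c, d}" by simp
  have "card {a, b, c, d} \<le> 4" by (simp add: card_insert_if)
  then show L: "L = {a, b, c, d}"
    using assms card_subset_eq[OF fin] card_mono[OF fin assms(2)] by simp
  show "distinct [a, b, c, d]"
    using assms(1) unfolding L by (auto simp: card_insert_if split: if_splits)
qed

text \<open>A path \<open>a x y b\<close> whose ends have the prescribed colors \<open>A t\<close> and \<open>B t\<close> at time \<open>t\<close>. The last four
  arguments are the colors of \<open>x\<close> and \<open>y\<close> and the number of their moves so far.\<close>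

inductive edge_play ::
  "'c set \<Rightarrow> 'c set \<Rightarrow> (nat \<Rightarrow> 'c) \<Rightarrow> (nat \<Rightarrow> 'c) \<Rightarrow> 'c \<Rightarrow> 'c
    \<Rightarrow> nat \<Rightarrow> 'c \<Rightarrow> 'c \<Rightarrow> nat \<Rightarrow> nat \<Rightarrow> bool"
  for Lx Ly A B x0 y0 where
  start: "x0 \<in> Lx \<Longrightarrow> y0 \<in> Ly \<Longrightarrow> x0 \<noteq> y0 \<Longrightarrow> x0 \<noteq> A 0 \<Longrightarrow> y0 \<noteq> B 0 \<Longrightarrow>
    edge_play Lx Ly A B x0 y0 0 x0 y0 0 0"
| move_x: "edge_play Lx Ly A B x0 y0 t x y m n \<Longrightarrow> d \<in> Lx \<Longrightarrow> d \<noteq> x \<Longrightarrow> d \<noteq> y \<Longrightarrow> d \<noteq> A t \<Longrightarrow>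
    edge_play Lx Ly A B x0 y0 t d y (Suc m) n"
| move_y: "edge_play Lx Ly A B x0 y0 t x y m n \<Longrightarrow> d \<in> Ly \<Longrightarrow> d \<noteq> y \<Longrightarrow> d \<noteq> x \<Longrightarrow> d \<noteq> B t \<Longrightarrow>
    edge_play Lx Ly A B x0 y0 t x d m (Suc n)"
| tick: "edge_play Lx Ly A B x0 y0 t x y m n \<Longrightarrow> x \<noteq> A (Suc t) \<Longrightarrow> y \<noteq> B (Suc t) \<Longrightarrow>
    edge_play Lx Ly A B x0 y0 (Suc t) x y m n"

lemma edge_play_swap:
  "edge_play Lx Ly A B x0 y0 t x y m n \<Longrightarrow> edge_play Ly Lx B A y0 x0 t y x n m"
proof (induction rule: edge_play.induct)
  case start
  then show ?case by (intro edge_play.start) auto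
next
  case (move_x t x y m n d)
  then show ?case by (intro edge_play.move_y) auto
next
  case (move_y t x y m n d)
  then show ?case by (intro edge_play.move_x) auto
next
  case (tick t x y m n)
  then show ?case by (intro edge_play.tick) auto
qed

lemma edge_play_valid:
  "edge_play Lx Ly A B x0 y0 t x y m n \<Longrightarrow>
    x \<in> Lx \<and> y \<in> Ly \<and> x \<noteq> y \<and> x \<noteq> A t \<and> y \<noteq> B t"
  by (induction rule: edge_play.induct) auto

locale edge_game =
  fixes Lx Ly :: "'c set" and A B :: "nat \<Rightarrow> 'c" and x0 y0 :: 'c
  assumes card_Lx: "card Lx = 4" and card_Ly: "card Ly = 4"
begin

abbreviation "play \<equiv> edge_play Lx Ly A B x0 y0"

text \<open>A clash is resolved just before the outer move: the new color has to avoid the present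
  color (which is the coming outer color), the partner's color and the present outer color, and four
  colors allow that.\<close>

lemma plain_step:
  assumes "play t x y m n"
  obtains x' y' m' n' where "play (Suc t) x' y' m' n'"
    "A (Suc t) \<noteq> x \<Longrightarrow> x' = x \<and> m' = m" "B (Suc t) \<noteq> y \<Longrightarrow> y' = y \<and> n' = n"
    "m' \<le> m + of_bool (A t \<noteq> A (Suc t))" "n' \<le> n + of_bool (B t \<noteq> B (Suc t))"
proof -
  note v = edge_play_valid[OF assms]
  obtain x' m' where x': "play t x' y m' n" "x' \<noteq> A (Suc t)"
    "A (Suc t) \<noteq> x \<Longrightarrow> x' = x \<and> m' = m" "m' \<le> m + of_bool (A t \<noteq> A (Suc t))"
  proof (cases "A (Suc t) = x")
    case True
    obtain d where "d \<in> Lx" "d \<noteq> x" "d \<noteq> y" "d \<noteq> A t"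
      using ex_not_in_three[OF card_Lx] by metis
    then have "play t d y (Suc m) n" using move_x[OF assms] by blast
    then show thesis using that[of d "Suc m"] True \<open>d \<noteq> x\<close> v by auto
  qed (use that[of x m] assms in auto)
  obtain y' n' where y': "play t x' y' m' n'" "y' \<noteq> B (Suc t)"
    "B (Suc t) \<noteq> y \<Longrightarrow> y' = y \<and> n' = n" "n' \<le> n + of_bool (B t \<noteq> B (Suc t))"
  proof (cases "B (Suc t) = y")
    case True
    obtain d where "d \<in> Ly" "d \<noteq> y" "d \<noteq> x'" "d \<noteq> B t"
      using ex_not_in_three[OF card_Ly] by metis
    then have "play t x' d m' (Suc n)" using move_y[OF x'(1)] by blast
    then show thesis using that[of d "Suc n"] True \<open>d \<noteq> y\<close> v by auto
  qed (use that[of y n] x' in auto)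
  show thesis
    using that[OF tick[OF y'(1) x'(2) y'(2)]] x' y' by blast
qed

lemma plain:
  assumes "t \<le> u" "play t x y m n"
  shows "\<exists>x' y' m' n'. play u x' y' m' n' \<and> m' \<le> m + changes A t u \<and> n' \<le> n + changes B t u"
  using assms(1)
proof (induction rule: dec_induct)
  case base
  then show ?case using assms(2) by auto
next
  case (step u)
  then obtain x' y' m' n' where IH: "play u x' y' m' n'" "m' \<le> m + changes A t u"
    "n' \<le> n + changes B t u" by blast
  obtain x'' y'' m'' n'' where "play (Suc u) x'' y'' m'' n''"
    "m'' \<le> m' + of_bool (A u \<noteq> A (Suc u))" "n'' \<le> n' + of_bool (B u \<noteq> B (Suc u))"
    using plain_step[OF IH(1)] by metis
  then show ?case using IH step by (intro exI[of _ x''] exI[of _ y''] exI[of _ m''] exI[of _ n'']) (simp add: changes_Suc)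
qed

text \<open>\<open>y\<close> never wears the color \<open>x\<close>, so a change of \<open>B\<close>
  to the color \<open>x\<close> cannot force \<open>y\<close> to move. Leaving such changes out of
  the count is what makes the refund in \<open>round_x\<close> possible.\<close>

lemma plain_x_fixed:
  assumes "t \<le> u" "play t x y m n" "\<And>s. t \<le> s \<Longrightarrow> s \<le> u \<Longrightarrow> A s \<noteq> x"
  shows "\<exists>y' n'. play u x y' m n' \<and> n' \<le> n + card {s \<in> {t..<u}. B s \<noteq> B (Suc s) \<and> B (Suc s) \<noteq> x}"
  using assms(1,3)
proof (induction rule: dec_induct)
  case base
  then show ?case using assms(2) by auto
next
  case (step u)
  then obtain y' n' where IH: "play u x y' m n'"
    "n' \<le> n + card {s \<in> {t..<u}. B s \<noteq> B (Suc s) \<and> B (Suc s) \<noteq> x}" by force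
  have "{s \<in> {t..<Suc u}. B s \<noteq> B (Suc s) \<and> B (Suc s) \<noteq> x}
      = {s \<in> {t..<u}. B s \<noteq> B (Suc s) \<and> B (Suc s) \<noteq> x}
        \<union> (if B u \<noteq> B (Suc u) \<and> B (Suc u) \<noteq> x then {u} else {})"
    using step(1) by (auto simp: less_Suc_eq)
  then have c: "card {s \<in> {t..<Suc u}. B s \<noteq> B (Suc s) \<and> B (Suc s) \<noteq> x}
      = card {s \<in> {t..<u}. B s \<noteq> B (Suc s) \<and> B (Suc s) \<noteq> x}
        + of_bool (B u \<noteq> B (Suc u) \<and> B (Suc u) \<noteq> x)"
    by (simp add: card_insert_if)
  have x: "A (Suc u) \<noteq> x" using step by simp
  note v = edge_play_valid[OF IH(1)]
  obtain x'' y'' m'' n'' where p: "play (Suc u) x'' y'' m'' n''" "x'' = x \<and> m'' = m"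
    "B (Suc u) \<noteq> y' \<Longrightarrow> y'' = y' \<and> n'' = n'" "n'' \<le> n' + of_bool (B u \<noteq> B (Suc u))"
    using plain_step[OF IH(1)] x by metis
  have "n'' \<le> n' + of_bool (B u \<noteq> B (Suc u) \<and> B (Suc u) \<noteq> x)"
    using p v by (cases "B (Suc u) = y'") auto
  then show ?case using IH(2) c p by (intro exI[of _ y''] exI[of _ n'']) auto
qed

lemma plain_x_fixed':
  assumes "t \<le> u" "play t x y m n" "\<And>s. t \<le> s \<Longrightarrow> s \<le> u \<Longrightarrow> A s \<noteq> x"
  shows "\<exists>y' n'. play u x y' m n' \<and> n' \<le> n + changes B t u"
proof -
  have "card {s \<in> {t..<u}. B s \<noteq> B (Suc s) \<and> B (Suc s) \<noteq> x} \<le> changes B t u"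
    unfolding changes_def by (intro card_mono) auto
  then show ?thesis using plain_x_fixed[OF assms] by (meson add_left_mono le_trans)
qed

lemma plain_fixed:
  assumes "t \<le> u" "play t x y m n" "\<And>s. t \<le> s \<Longrightarrow> s \<le> u \<Longrightarrow> A s \<noteq> x"
    "\<And>s. t \<le> s \<Longrightarrow> s \<le> u \<Longrightarrow> B s \<noteq> y"
  shows "play u x y m n"
  using assms(1,3,4)
proof (induction rule: dec_induct)
  case (step k)
  have "play k x y m n" using step by simp
  then show ?case using step(1) step(4)[of "Suc k"] step(5)[of "Suc k"] by (intro tick) auto
qed (use assms(2) in auto)


text \<open>Unless \<open>x\<close> can dodge two changes of \<open>A\<close> with one move, its list consists of its own color, the
  color of \<open>y\<close> and the present and next-but-one values of \<open>A\<close>. Then \<open>x\<close> takes over the color of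
  \<open>y\<close>, which moves away at the expense of one move; this move is refunded if \<open>B\<close> would have forced
  \<open>y\<close> to leave anyway.\<close>

lemma round_x:
  assumes p: "play t x y m n" and tu: "t \<le> u" and three: "changes A t u \<ge> 3"
  shows "\<exists>x' y' m' n'. play u x' y' m' n' \<and>
    (Suc m' \<le> m + changes A t u \<and> n' \<le> n + changes B t u \<or>
     Suc (Suc m') \<le> m + changes A t u \<and> n' \<le> Suc (n + changes B t u))"
    (is "\<exists>x' y' m' n'. ?goal x' y' m' n'")
proof -
  \<comment> \<open>A gain made by time \<open>s\<close> is kept until \<open>u\<close>, because
    plain play spends at most one move per outer change.\<close>
  have finish: ?thesis
    if prem: "play s x' y' m' n'" "t \<le> s" "s \<le> u"
      "Suc m' \<le> m + changes A t s \<and> n' \<le> n + changes B t s \<or>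
       Suc (Suc m') \<le> m + changes A t s \<and> n' \<le> Suc (n + changes B t s)" for s x' y' m' n'
  proof -
    obtain x'' y'' m'' n'' where "play u x'' y'' m'' n''" "m'' \<le> m' + changes A s u"
      "n'' \<le> n' + changes B s u"
      using plain[OF prem(3,1)] by blast
    then have "?goal x'' y'' m'' n''"
      using prem(4) changes_add[OF prem(2,3), of A] changes_add[OF prem(2,3), of B] by auto
    then show ?thesis by blast
  qed
  define a0 where "a0 = A t"
  obtain t1 a1 where t1: "t \<le> t1" "t1 < u" "\<And>s. t \<le> s \<Longrightarrow> s \<le> t1 \<Longrightarrow> A s = a0"
    "A (Suc t1) = a1" "a1 \<noteq> a0" "changes A t (Suc t1) = 1" "changes A t u = Suc (changes A (Suc t1) u)"
    using changes_pos_first[of A t u] three tu a0_def by (metis gr0I not_numeral_le_zero)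
  have "changes A (Suc t1) u > 0" using t1(7) three by simp
  then obtain t2 a2 where t2: "Suc t1 \<le> t2" "t2 < u" "\<And>s. Suc t1 \<le> s \<Longrightarrow> s \<le> t2 \<Longrightarrow> A s = a1"
    "A (Suc t2) = a2" "a2 \<noteq> a1" "changes A (Suc t1) (Suc t2) = 1"
    "changes A (Suc t1) u = Suc (changes A (Suc t2) u)"
    using changes_pos_first[of A "Suc t1" u] t1(2,4) by (metis Suc_leI)
  have "changes A (Suc t2) u > 0" using t1(7) t2(7) three by simp
  then obtain t3 a3 where t3: "Suc t2 \<le> t3" "t3 < u" "\<And>s. Suc t2 \<le> s \<Longrightarrow> s \<le> t3 \<Longrightarrow> A s = a2"
    "A (Suc t3) = a3" "a3 \<noteq> a2" "changes A (Suc t2) (Suc t3) = 1"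
    using changes_pos_first[of A "Suc t2" u] t2(2,4) by (metis Suc_leI)
  have c2: "changes A t (Suc t2) = 2"
    using changes_add[of t "Suc t1" "Suc t2" A] t1(1,6) t2(1,6) by simp
  have c3: "changes A t (Suc t3) = 3"
    using changes_add[of t "Suc t2" "Suc t3" A] t1(1) t2(1) t3(1,6) c2 by simp
  note v = edge_play_valid[OF p]
  obtain y1 n1 where p1: "play t1 x y1 m n1" and n1: "n1 \<le> n + changes B t t1"
    using plain_x_fixed'[OF t1(1) p] t1(1,3) v a0_def by (metis order_refl)
  note v1 = edge_play_valid[OF p1]
  have Bt1: "changes B t s = changes B t t1 + changes B t1 s" if "t1 \<le> s" for s
    using changes_add[OF t1(1) that] .
  show ?thesis
  proof (cases "a1 = x")
    case False
    \<comment> \<open>The first change does not hit \<open>x\<close> and passes without a move,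
      which is the saving.\<close>
    obtain y' n' where "play (Suc t1) x y' m n'" "n' \<le> n1 + changes B t1 (Suc t1)"
      using plain_x_fixed'[of t1 "Suc t1" x y1 m n1] p1 False v1 t1(4) by (metis le_SucE le_antisym lessI less_imp_le)
    then show ?thesis
      using finish[of "Suc t1" x y' m n'] t1 n1 Bt1[of "Suc t1"] by auto
  next
    case forced: True
    show ?thesis
    proof (cases "\<exists>d\<in>Lx. d \<noteq> a0 \<and> d \<noteq> x \<and> d \<noteq> y1 \<and> d \<noteq> a2")
      case True
      then obtain d where d: "d \<in> Lx" "d \<noteq> a0" "d \<noteq> x" "d \<noteq> y1" "d \<noteq> a2" by blast
      have "play t1 d y1 (Suc m) n1"
        using d t1(3)[of t1] t1(1) by (intro move_x[OF p1]) auto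
      moreover have "A s \<noteq> d" if st: "t1 \<le> s" "s \<le> Suc t2" for s
      proof -
        consider "s = t1" | "Suc t1 \<le> s" "s \<le> t2" | "s = Suc t2" using st by linarith
        then show ?thesis
          by cases (use t1 t2 d forced in auto)
      qed
      ultimately obtain y' n' where "play (Suc t2) d y' (Suc m) n'" "n' \<le> n1 + changes B t1 (Suc t2)"
        using plain_x_fixed'[of t1 "Suc t2" d y1 "Suc m" n1] t2(1) by auto
      then show ?thesis
        using finish[of "Suc t2" d y' "Suc m" n'] t1 t2 n1 c2 Bt1[of "Suc t2"] by auto
    next
      case False
      then have "Lx \<subseteq> {a0, x, y1, a2}" by blast
      note L = four_eq[OF card_Lx this]
      obtain d where d: "d \<in> Ly" "d \<noteq> y1" "d \<noteq> B t1" "d \<noteq> x"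
        using ex_not_in_three[OF card_Ly] by metis
      have "play t1 x d m (Suc n1)"
        using d by (intro move_y[OF p1]) auto
      then have swapped: "play t1 y1 d (Suc m) (Suc n1)"
        using d L v1 t1(1,3) by (intro move_x) auto
      have swapped2: "A s \<noteq> y1" if st: "t1 \<le> s" "s \<le> Suc t2" for s
      proof -
        consider "s = t1" | "Suc t1 \<le> s" "s \<le> t2" | "s = Suc t2" using st by linarith
        then show ?thesis
          by cases (use t1 t2 L forced in auto)
      qed
      show ?thesis
      proof (cases "\<exists>s. t1 \<le> s \<and> s \<le> t2 \<and> B s \<noteq> B (Suc s) \<and> B (Suc s) = y1")
        case True
        \<comment> \<open>Having left \<open>y1\<close> already, \<open>y\<close> need not answer
          the change of \<open>B\<close> to \<open>y1\<close>; the strict inequality pays for its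
          extra move.\<close>
        have "card {s \<in> {t1..<Suc t2}. B s \<noteq> B (Suc s) \<and> B (Suc s) \<noteq> y1} < changes B t1 (Suc t2)"
          unfolding changes_def
        proof (rule psubset_card_mono)
          obtain s where "t1 \<le> s" "s \<le> t2" "B s \<noteq> B (Suc s)" "B (Suc s) = y1" using True by blast
          then have "s \<in> {s \<in> {t1..<Suc t2}. B s \<noteq> B (Suc s)}"
            "s \<notin> {s \<in> {t1..<Suc t2}. B s \<noteq> B (Suc s) \<and> B (Suc s) \<noteq> y1}" by auto
          then show "{s \<in> {t1..<Suc t2}. B s \<noteq> B (Suc s) \<and> B (Suc s) \<noteq> y1}
            \<subset> {s \<in> {t1..<Suc t2}. B s \<noteq> B (Suc s)}" by blast
        qed simp
        moreover obtain y' n' where "play (Suc t2) y1 y' (Suc m) n'"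
          "n' \<le> Suc n1 + card {s \<in> {t1..<Suc t2}. B s \<noteq> B (Suc s) \<and> B (Suc s) \<noteq> y1}"
          using plain_x_fixed[OF _ swapped swapped2, of "Suc t2"] t2(1) by (meson Suc_leD le_SucI order_refl)
        ultimately show ?thesis
          using finish[of "Suc t2" y1 y' "Suc m" n'] t1 t2 n1 c2 Bt1[of "Suc t2"] by auto
      next
        case False
        have By1: "B s \<noteq> y1" if st: "t1 \<le> s" "s \<le> Suc t2" for s
          using st
        proof (induction rule: dec_induct)
          case (step k)
          then show ?case using False by auto
        qed (use v1 in auto)
        show ?thesis
        proof (cases "a3 = a0")
          case True
          \<comment> \<open>Since \<open>a3 = a0\<close>, the color \<open>y1\<close> outlasts the
            third change as well: one move of \<open>x\<close> answers three changes. The two moves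
            saved justify the extra move of \<open>y\<close>.\<close>
          have "A s \<noteq> y1" if st: "t1 \<le> s" "s \<le> Suc t3" for s
          proof -
            consider "s \<le> Suc t2" | "Suc t2 \<le> s" "s \<le> t3" | "s = Suc t3" using st by linarith
            then show ?thesis
              by cases (use t3(3,4) L swapped2 True st in auto)
          qed
          then obtain y' n' where "play (Suc t3) y1 y' (Suc m) n'"
            "n' \<le> Suc n1 + changes B t1 (Suc t3)"
            using plain_x_fixed'[OF _ swapped, of "Suc t3"] t2(1) t3(1) by auto
          then show ?thesis
            using finish[of "Suc t3" y1 y' "Suc m" n'] t1 t2 t3 n1 c3 Bt1[of "Suc t3"] by auto
        next
          case False
          \<comment> \<open>Here the exchange with \<open>y\<close> is not made. \<open>x\<close>
            waits on \<open>a2\<close> until \<open>t2\<close> and then takes \<open>a0\<close>,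
            which outlasts the second and the third change; \<open>y\<close> can stay on
            \<open>y1\<close> because \<open>B\<close> avoids it meanwhile. Two moves answer three
            changes, and \<open>y\<close> pays nothing extra.\<close>
          have "play t1 a2 y1 (Suc m) n1"
            using L t1(1,3) by (intro move_x[OF p1]) auto
          then have "play t2 a2 y1 (Suc m) n1"
          proof (rule plain_fixed[rotated])
            show "A s \<noteq> a2" if st: "t1 \<le> s" "s \<le> t2" for s
            proof -
              consider "s = t1" | "Suc t1 \<le> s" "s \<le> t2" using st by linarith
              then show ?thesis by cases (use t1 t2 L forced in auto)
            qed
          qed (use t2(1) By1 in auto)
          moreover have "A t2 = a1" using t2(1) t2(3)[of t2] by simp
          ultimately have "play t2 a0 y1 (Suc (Suc m)) n1"
            using edge_play.move_x[of Lx Ly A B x0 y0 t2 a2 y1 "Suc m" n1 a0] L t1(5) by simp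
          moreover have "A s \<noteq> a0" if st: "t2 \<le> s" "s \<le> Suc t3" for s
          proof -
            consider "s = t2" | "Suc t2 \<le> s" "s \<le> t3" | "s = Suc t3" using st by linarith
            then show ?thesis by cases (use t1(5) t2(1) t2(3)[of t2] t3(3,4) L False in auto)
          qed
          ultimately obtain y' n' where "play (Suc t3) a0 y' (Suc (Suc m)) n'"
            "n' \<le> n1 + changes B t2 (Suc t3)"
            using plain_x_fixed'[of t2 "Suc t3"] t3(1) by (metis Suc_leD le_SucI)
          moreover have "changes B t2 (Suc t3) \<le> changes B t1 (Suc t3)"
            using changes_add[of t1 t2 "Suc t3" B] t2(1) t3(1) by simp
          ultimately show ?thesis
            using finish[of "Suc t3" "a0" y' "Suc (Suc m)" n'] t1 t2 t3 n1 c3 Bt1[of "Suc t3"] by auto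
        qed
      qed
    qed
  qed
qed


lemma round_y:
  assumes p: "play t x y m n" and tu: "t \<le> u" and three: "changes B t u \<ge> 3"
  shows "\<exists>x' y' m' n'. play u x' y' m' n' \<and>
    (m' \<le> m + changes A t u \<and> Suc n' \<le> n + changes B t u \<or>
     m' \<le> Suc (m + changes A t u) \<and> Suc (Suc n') \<le> n + changes B t u)"
proof -
  interpret swap: edge_game Ly Lx B A y0 x0
    using card_Lx card_Ly by unfold_locales
  show ?thesis
    using swap.round_x[OF edge_play_swap[OF p] tu three] edge_play_swap[of Ly Lx B A y0 x0 u] by metis
qed

end

text \<open>A count grows by at most one per time step, so when the first of the two reaches 3,
  neither exceeds 3.\<close>

lemma changes_earliest:
  assumes "changes A t T \<ge> 3 \<or> changes B t T \<ge> 3" "t \<le> T"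
  obtains u where "t \<le> u" "u \<le> T" "changes A t u \<le> 3" "changes B t u \<le> 3"
    "changes A t u = 3 \<or> changes B t u = 3"
proof -
  define P where "P u \<longleftrightarrow> t \<le> u \<and> (changes A t u \<ge> 3 \<or> changes B t u \<ge> 3)" for u
  have ex: "P T" using assms by (auto simp: P_def)
  define u where "u = (LEAST u. P u)"
  have Pu: "P u" unfolding u_def using ex by (rule LeastI)
  have "u \<le> T" unfolding u_def using ex by (rule Least_le)
  moreover have "u \<noteq> t" using Pu by (auto simp: P_def)
  then obtain w where w: "u = Suc w" "t \<le> w"
    using Pu unfolding P_def by (metis Suc_le_D le_antisym not_less_eq_eq)
  moreover have "\<not> P w" using not_less_Least[of w P] w(1) unfolding u_def by simp
  ultimately show thesis
    using that[of u] Pu by (auto simp: P_def changes_Suc of_bool_def split: if_splits)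
qed

lemma changes_earliest_one:
  assumes "changes A t T \<ge> 3" "t \<le> T"
  obtains u where "t \<le> u" "u \<le> T" "changes A t u = 3"
  using changes_earliest[of A t T A] assms by metis

section \<open>Scheduling the rounds of the edge game within the budget\<close>

context edge_game
begin

text \<open>\<open>i\<close> and \<open>j\<close> bound how far \<open>x\<close> and \<open>y\<close> stay below the budget 18, once all remaining
  changes of their outer neighbors are charged to them in advance. A side stops being saved for
  once it has a surplus of 3.\<close>

lemma save_both:
  fixes i j :: int and T :: nat
  defines "enough \<equiv> \<lambda>i j :: int. i \<ge> 2 \<and> j \<ge> 1 \<or> i \<ge> 1 \<and> j \<ge> 2"
  assumes "play t x y m n" "t \<le> T"
    "int m + int (changes A t T) + i \<le> 18" "int n + int (changes B t T) + j \<le> 18"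
    "\<not> enough i j \<Longrightarrow> i \<le> 2 \<Longrightarrow> int (changes A t T) + 3 * (i + j) \<ge> 18"
    "\<not> enough i j \<Longrightarrow> j \<le> 2 \<Longrightarrow> int (changes B t T) + 3 * (i + j) \<ge> 18"
    "i \<le> 4" "j \<le> 4" "i + j \<ge> 1 \<or> i = 0 \<and> j = 0" "i \<ge> 3 \<or> j \<ge> 3 \<Longrightarrow> i + j \<ge> 2"
  shows "\<exists>x' y' m' n'. play T x' y' m' n' \<and> (m' \<le> 16 \<and> n' \<le> 17 \<or> m' \<le> 17 \<and> n' \<le> 16)"
  using assms(2-)
proof (induction "nat (9 - i - j)" arbitrary: i j t x y m n rule: less_induct)
  case less
  note p = less.prems(1) and tT = less.prems(2)
  show ?case
  proof (cases "enough i j")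
    case True
    obtain x' y' m' n' where "play T x' y' m' n'" "m' \<le> m + changes A t T" "n' \<le> n + changes B t T"
      using plain[OF tT p] by blast
    moreover from this True less.prems(3,4)
    have "m' \<le> 16 \<and> n' \<le> 17 \<or> m' \<le> 17 \<and> n' \<le> 16" unfolding enough_def by linarith
    ultimately show ?thesis by blast
  next
    case False
    note e = False[unfolded enough_def]
    \<comment> \<open>Without \<open>enough\<close>, \<open>i <= 0\<close> or \<open>j <= 0\<close>
      or \<open>i = j = 1\<close>. As both are at most 4, \<open>i + j <= 4\<close>, so an
      unsaturated side still has at least 18 - 12 changes ahead.\<close>
    have A3: "changes A t T \<ge> 3" if "i \<le> 2"
      using less.prems(5)[OF False that] less.prems(7,8) e that by presburger
    have B3: "changes B t T \<ge> 3" if "j \<le> 2"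
      using less.prems(6)[OF False that] less.prems(7,8) e that by presburger
    \<comment> \<open>Both outcomes of a round raise \<open>i + j\<close> by exactly one, and an
      unsaturated side loses at most three outer changes meanwhile. Hence the inequalities with 18
      are preserved.\<close>
    have X: ?thesis
      if u: "t \<le> u" "u \<le> T" "changes A t u = 3" "j \<le> 2 \<Longrightarrow> changes B t u \<le> 3" "i \<le> 2" for u
    proof -
      have c: "changes A t T = 3 + changes A u T" "changes B t T = changes B t u + changes B u T"
        using changes_add[OF u(1,2), of A] changes_add[OF u(1,2), of B] u(3) by auto
      obtain x' y' m' n' where p': "play u x' y' m' n'" and mn:
        "Suc m' \<le> m + 3 \<and> n' \<le> n + changes B t u \<or>
         Suc (Suc m') \<le> m + 3 \<and> n' \<le> Suc (n + changes B t u)"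
        using round_x[OF p u(1)] u(3) by auto
      note facts = less.prems(3,4,7-10) c u(5) e
      from mn show ?thesis
      proof
        assume mn: "Suc m' \<le> m + 3 \<and> n' \<le> n + changes B t u"
        show ?thesis
        proof (rule less.hyps[OF _ p' u(2), of "i + 1" j])
          show "int (changes B u T) + 3 * (i + 1 + j) \<ge> 18" if "j \<le> 2"
            using less.prems(6)[OF False that] u(4)[OF that] c(2) by (simp add: algebra_simps)
          show "int (changes A u T) + 3 * (i + 1 + j) \<ge> 18"
            using less.prems(5)[OF False u(5)] c(1) by (simp add: algebra_simps)
        qed (use facts mn in linarith)+
      next
        assume mn: "Suc (Suc m') \<le> m + 3 \<and> n' \<le> Suc (n + changes B t u)"
        show ?thesis
        proof (rule less.hyps[OF _ p' u(2), of "i + 2" "j - 1"])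
          show "int (changes B u T) + 3 * (i + 2 + (j - 1)) \<ge> 18"
            if "j - 1 \<le> 2" "\<not> enough (i + 2) (j - 1)"
          proof -
            \<comment> \<open>A saturated side does not reopen: if \<open>j = 3\<close> drops to 2,
              the invariant \<open>i + j >= 2\<close> gives \<open>i + 2 >= 1\<close>, and
              \<open>enough\<close> is reached.\<close>
            have "j \<le> 2" using that facts unfolding enough_def by linarith
            then show ?thesis
              using less.prems(6)[OF False] u(4) c(2) by (simp add: algebra_simps)
          qed
          show "int (changes A u T) + 3 * (i + 2 + (j - 1)) \<ge> 18"
            using less.prems(5)[OF False u(5)] c(1) by (simp add: algebra_simps)
        qed (use facts mn in linarith)+
      qed
    qed
    have Y: ?thesis
      if u: "t \<le> u" "u \<le> T" "changes B t u = 3" "i \<le> 2 \<Longrightarrow> changes A t u \<le> 3" "j \<le> 2" for u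
    proof -
      have c: "changes B t T = 3 + changes B u T" "changes A t T = changes A t u + changes A u T"
        using changes_add[OF u(1,2), of A] changes_add[OF u(1,2), of B] u(3) by auto
      obtain x' y' m' n' where p': "play u x' y' m' n'" and mn:
        "m' \<le> m + changes A t u \<and> Suc n' \<le> n + 3 \<or>
         m' \<le> Suc (m + changes A t u) \<and> Suc (Suc n') \<le> n + 3"
        using round_y[OF p u(1)] u(3) by auto
      note facts = less.prems(3,4,7-10) c u(5) e
      from mn show ?thesis
      proof
        assume mn: "m' \<le> m + changes A t u \<and> Suc n' \<le> n + 3"
        show ?thesis
        proof (rule less.hyps[OF _ p' u(2), of i "j + 1"])
          show "int (changes A u T) + 3 * (i + (j + 1)) \<ge> 18" if "i \<le> 2"
            using less.prems(5)[OF False that] u(4)[OF that] c(2) by (simp add: algebra_simps)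
          show "int (changes B u T) + 3 * (i + (j + 1)) \<ge> 18"
            using less.prems(6)[OF False u(5)] c(1) by (simp add: algebra_simps)
        qed (use facts mn in linarith)+
      next
        assume mn: "m' \<le> Suc (m + changes A t u) \<and> Suc (Suc n') \<le> n + 3"
        show ?thesis
        proof (rule less.hyps[OF _ p' u(2), of "i - 1" "j + 2"])
          show "int (changes A u T) + 3 * (i - 1 + (j + 2)) \<ge> 18"
            if "i - 1 \<le> 2" "\<not> enough (i - 1) (j + 2)"
          proof -
            have "i \<le> 2" using that facts unfolding enough_def by linarith
            then show ?thesis
              using less.prems(5)[OF False] u(4) c(2) by (simp add: algebra_simps)
          qed
          show "int (changes B u T) + 3 * (i - 1 + (j + 2)) \<ge> 18"
            using less.prems(6)[OF False u(5)] c(1) by (simp add: algebra_simps)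
        qed (use facts mn in linarith)+
      qed
    qed
    consider "i \<le> 2" "j \<ge> 3" | "i \<ge> 3" "j \<le> 2" | "i \<le> 2" "j \<le> 2"
      using e by linarith
    then show ?thesis
    proof cases
      case 1
      then show ?thesis using changes_earliest_one[OF A3 tT] X by (smt (verit))
    next
      case 2
      then show ?thesis using changes_earliest_one[OF B3 tT] Y by (smt (verit))
    next
      case 3
      then show ?thesis using changes_earliest[of A t T B] A3 tT X Y by metis
    qed
  qed
qed

text \<open>The only obstruction is an exchange, with \<open>x\<close> wearing \<open>y1\<close> and
  \<open>y\<close> wearing \<open>x1\<close>: one of them must first step aside. The vertex with at
  most 16 moves does so and makes two moves, the other makes one.\<close>

lemma edge_game_end:
  assumes p: "play T x y m n" and v: "x1 \<in> Lx" "y1 \<in> Ly" "x1 \<noteq> y1" "x1 \<noteq> A T" "y1 \<noteq> B T"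
    and mn: "m \<le> 16 \<and> n \<le> 17 \<or> m \<le> 17 \<and> n \<le> 16"
  shows "\<exists>m' n'. play T x1 y1 m' n' \<and> m' \<le> 18 \<and> n' \<le> 18"
proof -
  note w = edge_play_valid[OF p]
  have set_x: "\<exists>m'. play T x1 y' m' n' \<and> m' \<le> Suc k" if "play T x' y' k n'" "y' \<noteq> x1" for x' y' k n'
    using move_x[OF that(1) v(1)] that v by (cases "x' = x1") auto
  have set_y: "\<exists>n'. play T x' y1 k n' \<and> n' \<le> Suc n''" if "play T x' y' k n''" "x' \<noteq> y1" for x' y' k n''
    using move_y[OF that(1) v(2)] that v by (cases "y' = y1") auto
  consider "y \<noteq> x1" | "x \<noteq> y1" | "y = x1" "x = y1" "m \<le> 16" | "y = x1" "x = y1" "n \<le> 16"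
    using mn by blast
  then show ?thesis
  proof cases
    case 1
    obtain m' where "play T x1 y m' n" "m' \<le> Suc m" using set_x[OF p 1] by blast
    moreover from set_y[OF this(1) v(3)] obtain n' where "play T x1 y1 m' n'" "n' \<le> Suc n" by blast
    ultimately show ?thesis using mn by (intro exI[of _ m'] exI[of _ n']) auto
  next
    case 2
    obtain n' where "play T x y1 m n'" "n' \<le> Suc n" using set_y[OF p 2] by blast
    moreover from set_x[OF this(1)] v(3) obtain m' where "play T x1 y1 m' n'" "m' \<le> Suc m" by metis
    ultimately show ?thesis using mn by (intro exI[of _ m'] exI[of _ n']) auto
  next
    case 3
    obtain d where d: "d \<in> Lx" "d \<noteq> x" "d \<noteq> y" "d \<noteq> A T" using ex_not_in_three[OF card_Lx] by metis
    then have "play T d y (Suc m) n" using move_x[OF p] by blast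
    then obtain n' where n': "play T d y1 (Suc m) n'" "n' \<le> Suc n" using set_y 3 d by metis
    then obtain m' where "play T x1 y1 m' n'" "m' \<le> Suc (Suc m)" using set_x v(3) by metis
    then show ?thesis using n' mn 3 by (intro exI[of _ m'] exI[of _ n']) auto
  next
    case 4
    obtain d where d: "d \<in> Ly" "d \<noteq> y" "d \<noteq> x" "d \<noteq> B T" using ex_not_in_three[OF card_Ly] by metis
    then have "play T x d m (Suc n)" using move_y[OF p] by blast
    then obtain m' where m': "play T x1 d m' (Suc n)" "m' \<le> Suc m" using set_x 4 d by metis
    then obtain n' where "play T x1 y1 m' n'" "n' \<le> Suc (Suc n)" using set_y v(3) by metis
    then show ?thesis using m' mn 4 by (intro exI[of _ m'] exI[of _ n']) auto
  qed
qed

lemma edge_game_solvable: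
  assumes start: "x0 \<in> Lx" "y0 \<in> Ly" "x0 \<noteq> y0" "x0 \<noteq> A 0" "y0 \<noteq> B 0"
    and goal: "x1 \<in> Lx" "y1 \<in> Ly" "x1 \<noteq> y1" "x1 \<noteq> A T" "y1 \<noteq> B T"
    and A: "changes A 0 T \<le> 18" and B: "changes B 0 T \<le> 18"
  shows "\<exists>m n. play T x1 y1 m n \<and> m \<le> 18 \<and> n \<le> 18"
proof -
  \<comment> \<open>Outer changes missing from 18 count as initial surplus. It is cut off at 4, the
    largest value that \<open>save_both\<close> admits: a side served at surplus 2 may gain
    two.\<close>
  define i where "i = min 4 (18 - int (changes A 0 T))"
  define j where "j = min 4 (18 - int (changes B 0 T))"
  have "0 \<le> i" "0 \<le> j" using A B by (auto simp: i_def j_def)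
  have "\<exists>x y m n. play T x y m n \<and> (m \<le> 16 \<and> n \<le> 17 \<or> m \<le> 17 \<and> n \<le> 16)"
  proof (rule save_both[of 0 x0 y0 0 0 T i j])
    show "play 0 x0 y0 0 0" using start by (intro edge_play.start)
  qed (use A B in \<open>auto simp: i_def j_def min_def\<close>)
  then show ?thesis using edge_game_end goal by blast
qed

end

section \<open>A vertex of degree 3 with three neighbors of degree 2\<close>

text \<open>The leaf \<open>i\<close> has the outer neighbor color \<open>A i t\<close> at time \<open>t\<close>; the center has no outer neighbor.\<close>

inductive star_play ::
  "'i set \<Rightarrow> 'c set \<Rightarrow> ('i \<Rightarrow> 'c set) \<Rightarrow> ('i \<Rightarrow> nat \<Rightarrow> 'c) \<Rightarrow> 'c \<Rightarrow> ('i \<Rightarrow> 'c)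
    \<Rightarrow> nat \<Rightarrow> 'c \<Rightarrow> ('i \<Rightarrow> 'c) \<Rightarrow> nat \<Rightarrow> ('i \<Rightarrow> nat) \<Rightarrow> bool"
  for I Lv Lx A c0 X0 where
  start: "c0 \<in> Lv \<Longrightarrow> (\<And>i. i \<in> I \<Longrightarrow> X0 i \<in> Lx i \<and> X0 i \<noteq> c0 \<and> X0 i \<noteq> A i 0) \<Longrightarrow>
    star_play I Lv Lx A c0 X0 0 c0 X0 0 (\<lambda>_. 0)"
| center: "star_play I Lv Lx A c0 X0 t c X k m \<Longrightarrow> d \<in> Lv \<Longrightarrow> d \<noteq> c \<Longrightarrow> (\<And>i. i \<in> I \<Longrightarrow> X i \<noteq> d) \<Longrightarrow>
    star_play I Lv Lx A c0 X0 t d X (Suc k) m"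
| leaf: "star_play I Lv Lx A c0 X0 t c X k m \<Longrightarrow> i \<in> I \<Longrightarrow> d \<in> Lx i \<Longrightarrow> d \<noteq> X i \<Longrightarrow> d \<noteq> c \<Longrightarrow> d \<noteq> A i t \<Longrightarrow>
    star_play I Lv Lx A c0 X0 t c (X(i := d)) k (m(i := Suc (m i)))"
| tick: "star_play I Lv Lx A c0 X0 t c X k m \<Longrightarrow> (\<And>i. i \<in> I \<Longrightarrow> X i \<noteq> A i (Suc t)) \<Longrightarrow>
    star_play I Lv Lx A c0 X0 (Suc t) c X k m"

lemma star_play_valid:
  assumes "star_play I Lv Lx A c0 X0 t c X k m"
  shows "c \<in> Lv" "i \<in> I \<Longrightarrow> X i \<in> Lx i" "i \<in> I \<Longrightarrow> X i \<noteq> c" "i \<in> I \<Longrightarrow> X i \<noteq> A i t"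
  using assms by (induction arbitrary: i rule: star_play.induct) auto

locale star_game =
  fixes I :: "'i set" and Lv :: "'c set" and Lx :: "'i \<Rightarrow> 'c set" and A :: "'i \<Rightarrow> nat \<Rightarrow> 'c"
    and c0 :: 'c and X0 :: "'i \<Rightarrow> 'c"
  assumes fin: "finite I" and card_I: "card I \<le> 3"
    and card_Lv: "card Lv = 4" and card_Lx: "\<And>i. i \<in> I \<Longrightarrow> card (Lx i) = 4"
begin

abbreviation "play \<equiv> star_play I Lv Lx A c0 X0"

text \<open>Leaves do not constrain one another, so a simultaneous move can be carried out leaf by
  leaf in any order.\<close>

lemma move_leaves:
  assumes "play t c X k m" "J \<subseteq> I"
    and "\<And>i. i \<in> J \<Longrightarrow> Y i \<in> Lx i \<and> Y i \<noteq> c \<and> Y i \<noteq> A i t"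
  shows "play t c (\<lambda>i. if i \<in> J then Y i else X i) k (\<lambda>i. m i + of_bool (i \<in> J \<and> Y i \<noteq> X i))"
proof -
  have "finite J" using fin assms(2) finite_subset by blast
  then show ?thesis
    using assms(2,3)
  proof (induction rule: finite_induct)
    case empty
    then show ?case using assms(1) by simp
  next
    case (insert j J)
    let ?X = "\<lambda>i. if i \<in> J then Y i else X i" and ?m = "\<lambda>i. m i + of_bool (i \<in> J \<and> Y i \<noteq> X i)"
    have IH: "play t c ?X k ?m" using insert by simp
    show ?case
    proof (cases "Y j = X j")
      case True
      then have "(\<lambda>i. if i \<in> insert j J then Y i else X i) = ?X"
        "(\<lambda>i. m i + of_bool (i \<in> insert j J \<and> Y i \<noteq> X i)) = ?m" using insert(2) by auto
      then show ?thesis using IH by simp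
    next
      case False
      have "play t c (?X(j := Y j)) k (?m(j := Suc (?m j)))"
        using insert False by (intro leaf[OF IH]) auto
      moreover have "(\<lambda>i. if i \<in> insert j J then Y i else X i) = ?X(j := Y j)" by auto
      moreover have "(\<lambda>i. m i + of_bool (i \<in> insert j J \<and> Y i \<noteq> X i)) = ?m(j := Suc (?m j))"
        using insert(2) False by auto
      ultimately show ?thesis by simp
    qed
  qed
qed

lemma plain_step:
  assumes "play t c X k m"
  obtains X' m' where "play (Suc t) c X' k m'"
    "\<And>i. A i (Suc t) \<noteq> X i \<Longrightarrow> X' i = X i \<and> m' i = m i"
    "\<And>i. i \<in> I \<Longrightarrow> m' i \<le> m i + of_bool (A i t \<noteq> A i (Suc t))"
proof -
  define J where "J = {i \<in> I. A i (Suc t) = X i}"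
  have "\<exists>d. d \<in> Lx i \<and> d \<noteq> X i \<and> d \<noteq> c \<and> d \<noteq> A i t" if "i \<in> I" for i
    using ex_not_in_three[OF card_Lx[OF that]] by metis
  then obtain Y where Y: "\<And>i. i \<in> I \<Longrightarrow> Y i \<in> Lx i \<and> Y i \<noteq> X i \<and> Y i \<noteq> c \<and> Y i \<noteq> A i t"
    by metis
  let ?X = "\<lambda>i. if i \<in> J then Y i else X i"
  have "play t c ?X k (\<lambda>i. m i + of_bool (i \<in> J \<and> Y i \<noteq> X i))"
    using Y by (intro move_leaves[OF assms]) (auto simp: J_def)
  then have "play (Suc t) c ?X k (\<lambda>i. m i + of_bool (i \<in> J \<and> Y i \<noteq> X i))"
    using Y by (intro tick) (auto simp: J_def)
  then show thesis
    by (rule that) (use star_play_valid(4)[OF assms] in \<open>force simp: J_def\<close>)+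
qed

text \<open>The last conclusion lets the leaf being served stand still on a safe color while the
  other leaves react to their own neighbors.\<close>

lemma plain:
  assumes "t \<le> u" "play t c X k m"
  shows "\<exists>X' m'. play u c X' k m' \<and> (\<forall>i\<in>I. m' i \<le> m i + changes (A i) t u) \<and>
    (\<forall>i. (\<forall>s. t \<le> s \<longrightarrow> s \<le> u \<longrightarrow> A i s \<noteq> X i) \<longrightarrow> X' i = X i \<and> m' i = m i)"
  using assms(1)
proof (induction rule: dec_induct)
  case base
  then show ?case using assms(2) by (intro exI[of _ X] exI[of _ m]) auto
next
  case (step w)
  then obtain X' m' where IH: "play w c X' k m'" "\<And>i. i \<in> I \<Longrightarrow> m' i \<le> m i + changes (A i) t w"
    "\<And>i. (\<And>s. t \<le> s \<Longrightarrow> s \<le> w \<Longrightarrow> A i s \<noteq> X i) \<Longrightarrow> X' i = X i \<and> m' i = m i" by metis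
  obtain X'' m'' where s: "play (Suc w) c X'' k m''"
    "\<And>i. A i (Suc w) \<noteq> X' i \<Longrightarrow> X'' i = X' i \<and> m'' i = m' i"
    "\<And>i. i \<in> I \<Longrightarrow> m'' i \<le> m' i + of_bool (A i w \<noteq> A i (Suc w))"
    using plain_step[OF IH(1)] by metis
  have "m'' i \<le> m i + changes (A i) t (Suc w)" if "i \<in> I" for i
    using IH(2)[OF that] s(3)[OF that] changes_Suc[OF step(1), of "A i"] by linarith
  moreover have "X'' i = X i \<and> m'' i = m i" if a: "\<forall>s. t \<le> s \<longrightarrow> s \<le> Suc w \<longrightarrow> A i s \<noteq> X i" for i
    using IH(3)[of i] s(2)[of i] a step(1) by (metis le_SucI order_refl)
  ultimately show ?case using s(1) by blast
qed

text \<open>If the center cannot free its color for the leaf \<open>i\<close>, then every other color of its list is the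
  color of some leaf. Once \<open>i\<close> has moved, the center takes the old color of \<open>i\<close>, which is now also the color of
  the outer neighbor, and at the next forced move \<open>i\<close> has two colors to choose from.\<close>

lemma round:
  assumes p: "play t c X k m" and tu: "t \<le> u" and iI: "i \<in> I" and three: "changes (A i) t u \<ge> 3"
  shows "\<exists>c' X' k' m'. play u c' X' k' m' \<and> k' \<le> Suc k \<and> Suc (m' i) \<le> m i + changes (A i) t u \<and>
    (\<forall>j\<in>I. m' j \<le> m j + changes (A j) t u)" (is "\<exists>c' X' k' m'. ?goal c' X' k' m'")
proof -
  have finish: ?thesis
    if prem: "play s c' X' k' m'" "t \<le> s" "s \<le> u" "k' \<le> Suc k" "Suc (m' i) \<le> m i + changes (A i) t s"
      "\<And>j. j \<in> I \<Longrightarrow> j \<noteq> i \<Longrightarrow> m' j \<le> m j + changes (A j) t s" for s c' X' k' m'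
  proof -
    obtain X'' m'' where q: "play u c' X'' k' m''" "\<And>j. j \<in> I \<Longrightarrow> m'' j \<le> m' j + changes (A j) s u"
      using plain[OF prem(3,1)] by metis
    have ch: "changes (A j) t u = changes (A j) t s + changes (A j) s u" for j
      using changes_add[OF prem(2,3)] .
    have "m'' j \<le> m j + changes (A j) t u" if "j \<in> I" for j
      using q(2)[OF that] prem(5) prem(6)[OF that] ch[of j] by (cases "j = i") auto
    moreover have "Suc (m'' i) \<le> m i + changes (A i) t u"
      using q(2)[OF iI] prem(5) ch[of i] by linarith
    ultimately show ?thesis using q(1) prem(4) by blast
  qed
  define a0 where "a0 = A i t"
  obtain t1 a1 where t1: "t \<le> t1" "t1 < u" "\<And>s. t \<le> s \<Longrightarrow> s \<le> t1 \<Longrightarrow> A i s = a0"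
    "A i (Suc t1) = a1" "a1 \<noteq> a0" "changes (A i) t (Suc t1) = 1"
    "changes (A i) t u = Suc (changes (A i) (Suc t1) u)"
    using changes_pos_first[of "A i" t u] three tu a0_def by (metis gr0I not_numeral_le_zero)
  have "changes (A i) (Suc t1) u > 0" using t1(7) three by simp
  then obtain t2 a2 where t2: "Suc t1 \<le> t2" "t2 < u"
    "\<And>s. Suc t1 \<le> s \<Longrightarrow> s \<le> t2 \<Longrightarrow> A i s = a1"
    "A i (Suc t2) = a2" "a2 \<noteq> a1" "changes (A i) (Suc t1) (Suc t2) = 1"
    "changes (A i) (Suc t1) u = Suc (changes (A i) (Suc t2) u)"
    using changes_pos_first[of "A i" "Suc t1" u] t1(2,4) by (metis Suc_leI)
  have "changes (A i) (Suc t2) u > 0" using t1(7) t2(7) three by simp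
  then obtain t3 a3 where t3: "Suc t2 \<le> t3" "t3 < u"
    "\<And>s. Suc t2 \<le> s \<Longrightarrow> s \<le> t3 \<Longrightarrow> A i s = a2"
    "A i (Suc t3) = a3" "a3 \<noteq> a2" "changes (A i) (Suc t2) (Suc t3) = 1"
    using changes_pos_first[of "A i" "Suc t2" u] t2(2,4) by (metis Suc_leI)
  have c2: "changes (A i) t (Suc t2) = 2"
    using changes_add[of t "Suc t1" "Suc t2" "A i"] t1(1,6) t2(1,6) by simp
  have c3: "changes (A i) t (Suc t3) = 3"
    using changes_add[of t "Suc t2" "Suc t3" "A i"] t1(1) t2(1) t3(1,6) c2 by simp
  have xt: "X i \<noteq> a0" using star_play_valid(4)[OF p iI] a0_def by simp
  obtain X1 m1 where p1: "play t1 c X1 k m1" and m1: "\<And>j. j \<in> I \<Longrightarrow> m1 j \<le> m j + changes (A j) t t1"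
    and "X1 i = X i \<and> m1 i = m i"
    using plain[OF t1(1) p] xt t1(3) by metis
  define x where "x = X1 i"
  have m1i: "m1 i = m i" using \<open>X1 i = X i \<and> m1 i = m i\<close> by simp
  have At1: "A i t1 = a0" using t1(1,3) by simp
  have xv: "x \<in> Lx i" "x \<noteq> c" "x \<noteq> a0"
    using star_play_valid(2-4)[OF p1 iI] At1 by (auto simp: x_def)
  have run: ?thesis
    if q: "play t1 c' X' k' m'" "k' \<le> Suc k" "t1 \<le> s" "s \<le> u"
      "\<And>r. t1 \<le> r \<Longrightarrow> r \<le> s \<Longrightarrow> A i r \<noteq> X' i" "Suc (m' i) \<le> m i + changes (A i) t s"
      "\<And>j. j \<noteq> i \<Longrightarrow> m' j = m1 j" for c' X' k' m' s
  proof -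
    obtain X'' m'' where q': "play s c' X'' k' m''" "m'' i = m' i"
      "\<And>j. j \<in> I \<Longrightarrow> m'' j \<le> m' j + changes (A j) t1 s"
      using plain[OF q(3,1)] q(5) by metis
    show ?thesis
    proof (rule finish[OF q'(1)])
      fix j assume "j \<in> I" "j \<noteq> i"
      then show "m'' j \<le> m j + changes (A j) t s"
        using q'(3)[of j] q(7)[of j] m1[of j] changes_add[OF t1(1) q(3), of "A j"] by simp
    qed (use q q' t1(1) in auto)
  qed
  show ?thesis
  proof (cases "a1 = x")
    case False
    show ?thesis
    proof (rule run[OF p1])
      show "A i r \<noteq> X1 i" if "t1 \<le> r" "r \<le> Suc t1" for r
        using that False At1 xv(3) t1(4) x_def by (metis le_SucE le_antisym)
    qed (use t1 m1i in auto)
  next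
    case forced: True
    have A_until_2: "A i r \<in> {a0, x, a2}" if "t1 \<le> r" "r \<le> Suc t2" for r
    proof -
      consider "r = t1" | "Suc t1 \<le> r" "r \<le> t2" | "r = Suc t2" using \<open>t1 \<le> r\<close> \<open>r \<le> Suc t2\<close> by linarith
      then show ?thesis
        by cases (use At1 t2(3,4) forced in auto)
    qed
    show ?thesis
    proof (cases "\<exists>d\<in>Lx i. d \<noteq> a0 \<and> d \<noteq> x \<and> d \<noteq> c \<and> d \<noteq> a2")
      case True
      then obtain d where d: "d \<in> Lx i" "d \<noteq> a0" "d \<noteq> x" "d \<noteq> c" "d \<noteq> a2" by blast
      have "play t1 c (X1(i := d)) k (m1(i := Suc (m1 i)))"
        using d At1 x_def by (intro leaf[OF p1 iI]) auto
      then show ?thesis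
      proof (rule run)
        show "A i r \<noteq> (X1(i := d)) i" if "t1 \<le> r" "r \<le> Suc t2" for r
          using A_until_2[OF that] d by auto
      qed (use t1(1,2) t2(1,2) m1i c2 in auto)
    next
      case False
      then have "Lx i \<subseteq> {a0, x, c, a2}" by blast
      note L = four_eq[OF card_Lx[OF iI] this]
      show ?thesis
      proof (cases "\<exists>e\<in>Lv. e \<noteq> c \<and> e \<notin> X1 ` I")
        case True
        then obtain e where e: "e \<in> Lv" "e \<noteq> c" "e \<notin> X1 ` I" by blast
        have "play t1 e X1 (Suc k) m1"
          using e by (intro center[OF p1]) auto
        then have "play t1 e (X1(i := c)) (Suc k) (m1(i := Suc (m1 i)))"
          using e L(1) At1 xv x_def L(2) by (intro leaf[OF _ iI]) auto
        then show ?thesis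
        proof (rule run)
          show "A i r \<noteq> (X1(i := c)) i" if "t1 \<le> r" "r \<le> Suc t2" for r
            using A_until_2[OF that] L(2) by auto
        qed (use t1(1,2) t2(1,2) m1i c2 in auto)
      next
        case False
        \<comment> \<open>The four colors of \<open>Lv\<close> must fit among \<open>c\<close> and
          the colors of at most three leaves. So the leaves wear distinct colors, all from
          \<open>Lv\<close>: only \<open>i\<close> wears \<open>x\<close>, and the center may go
          there once \<open>i\<close> has left.\<close>
        then have sub: "Lv \<subseteq> insert c (X1 ` I)" by blast
        have "card (X1 ` I) \<le> card I" using fin by (rule card_image_le)
        moreover have "4 \<le> card (insert c (X1 ` I))"
          using card_mono[OF _ sub] fin card_Lv by simp
        moreover have "card (insert c (X1 ` I)) \<le> Suc (card (X1 ` I))"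
          using fin by (simp add: card_insert_if)
        ultimately have cards: "card (X1 ` I) = card I" "card (insert c (X1 ` I)) = 4"
          using card_I by linarith+
        have inj: "inj_on X1 I" using fin cards(1) by (rule eq_card_imp_inj_on)
        have "Lv = insert c (X1 ` I)"
          using card_subset_eq[OF _ sub] fin card_Lv cards(2) by simp
        then have xLv: "x \<in> Lv" using iI x_def by blast
        have "play t1 c (X1(i := a2)) k (m1(i := Suc (m1 i)))"
          using L At1 x_def by (intro leaf[OF p1 iI]) auto
        then have "play t1 x (X1(i := a2)) (Suc k) (m1(i := Suc (m1 i)))"
        proof (rule center)
          show "(X1(i := a2)) j \<noteq> x" if "j \<in> I" for j
            using inj that iI L(2) x_def by (auto dest: inj_onD)
        qed (use xLv xv in auto)
        moreover have "A i r \<noteq> (X1(i := a2)) i" if r: "t1 \<le> r" "r \<le> t2" for r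
        proof -
          consider "r = t1" | "Suc t1 \<le> r" using r by linarith
          then show ?thesis
            by cases (use At1 t2(3)[of r] r forced L(2) in auto)
        qed
        moreover have "t1 \<le> t2" using t2(1) by simp
        ultimately obtain X2 m2 where p2: "play t2 x X2 (Suc k) m2" "X2 i = a2" "m2 i = Suc (m1 i)"
          "\<And>j. j \<in> I \<Longrightarrow> j \<noteq> i \<Longrightarrow> m2 j \<le> m1 j + changes (A j) t1 t2"
          using plain[of t1 t2 x "X1(i := a2)" "Suc k" "m1(i := Suc (m1 i))"] by (metis fun_upd_apply)
        \<comment> \<open>Center and outer neighbor both show \<open>x\<close> at \<open>t2\<close>.
          Of the two colors besides \<open>x\<close> and \<open>a2\<close>, one differs from
          \<open>a3\<close> and outlasts the third change: two moves answer three changes.\<close>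
        obtain d where d: "d \<in> Lx i" "d \<noteq> x" "d \<noteq> a2" "d \<noteq> a3"
          using ex_not_in_three[OF card_Lx[OF iI]] by metis
        have At2: "A i t2 = x" using t2(1,3) forced by simp
        have "play t2 x (X2(i := d)) (Suc k) (m2(i := Suc (m2 i)))"
          using d At2 p2 by (intro leaf[OF p2(1) iI]) auto
        moreover have "A i r \<noteq> (X2(i := d)) i" if r: "t2 \<le> r" "r \<le> Suc t3" for r
        proof -
          consider "r = t2" | "Suc t2 \<le> r" "r \<le> t3" | "r = Suc t3" using r by linarith
          then show ?thesis
            by cases (use At2 t3(3)[of r] t3(4) d in auto)
        qed
        moreover have "t2 \<le> Suc t3" using t3(1) by simp
        ultimately obtain X3 m3 where p3: "play (Suc t3) x X3 (Suc k) m3" "m3 i = Suc (m2 i)"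
          "\<And>j. j \<in> I \<Longrightarrow> j \<noteq> i \<Longrightarrow> m3 j \<le> m2 j + changes (A j) t2 (Suc t3)"
          using plain[of t2 "Suc t3" x "X2(i := d)" "Suc k" "m2(i := Suc (m2 i))"] by (metis fun_upd_apply)
        show ?thesis
        proof (rule finish[OF p3(1)])
          fix j assume j: "j \<in> I" "j \<noteq> i"
          have "changes (A j) t (Suc t3)
              = changes (A j) t t1 + changes (A j) t1 t2 + changes (A j) t2 (Suc t3)"
            using changes_add[of t t1 "Suc t3" "A j"] changes_add[of t1 t2 "Suc t3" "A j"]
              t1(1) t2(1) t3(1) by simp
          then show "m3 j \<le> m j + changes (A j) t (Suc t3)"
            using p3(3)[OF j] p2(4)[OF j] m1[OF j(1)] by linarith
        qed (use t1(1) t2(1) t3(1,2) p3(2) p2(3) m1i c3 in auto)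
      qed
    qed
  qed
qed

text \<open>\<open>s i\<close> is the surplus of the leaf \<open>i\<close> as in \<open>save_both\<close>. The round goes to the unsaturated leaf
  whose third outer change comes first, so no unsaturated leaf loses more than three outer changes
  per round.\<close>

lemma save_all:
  assumes "play t c X k m" "t \<le> T"
    and "\<And>i. i \<in> I \<Longrightarrow> m i + changes (A i) t T + s i \<le> 18" "\<And>i. i \<in> I \<Longrightarrow> s i \<le> 2"
    and "\<And>i. i \<in> I \<Longrightarrow> s i < 2 \<Longrightarrow> changes (A i) t T + 3 * sum s I \<ge> 18"
    and "k \<le> sum s I"
  shows "\<exists>c' X' k' m'. play T c' X' k' m' \<and> k' \<le> 6 \<and> (\<forall>i\<in>I. m' i \<le> 16)"
  using assms
proof (induction "6 - sum s I" arbitrary: t c X k m s rule: less_induct)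
  case less
  note p = less.prems(1) and tT = less.prems(2)
  have sum_le: "sum s I \<le> 2 * card I" using sum_bounded_above[of I s 2] less.prems(4) by simp
  show ?case
  proof (cases "\<forall>i\<in>I. s i = 2")
    case True
    obtain X' m' where q: "play T c X' k m'" "\<And>i. i \<in> I \<Longrightarrow> m' i \<le> m i + changes (A i) t T"
      using plain[OF tT p] by metis
    have "m' i \<le> 16" if "i \<in> I" for i
      using q(2)[OF that] less.prems(3)[OF that] True that by force
    then show ?thesis using q(1) less.prems(6) sum_le card_I by fastforce
  next
    case False
    then obtain i0 where i0: "i0 \<in> I" "s i0 < 2" using less.prems(4) by (metis le_neq_implies_less)
    \<comment> \<open>With an unsaturated leaf left, the total surplus is at most 5, so at least 18
      - 15 = 3 changes remain for that leaf. This is where 18 is tight.\<close>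
    have lt: "sum s I < 6"
    proof -
      have "sum s I < sum (\<lambda>_. 2) I" using fin i0 less.prems(4) by (intro sum_strict_mono_ex1) auto
      then show ?thesis using card_I by simp
    qed
    define P where "P u \<longleftrightarrow> t \<le> u \<and> (\<exists>i\<in>I. s i < 2 \<and> changes (A i) t u \<ge> 3)" for u
    have "P T" using less.prems(5)[OF i0] lt tT i0 by (auto simp: P_def intro!: bexI[of _ i0])
    define u where "u = (LEAST u. P u)"
    have Pu: "P u" unfolding u_def using \<open>P T\<close> by (rule LeastI)
    have uT: "u \<le> T" unfolding u_def using \<open>P T\<close> by (rule Least_le)
    obtain i where i: "t \<le> u" "i \<in> I" "s i < 2" "changes (A i) t u \<ge> 3" using Pu by (auto simp: P_def)
    have le3: "changes (A j) t u \<le> 3" if j: "j \<in> I" "s j < 2" for j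
    proof -
      have "u \<noteq> t" using i(4) by auto
      then obtain w where w: "u = Suc w" "t \<le> w"
        using i(1) by (metis Suc_le_D le_antisym not_less_eq_eq)
      then have "\<not> P w" using not_less_Least[of w P] unfolding u_def by simp
      then have "changes (A j) t w < 3" using w j by (auto simp: P_def)
      then show ?thesis using w by (simp add: changes_Suc)
    qed
    obtain c' X' k' m' where q: "play u c' X' k' m'" "k' \<le> Suc k" "Suc (m' i) \<le> m i + changes (A i) t u"
      "\<And>j. j \<in> I \<Longrightarrow> m' j \<le> m j + changes (A j) t u"
      using round[OF p i(1,2,4)] by blast
    define s' where "s' = s(i := Suc (s i))"
    have s': "sum s' I = Suc (sum s I)"
      using fin i(2) by (simp add: s'_def sum.remove)
    have ch: "changes (A j) t T = changes (A j) t u + changes (A j) u T" for j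
      using changes_add[OF i(1) uT] .
    show ?thesis
    proof (rule less.hyps[OF _ q(1) uT, of s'])
      fix j assume j: "j \<in> I"
      show "m' j + changes (A j) u T + s' j \<le> 18"
        using less.prems(3)[OF j] q(3) q(4)[OF j] ch[of j] by (cases "j = i") (auto simp: s'_def)
      show "s' j \<le> 2" using less.prems(4)[OF j] i(3) by (auto simp: s'_def)
      assume "s' j < 2"
      then have "s j < 2" by (auto simp: s'_def split: if_splits)
      then show "18 \<le> changes (A j) u T + 3 * sum s' I"
        using less.prems(5)[OF j] le3[OF j] ch[of j] s' by simp
    qed (use lt s' q(2) less.prems(6) in auto)
  qed
qed

lemma star_game_solvable:
  assumes start: "c0 \<in> Lv" "\<And>i. i \<in> I \<Longrightarrow> X0 i \<in> Lx i \<and> X0 i \<noteq> c0 \<and> X0 i \<noteq> A i 0"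
    and goal: "c1 \<in> Lv" "\<And>i. i \<in> I \<Longrightarrow> X1 i \<in> Lx i \<and> X1 i \<noteq> c1 \<and> X1 i \<noteq> A i T"
    and A: "\<And>i. i \<in> I \<Longrightarrow> changes (A i) 0 T \<le> 18"
  shows "\<exists>X k m. play T c1 X k m \<and> (\<forall>i\<in>I. X i = X1 i \<and> m i \<le> 18) \<and> k \<le> 18"
proof -
  define s where "s i = min 2 (18 - changes (A i) 0 T)" for i
  have s_le: "s i \<le> sum s I" if "i \<in> I" for i
    using member_le_sum[OF that _ fin, of s] by simp
  have "\<exists>c X k m. play T c X k m \<and> k \<le> 6 \<and> (\<forall>i\<in>I. m i \<le> 16)"
  proof (rule save_all[of 0 c0 X0 0 "\<lambda>_. 0" T s])
    show "play 0 c0 X0 0 (\<lambda>_. 0)" using start by (intro star_play.start) auto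
    show "changes (A i) 0 T + 3 * sum s I \<ge> 18" if "i \<in> I" "s i < 2" for i
      using s_le[OF that(1)] that(2) A[OF that(1)] unfolding s_def[of i] by linarith
    show "0 + changes (A i) 0 T + s i \<le> 18" if "i \<in> I" for i
      using A[OF that] unfolding s_def[of i] by linarith
  qed (auto simp: s_def)
  then obtain c X k m where p: "play T c X k m" "k \<le> 6" "\<And>i. i \<in> I \<Longrightarrow> m i \<le> 16" by blast
  have "\<exists>d. d \<in> Lx i \<and> d \<noteq> X i \<and> d \<noteq> c \<and> d \<noteq> A i T" if "i \<in> I" for i
    using ex_not_in_three[OF card_Lx[OF that]] by metis
  then obtain Y where Y: "\<And>i. i \<in> I \<Longrightarrow> Y i \<in> Lx i \<and> Y i \<noteq> X i \<and> Y i \<noteq> c \<and> Y i \<noteq> A i T" by metis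
  \<comment> \<open>The closing moves: leaves wearing \<open>c1\<close> step aside, the center takes
    \<open>c1\<close>, then all leaves take their targets. A leaf makes at most 16 + 2 moves, the
    center at most 6 + 1.\<close>
  define J where "J = {i \<in> I. X i = c1}"
  define X2 where "X2 = (\<lambda>i. if i \<in> J then Y i else X i)"
  define m2 where "m2 = (\<lambda>i. m i + of_bool (i \<in> J \<and> Y i \<noteq> X i))"
  have p2: "play T c X2 k m2"
    unfolding X2_def m2_def using Y by (intro move_leaves[OF p(1)]) (auto simp: J_def)
  have "X2 i \<noteq> c1" if "i \<in> I" for i using Y[OF that] that by (auto simp: X2_def J_def)
  then obtain k3 where p3: "play T c1 X2 k3 m2" "k3 \<le> Suc k"
    using center[OF p2 goal(1)] p2 by (cases "c1 = c") auto
  have "play T c1 (\<lambda>i. if i \<in> I then X1 i else X2 i) k3 (\<lambda>i. m2 i + of_bool (i \<in> I \<and> X1 i \<noteq> X2 i))"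
    using goal(2) by (intro move_leaves[OF p3(1)]) auto
  moreover have "m2 i + of_bool (i \<in> I \<and> X1 i \<noteq> X2 i) \<le> 18" if "i \<in> I" for i
    using p(3)[OF that] by (simp add: m2_def of_bool_def)
  ultimately show ?thesis using p3(2) p(2)
    by (intro exI[of _ "\<lambda>i. if i \<in> I then X1 i else X2 i"] exI[of _ k3]
        exI[of _ "\<lambda>i. m2 i + of_bool (i \<in> I \<and> X1 i \<noteq> X2 i)"]) auto
qed

end

section \<open>Extending a recoloring sequence to the deleted vertices\<close>

text \<open>A sequence grown at its end, reduced to its current coloring and its move counters. This
  matches the steps of the games without list indices; \<open>recolors_to_sequence\<close>
  translates back.\<close>

inductive recolors_to ::
  "'a set \<Rightarrow> 'a set set \<Rightarrow> ('a \<Rightarrow> 'c set) \<Rightarrow> ('a \<Rightarrow> 'c) \<Rightarrow> ('a \<Rightarrow> 'c) \<Rightarrow> ('a \<Rightarrow> nat) \<Rightarrow> bool"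
  for V E L \<alpha> where
  init: "list_coloring V E L \<alpha> \<Longrightarrow> recolors_to V E L \<alpha> \<alpha> (\<lambda>_. 0)"
| recolor: "recolors_to V E L \<alpha> \<psi> c \<Longrightarrow> v \<in> V \<Longrightarrow> d \<noteq> \<psi> v \<Longrightarrow> list_coloring V E L (\<psi>(v := d)) \<Longrightarrow>
    recolors_to V E L \<alpha> (\<psi>(v := d)) (c(v := Suc (c v)))"

lemma recolor_count_eq_changes: "recolor_count s w = changes (\<lambda>t. (s ! t) w) 0 (length s - 1)"
  unfolding recolor_count_def changes_def by (rule arg_cong[where f = card]) auto

lemma recolor_count_snoc:
  assumes "s \<noteq> []"
  shows "recolor_count (s @ [\<psi>]) w = recolor_count s w + of_bool (last s w \<noteq> \<psi> w)"
proof -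
  obtain n where n: "length s = Suc n" using assms by (cases s) auto
  have "changes (\<lambda>t. ((s @ [\<psi>]) ! t) w) 0 n = changes (\<lambda>t. (s ! t) w) 0 n"
    unfolding changes_def using n by (intro arg_cong[where f = card]) (auto simp: nth_append)
  then show ?thesis
    using n assms by (simp add: recolor_count_eq_changes changes_Suc nth_append last_conv_nth)
qed

lemma recolors_to_sequence:
  assumes "recolors_to V E L \<alpha> \<psi> c"
  shows "\<exists>s. recoloring_sequence V E L \<alpha> \<psi> s \<and> (\<forall>w. recolor_count s w = c w)"
  using assms
proof (induction rule: recolors_to.induct)
  case init
  then show ?case
    by (intro exI[of _ "[\<alpha>]"]) (auto simp: recoloring_sequence_def recolor_count_def)
next
  case (recolor \<psi> c v d)
  then obtain s where s: "recoloring_sequence V E L \<alpha> \<psi> s" "\<And>w. recolor_count s w = c w" by blast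
  let ?\<psi> = "\<psi>(v := d)"
  have ne: "s \<noteq> []" and last: "last s = \<psi>" using s(1) by (auto simp: recoloring_sequence_def)
  have "\<exists>!w. w \<in> V \<and> ((s @ [?\<psi>]) ! i) w \<noteq> ((s @ [?\<psi>]) ! Suc i) w" if i: "Suc i < length (s @ [?\<psi>])" for i
  proof (cases "Suc i < length s")
    case True
    then show ?thesis using s(1) by (simp add: recoloring_sequence_def nth_append)
  next
    case False
    then have "i = length s - 1" "Suc i = length s" using i ne by (auto simp: less_Suc_eq)
    then have "(s @ [?\<psi>]) ! i = \<psi>" "(s @ [?\<psi>]) ! Suc i = ?\<psi>"
      using ne last by (auto simp: nth_append last_conv_nth)
    then show ?thesis using recolor(2,3) by (intro ex1I[of _ v]) (auto split: if_splits)
  qed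
  then have "recoloring_sequence V E L \<alpha> ?\<psi> (s @ [?\<psi>])"
    using s(1) recolor(4) by (auto simp: recoloring_sequence_def)
  moreover have "recolor_count (s @ [?\<psi>]) w = (c(v := Suc (c v))) w" for w
    using recolor_count_snoc[OF ne, of ?\<psi> w] s(2) recolor(3) last by auto
  ultimately show ?case by blast
qed

lemma card_2_other:
  assumes "card N = 2" "u \<in> N"
  obtains a where "N = {u, a}" "a \<noteq> u"
proof -
  obtain p q where "N = {p, q}" "p \<noteq> q" using assms(1) by (auto simp: card_2_iff)
  then show thesis using that[of p] that[of q] assms(2) by (auto simp: insert_commute)
qed

section \<open>Gluing inner colors to a given outer sequence\<close>

definition delete_edges :: "'a set set \<Rightarrow> 'a set \<Rightarrow> 'a set set" where
  "delete_edges E S = {e \<in> E. e \<inter> S = {}}"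

locale deletion =
  fixes V :: "'a set" and E :: "'a set set" and L :: "'a \<Rightarrow> 'c set" and \<alpha> \<beta> :: "'a \<Rightarrow> 'c"
    and S :: "'a set" and s :: "('a \<Rightarrow> 'c) list"
  assumes graph: "simple_graph V E" and S_V: "S \<subseteq> V"
    and assignment: "list_assignment 4 V L"
    and colorings: "list_coloring V E L \<alpha>" "list_coloring V E L \<beta>"
    and seq: "recoloring_sequence (V - S) (delete_edges E S) L
      (restrict \<alpha> (V - S)) (restrict \<beta> (V - S)) s"
    and count: "\<And>w. w \<in> V - S \<Longrightarrow> recolor_count s w \<le> 18"
begin

definition T :: nat where "T = length s - 1"

lemma length_s: "length s = Suc T"
  using seq unfolding T_def recoloring_sequence_def by (metis Suc_pred' length_greater_0_conv)

abbreviation outer :: "'a \<Rightarrow> nat \<Rightarrow> 'c" where "outer w \<equiv> \<lambda>t. (s ! t) w"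

lemma outer_coloring: "t \<le> T \<Longrightarrow> list_coloring (V - S) (delete_edges E S) L (s ! t)"
  using seq length_s by (auto simp: recoloring_sequence_def)

text \<open>The clause for \<open>w\<close> outside \<open>V\<close> compares default values: both
  sides are \<open>undefined\<close>, as needed for \<open>glue 0 \<alpha>\<close> to equal \<alpha>
  as a function.\<close>

lemma outer_start: "w \<in> V - S \<Longrightarrow> outer w 0 = \<alpha> w" "w \<notin> V \<Longrightarrow> outer w 0 = \<alpha> w"
  using seq colorings(1)
  by (auto simp: recoloring_sequence_def hd_conv_nth list_coloring_def PiE_def extensional_def restrict_def)

lemma outer_end: "w \<in> V - S \<Longrightarrow> outer w T = \<beta> w" "w \<notin> V \<Longrightarrow> outer w T = \<beta> w"
  using seq colorings(2)
  by (auto simp: recoloring_sequence_def last_conv_nth T_def list_coloring_def PiE_def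
      extensional_def restrict_def)

lemma outer_changes: "w \<in> V - S \<Longrightarrow> changes (outer w) 0 T \<le> 18"
  using count by (simp add: recolor_count_eq_changes T_def)

definition glue :: "nat \<Rightarrow> ('a \<Rightarrow> 'c) \<Rightarrow> 'a \<Rightarrow> 'c" where
  "glue t \<sigma> w = (if w \<in> S then \<sigma> w else outer w t)"

definition inner_ok :: "nat \<Rightarrow> ('a \<Rightarrow> 'c) \<Rightarrow> bool" where
  "inner_ok t \<sigma> \<longleftrightarrow> (\<forall>v\<in>S. \<sigma> v \<in> L v) \<and>
     (\<forall>v\<in>S. \<forall>w. {v, w} \<in> E \<longrightarrow> \<sigma> v \<noteq> (if w \<in> S then \<sigma> w else outer w t))"

text \<open>The counters of outer vertices are fixed by the given sequence \<open>s\<close>, so only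
  the counters on \<open>S\<close> remain to be controlled.\<close>

definition reachable :: "nat \<Rightarrow> ('a \<Rightarrow> 'c) \<Rightarrow> ('a \<Rightarrow> nat) \<Rightarrow> bool" where
  "reachable t \<sigma> c \<longleftrightarrow>
     recolors_to V E L \<alpha> (glue t \<sigma>) (\<lambda>w. if w \<in> S then c w else changes (outer w) 0 t)"

lemma edge_in_V: "{u, v} \<in> E \<Longrightarrow> u \<in> V \<and> v \<in> V \<and> u \<noteq> v"
  using graph unfolding simple_graph_def by (metis doubleton_eq_iff insert_absorb2 singletonD singletonI insertCI)

lemma glue_coloring:
  assumes "t \<le> T" "inner_ok t \<sigma>"
  shows "list_coloring V E L (glue t \<sigma>)"
proof -
  note o = outer_coloring[OF assms(1)]
  have "glue t \<sigma> \<in> (\<Pi>\<^sub>E v\<in>V. L v)"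
    using o assms(2) S_V unfolding list_coloring_def inner_ok_def glue_def PiE_def extensional_def
    by auto
  moreover have "glue t \<sigma> u \<noteq> glue t \<sigma> v" if e: "{u, v} \<in> E" for u v
  proof -
    consider "u \<in> S" | "v \<in> S" | "u \<notin> S" "v \<notin> S" by blast
    then show ?thesis
    proof cases
      case 1
      then show ?thesis using assms(2) e unfolding inner_ok_def glue_def by auto
    next
      case 2
      have "{v, u} \<in> E" using e by (simp add: insert_commute)
      then show ?thesis using assms(2) 2 unfolding inner_ok_def glue_def by metis
    next
      case 3
      then have "{u, v} \<in> delete_edges E S" using e by (auto simp: delete_edges_def)
      then show ?thesis using o 3 by (simp add: list_coloring_def glue_def)
    qed
  qed
  ultimately show ?thesis by (simp add: list_coloring_def)
qed

lemma reachable_cong: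
  assumes "reachable t \<sigma> c" "\<And>w. w \<in> S \<Longrightarrow> \<sigma> w = \<sigma>' w" "\<And>w. w \<in> S \<Longrightarrow> c w = c' w"
  shows "reachable t \<sigma>' c'"
proof -
  have "glue t \<sigma> = glue t \<sigma>'" using assms(2) by (auto simp: glue_def)
  moreover have "(\<lambda>w. if w \<in> S then c w else changes (outer w) 0 t)
      = (\<lambda>w. if w \<in> S then c' w else changes (outer w) 0 t)" using assms(3) by auto
  ultimately show ?thesis using assms(1) by (simp add: reachable_def)
qed

lemma inner_ok_cong:
  assumes "inner_ok t \<sigma>" "\<And>w. w \<in> S \<Longrightarrow> \<sigma> w = \<sigma>' w"
  shows "inner_ok t \<sigma>'"
  unfolding inner_ok_def
proof (intro conjI ballI allI impI)
  show "\<sigma>' v \<in> L v" if "v \<in> S" for v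
    using assms that by (simp add: inner_ok_def)
  show "\<sigma>' v \<noteq> (if w \<in> S then \<sigma>' w else outer w t)" if "v \<in> S" "{v, w} \<in> E" for v w
    using assms(1) assms(2)[OF that(1)] assms(2)[of w] that unfolding inner_ok_def by metis
qed

lemma reachable_start: "reachable 0 \<alpha> (\<lambda>_. 0)"
proof -
  have "glue 0 \<alpha> = \<alpha>" using outer_start by (auto simp: glue_def fun_eq_iff)
  moreover have "(\<lambda>w. if w \<in> S then 0 else changes (outer w) 0 0) = (\<lambda>_. 0)" by auto
  ultimately show ?thesis using recolors_to.init[OF colorings(1)] by (simp add: reachable_def)
qed

lemma reachable_move:
  assumes r: "reachable t \<sigma> c" and "t \<le> T" "v \<in> S" "d \<noteq> \<sigma> v" "inner_ok t (\<sigma>(v := d))"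
  shows "reachable t (\<sigma>(v := d)) (c(v := Suc (c v)))"
proof -
  have g: "glue t (\<sigma>(v := d)) = (glue t \<sigma>)(v := d)" using assms(3) by (auto simp: glue_def)
  let ?c = "\<lambda>w. if w \<in> S then c w else changes (outer w) 0 t"
  have c: "(\<lambda>w. if w \<in> S then (c(v := Suc (c v))) w else changes (outer w) 0 t) = ?c(v := Suc (?c v))"
    using assms(3) by auto
  have "recolors_to V E L \<alpha> ((glue t \<sigma>)(v := d)) (?c(v := Suc (?c v)))"
  proof (rule recolors_to.recolor)
    show "recolors_to V E L \<alpha> (glue t \<sigma>) ?c" using r by (simp add: reachable_def)
    show "list_coloring V E L ((glue t \<sigma>)(v := d))"
      using glue_coloring[OF assms(2,5)] g by simp
  qed (use assms S_V in \<open>auto simp: glue_def\<close>)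
  then show ?thesis unfolding reachable_def g c .
qed

text \<open>An outer step recolors exactly one outer vertex, so it is a single move of the glued
  coloring. It is legal because the inner vertices already avoid the new outer color.\<close>

lemma reachable_tick:
  assumes r: "reachable t \<sigma> c" and t: "Suc t \<le> T" and ok: "inner_ok (Suc t) \<sigma>"
  shows "reachable (Suc t) \<sigma> c"
proof -
  have "\<exists>!v. v \<in> V - S \<and> outer v t \<noteq> outer v (Suc t)"
    using seq t length_s by (auto simp: recoloring_sequence_def)
  then obtain v where v: "v \<in> V - S" "outer v t \<noteq> outer v (Suc t)"
    "\<And>w. w \<in> V - S \<Longrightarrow> w \<noteq> v \<Longrightarrow> outer w t = outer w (Suc t)" by blast
  have same: "outer w t = outer w (Suc t)" if "w \<noteq> v" "w \<notin> S" for w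
    using v(3)[of w] that outer_coloring[of t] outer_coloring[OF t] t
    by (cases "w \<in> V") (auto simp: list_coloring_def PiE_def extensional_def)
  let ?c = "\<lambda>w. if w \<in> S then c w else changes (outer w) 0 t"
  have g: "glue (Suc t) \<sigma> = (glue t \<sigma>)(v := outer v (Suc t))"
    using same v(1) by (auto simp: glue_def)
  have c: "(\<lambda>w. if w \<in> S then c w else changes (outer w) 0 (Suc t)) = ?c(v := Suc (?c v))"
    using same v(1,2) by (auto simp: changes_Suc)
  have "recolors_to V E L \<alpha> ((glue t \<sigma>)(v := outer v (Suc t))) (?c(v := Suc (?c v)))"
  proof (rule recolors_to.recolor)
    show "recolors_to V E L \<alpha> (glue t \<sigma>) ?c" using r by (simp add: reachable_def)
    show "list_coloring V E L ((glue t \<sigma>)(v := outer v (Suc t)))"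
      using glue_coloring[OF t ok] g by simp
  qed (use v in \<open>auto simp: glue_def\<close>)
  then show ?thesis unfolding reachable_def g c .
qed

lemma reachable_end:
  assumes "reachable T \<sigma> c" "\<And>w. w \<in> S \<Longrightarrow> \<sigma> w = \<beta> w" "\<And>w. w \<in> S \<Longrightarrow> c w \<le> 18"
  shows "\<exists>s. recoloring_sequence V E L \<alpha> \<beta> s \<and> (\<forall>v\<in>V. recolor_count s v \<le> 18)"
proof -
  have "glue T \<sigma> = \<beta>" using assms(2) outer_end S_V by (auto simp: glue_def fun_eq_iff)
  then have "recolors_to V E L \<alpha> \<beta> (\<lambda>w. if w \<in> S then c w else changes (outer w) 0 T)"
    using assms(1) by (simp add: reachable_def)
  from recolors_to_sequence[OF this] show ?thesis
    using assms(3) outer_changes by force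
qed

lemma list_card: "v \<in> V \<Longrightarrow> card (L v) = 4"
  using assignment by (simp add: list_assignment_def)

lemma coloring_in_list: "v \<in> V \<Longrightarrow> \<alpha> v \<in> L v" "v \<in> V \<Longrightarrow> \<beta> v \<in> L v"
  using colorings by (auto simp: list_coloring_def)

lemma coloring_proper: "{u, v} \<in> E \<Longrightarrow> \<alpha> u \<noteq> \<alpha> v" "{u, v} \<in> E \<Longrightarrow> \<beta> u \<noteq> \<beta> v"
  using colorings by (auto simp: list_coloring_def)

text \<open>The edge game also settles a single vertex of degree at most one: its partner is then imaginary.\<close>

lemma extend_leaf:
  assumes S: "S = {x}" and nbr: "card {w. {x, w} \<in> E} \<le> 1"
  shows "\<exists>s. recoloring_sequence V E L \<alpha> \<beta> s \<and> (\<forall>v\<in>V. recolor_count s v \<le> 18)"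
proof -
  have xV: "x \<in> V" using S S_V by simp
  have iff: "w \<in> S \<longleftrightarrow> w = x" for w using S by simp
  have ok: "inner_ok t (\<lambda>_. c)" if "c \<in> L x" "\<And>w. {x, w} \<in> E \<Longrightarrow> c \<noteq> outer w t" for c t
    unfolding inner_ok_def Ball_def iff using that edge_in_V by fastforce
  \<comment> \<open>Needed because \<open>card\<close> of an infinite set is 0.\<close>
  have "finite {w. {x, w} \<in> E}"
  proof (rule finite_subset)
    show "{w. {x, w} \<in> E} \<subseteq> V" using edge_in_V by blast
    show "finite V" using graph by (simp add: simple_graph_def)
  qed
  then consider "{w. {x, w} \<in> E} = {}" | a where "{w. {x, w} \<in> E} = {a}"
    using nbr by (metis card_0_eq card_1_singletonE le_0_eq le_Suc_eq One_nat_def)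
  then obtain A where A: "\<And>w. {x, w} \<in> E \<Longrightarrow> A = outer w" "\<alpha> x \<noteq> A 0" "\<beta> x \<noteq> A T" "changes A 0 T \<le> 18"
  proof cases
    case 1
    \<comment> \<open>An isolated vertex gets a constant outer color that clashes with neither end
      of the sequence.\<close>
    obtain d where "d \<in> L x" "d \<noteq> \<alpha> x" "d \<noteq> \<beta> x" using ex_not_in_three[OF list_card[OF xV]] by metis
    then show thesis using that[of "\<lambda>_. d"] 1 by (auto simp: changes_def)
  next
    case 2
    then have e: "{x, a} \<in> E" by blast
    then have a: "a \<in> V - S" using edge_in_V S by blast
    show thesis
    proof (rule that[of "outer a"])
      show "outer a = outer w" if "{x, w} \<in> E" for w using that 2 by (metis mem_Collect_eq singletonD)
    qed (use coloring_proper[OF e] outer_start[of a] outer_end[of a] a outer_changes[OF a] in auto)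
  qed
  obtain y0 where y0: "y0 \<in> L x" "y0 \<noteq> \<alpha> x" using ex_not_in_three[OF list_card[OF xV]] by metis
  obtain y1 where y1: "y1 \<in> L x" "y1 \<noteq> \<beta> x" using ex_not_in_three[OF list_card[OF xV]] by metis
  \<comment> \<open>The imaginary partner goes from \<open>y0\<close> to \<open>y1\<close>; its own
    outer neighbor is frozen at \<open>b\<close>, which must differ from both.\<close>
  obtain b where b: "b \<in> L x" "b \<noteq> y0" "b \<noteq> y1" using ex_not_in_three[OF list_card[OF xV]] by metis
  interpret game: edge_game "L x" "L x" A "\<lambda>_. b" "\<alpha> x" y0
    using list_card[OF xV] by unfold_locales
  have lift: "reachable t (\<lambda>_. c) (\<lambda>_. m)" if "game.play t c y m n" "t \<le> T" for t c y m n
    using that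
  proof (induction rule: edge_play.induct)
    case start
    then show ?case using reachable_cong[OF reachable_start] S by simp
  next
    case (move_x t c y m n d)
    have "inner_ok t (\<lambda>_. d)" using move_x A(1) by (intro ok) metis+
    then have "inner_ok t ((\<lambda>_. c)(x := d))"
      by (rule inner_ok_cong) (simp add: iff)
    then have "reachable t ((\<lambda>_. c)(x := d)) ((\<lambda>_. m)(x := Suc m))"
      using move_x by (intro reachable_move) (auto simp: iff)
    then show ?case by (rule reachable_cong) (auto simp: iff)
  next
    case (tick t c y m n)
    have "inner_ok (Suc t) (\<lambda>_. c)"
      using tick A(1) edge_play_valid[OF tick(1)] by (intro ok) metis+
    then show ?case using tick by (intro reachable_tick) auto
  \<comment> \<open>In the remaining case only the imaginary partner moves, and nothing happens in
    the graph.\<close>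
  qed simp
  obtain m n where "game.play T (\<beta> x) y1 m n" "m \<le> 18"
    using game.edge_game_solvable[of "\<beta> x" y1 T] coloring_in_list xV A y0 y1 b
    by (auto simp: changes_def)
  then show ?thesis using reachable_end[OF lift] S by auto
qed

lemma extend_edge:
  assumes S: "S = {x, y}" and xy: "{x, y} \<in> E"
    and deg: "card {w. {x, w} \<in> E} = 2" "card {w. {y, w} \<in> E} = 2"
  shows "\<exists>s. recoloring_sequence V E L \<alpha> \<beta> s \<and> (\<forall>v\<in>V. recolor_count s v \<le> 18)"
proof -
  have yx: "{y, x} \<in> E" using xy by (simp add: insert_commute)
  have iff: "w \<in> S \<longleftrightarrow> w = x \<or> w = y" for w using S by simp
  have V: "x \<in> V" "y \<in> V" "x \<noteq> y" using edge_in_V[OF xy] by auto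
  obtain a where a: "{w. {x, w} \<in> E} = {y, a}" "a \<noteq> y"
    using card_2_other[OF deg(1), of y] xy by auto
  obtain b where b: "{w. {y, w} \<in> E} = {x, b}" "b \<noteq> x"
    using card_2_other[OF deg(2), of x] yx by auto
  have e: "{x, a} \<in> E" "{y, b} \<in> E" using a b by auto
  have out: "a \<in> V - S" "b \<in> V - S" using edge_in_V[OF e(1)] edge_in_V[OF e(2)] a b S by auto
  have nx: "w = y \<or> w = a" if "{x, w} \<in> E" for w using a that by blast
  have ny: "w = x \<or> w = b" if "{y, w} \<in> E" for w using b that by blast
  \<comment> \<open>The vertices \<open>a\<close> and \<open>b\<close> may coincide, in a triangle;
    the game puts no condition on how the two outer sequences are related.\<close>
  interpret game: edge_game "L x" "L y" "outer a" "outer b" "\<alpha> x" "\<alpha> y"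
    using list_card V by unfold_locales auto
  let ?\<sigma> = "\<lambda>c d w. if w = x then c else d"
  have ok: "inner_ok t (?\<sigma> c d)"
    if "c \<in> L x" "d \<in> L y" "c \<noteq> d" "c \<noteq> outer a t" "d \<noteq> outer b t" for c d t
    unfolding inner_ok_def using that nx ny S out V by fastforce
  have lift: "reachable t (?\<sigma> c d) (?\<sigma> m n)" if "game.play t c d m n" "t \<le> T" for t c d m n
    using that
  proof (induction rule: edge_play.induct)
    case start
    then show ?case by (intro reachable_cong[OF reachable_start]) (use S in auto)
  next
    case (move_x t c d m n c')
    note v = edge_play_valid[OF move_x(1)]
    have u: "(?\<sigma> c d)(x := c') = ?\<sigma> c' d" "(?\<sigma> m n)(x := Suc (?\<sigma> m n x)) = ?\<sigma> (Suc m) n" by auto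
    have "inner_ok t (?\<sigma> c' d)" using move_x v by (intro ok) auto
    then show ?case unfolding u[symmetric]
      by (intro reachable_move) (use move_x in \<open>auto simp: iff\<close>)
  next
    case (move_y t c d m n d')
    note v = edge_play_valid[OF move_y(1)]
    have "reachable t ((?\<sigma> c d)(y := d')) ((?\<sigma> m n)(y := Suc (?\<sigma> m n y)))"
    proof (rule reachable_move)
      have "inner_ok t (?\<sigma> c d')" using move_y v by (intro ok) auto
      then show "inner_ok t ((?\<sigma> c d)(y := d'))"
        by (rule inner_ok_cong) (use V in \<open>auto simp: iff\<close>)
    qed (use move_y V in \<open>auto simp: iff\<close>)
    then show ?case by (rule reachable_cong) (use V in \<open>auto simp: iff\<close>)
  next
    case (tick t c d m n)
    then show ?case using edge_play_valid[OF tick(1)] by (intro reachable_tick ok) auto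
  qed
  obtain m n where "game.play T (\<beta> x) (\<beta> y) m n" "m \<le> 18" "n \<le> 18"
    using game.edge_game_solvable[of "\<beta> x" "\<beta> y" T] coloring_in_list V
      coloring_proper[OF xy] coloring_proper[OF e(1)] coloring_proper[OF e(2)]
      outer_start(1)[OF out(1)] outer_start(1)[OF out(2)] outer_end(1)[OF out(1)]
      outer_end(1)[OF out(2)] outer_changes[OF out(1)] outer_changes[OF out(2)] by auto
  then show ?thesis
    by (intro reachable_end[OF lift]) (use S in auto)
qed

lemma extend_star:
  assumes S: "S = insert v I" and I: "I = {w. {v, w} \<in> E}" and card_I: "card I = 3"
    and deg: "\<And>i. i \<in> I \<Longrightarrow> card {w. {i, w} \<in> E} = 2"
    and indep: "\<And>i j. i \<in> I \<Longrightarrow> j \<in> I \<Longrightarrow> {i, j} \<notin> E"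
  shows "\<exists>s. recoloring_sequence V E L \<alpha> \<beta> s \<and> (\<forall>v\<in>V. recolor_count s v \<le> 18)"
proof -
  have vI: "v \<notin> I" using I edge_in_V by blast
  have V: "v \<in> V" "I \<subseteq> V" using S S_V by auto
  have e: "{v, i} \<in> E" "{i, v} \<in> E" if "i \<in> I" for i using I that by (auto simp: insert_commute)
  have "\<exists>a. {w. {i, w} \<in> E} = {v, a} \<and> a \<noteq> v" if "i \<in> I" for i
    using card_2_other[OF deg[OF that], of v] e(2)[OF that] by (metis mem_Collect_eq)
  then obtain a where a: "\<And>i. i \<in> I \<Longrightarrow> {w. {i, w} \<in> E} = {v, a i} \<and> a i \<noteq> v" by metis
  have ea: "{i, a i} \<in> E" if "i \<in> I" for i using a[OF that] by auto
  \<comment> \<open>By \<open>indep\<close> the second neighbor of a leaf is not a leaf, so it lies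
    outside \<open>S\<close> and its moves are prescribed.\<close>
  have out: "a i \<in> V - S" if "i \<in> I" for i
    using edge_in_V[OF ea[OF that]] a[OF that] indep[OF that, of "a i"] ea[OF that] S by auto
  have ni: "w = v \<or> w = a i" if "i \<in> I" "{i, w} \<in> E" for i w using a that by blast
  have nv: "w \<in> I" if "{v, w} \<in> E" for w using I that by blast
  interpret game: star_game I "L v" L "\<lambda>i. outer (a i)" "\<alpha> v" \<alpha>
    using list_card V card_I card_ge_0_finite[of I] by unfold_locales auto
  let ?\<sigma> = "\<lambda>c X w. if w = v then c else X w"
  have ok: "inner_ok t (?\<sigma> c X)"
    if "c \<in> L v" "\<And>i. i \<in> I \<Longrightarrow> X i \<in> L i \<and> X i \<noteq> c \<and> X i \<noteq> outer (a i) t" for c X t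
  proof -
    have "?\<sigma> c X u \<noteq> (if w \<in> S then ?\<sigma> c X w else outer w t)" if u: "u \<in> S" "{u, w} \<in> E" for u w
    proof (cases "u = v")
      case True
      then have "w \<in> I" using nv u by blast
      then show ?thesis using True that vI S \<open>\<And>i. i \<in> I \<Longrightarrow> X i \<in> L i \<and> X i \<noteq> c \<and> X i \<noteq> outer (a i) t\<close> by auto
    next
      case False
      then have "u \<in> I" using u S by blast
      then show ?thesis
        using False ni[OF _ u(2)] out[of u] vI S
          \<open>\<And>i. i \<in> I \<Longrightarrow> X i \<in> L i \<and> X i \<noteq> c \<and> X i \<noteq> outer (a i) t\<close>[of u] by auto
    qed
    then show ?thesis unfolding inner_ok_def using that S vI by auto
  qed
  have lift: "reachable t (?\<sigma> c X) (?\<sigma> k m)" if "game.play t c X k m" "t \<le> T" for t c X k m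
    using that
  proof (induction rule: star_play.induct)
    case start
    show ?case by (intro reachable_cong[OF reachable_start]) auto
  next
    case (center t c X k m d)
    have u: "(?\<sigma> c X)(v := d) = ?\<sigma> d X" "(?\<sigma> k m)(v := Suc (?\<sigma> k m v)) = ?\<sigma> (Suc k) m" by auto
    show ?case unfolding u[symmetric]
    proof (rule reachable_move)
      show "inner_ok t ((?\<sigma> c X)(v := d))" unfolding u
        by (rule ok) (use center(2,4) star_play_valid[OF center(1)] in auto)
    qed (use center S in auto)
  next
    case (leaf t c X k m i d)
    have "i \<noteq> v" using leaf vI by blast
    then have u: "(?\<sigma> c X)(i := d) = ?\<sigma> c (X(i := d))"
      "(?\<sigma> k m)(i := Suc (?\<sigma> k m i)) = ?\<sigma> k (m(i := Suc (m i)))" by auto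
    show ?case unfolding u[symmetric]
    proof (rule reachable_move)
      show "inner_ok t ((?\<sigma> c X)(i := d))" unfolding u
        by (rule ok) (use leaf(2-6) star_play_valid[OF leaf(1)] in auto)
    qed (use leaf S vI in auto)
  next
    case (tick t c X k m)
    then show ?case using star_play_valid[OF tick(1)] by (intro reachable_tick ok) auto
  qed
  obtain X k m where "game.play T (\<beta> v) X k m" "\<And>i. i \<in> I \<Longrightarrow> X i = \<beta> i \<and> m i \<le> 18" "k \<le> 18"
  proof -
    have "\<exists>X k m. game.play T (\<beta> v) X k m \<and> (\<forall>i\<in>I. X i = \<beta> i \<and> m i \<le> 18) \<and> k \<le> 18"
    proof (rule game.star_game_solvable)
      fix i assume i: "i \<in> I"
      show "\<alpha> i \<in> L i \<and> \<alpha> i \<noteq> \<alpha> v \<and> \<alpha> i \<noteq> outer (a i) 0"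
        using i coloring_in_list V coloring_proper[OF e(2)[OF i]] coloring_proper[OF ea[OF i]]
          outer_start(1)[OF out[OF i]] by auto
      show "\<beta> i \<in> L i \<and> \<beta> i \<noteq> \<beta> v \<and> \<beta> i \<noteq> outer (a i) T"
        using i coloring_in_list V coloring_proper[OF e(2)[OF i]] coloring_proper[OF ea[OF i]]
          outer_end(1)[OF out[OF i]] by auto
    qed (use coloring_in_list V outer_changes out in auto)
    then show thesis using that by blast
  qed
  then show ?thesis
    by (intro reachable_end[OF lift]) (use S in auto)
qed

end

section \<open>Sparse graphs\<close>

lemma sum_degrees:
  assumes "simple_graph V E"
  shows "(\<Sum>v\<in>V. card {w. {v, w} \<in> E}) = 2 * card E"
proof -
  have finV: "finite V" and E: "\<And>e. e \<in> E \<Longrightarrow> \<exists>u\<in>V. \<exists>v\<in>V. u \<noteq> v \<and> e = {u, v}"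
    using assms by (auto simp: simple_graph_def)
  have "E \<subseteq> Pow V" using E by blast
  then have finE: "finite E" using finV finite_subset by auto
  have "card {w. {v, w} \<in> E} = card {e \<in> E. v \<in> e}" for v
  proof (rule bij_betw_same_card[of "\<lambda>w. {v, w}"], rule bij_betwI')
    show "\<And>x y. ({v, x} = {v, y}) = (x = y)" by (auto simp: doubleton_eq_iff)
    show "\<exists>w\<in>{w. {v, w} \<in> E}. e = {v, w}" if "e \<in> {e \<in> E. v \<in> e}" for e
      using E[of e] that by (auto simp: insert_commute)
  qed auto
  then have "(\<Sum>v\<in>V. card {w. {v, w} \<in> E}) = (\<Sum>v\<in>V. \<Sum>e\<in>E. of_bool (v \<in> e))"
    using finE by (simp add: Int_def)
  also have "\<dots> = (\<Sum>e\<in>E. \<Sum>v\<in>V. of_bool (v \<in> e))" by (rule sum.swap)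
  also have "\<dots> = (\<Sum>e\<in>E. 2)"
  proof (rule sum.cong[OF refl])
    fix e assume "e \<in> E"
    then obtain u v where "u \<in> V" "v \<in> V" "u \<noteq> v" "e = {u, v}" using E by blast
    then have "V \<inter> {w. w \<in> e} = {u, v}" by auto
    then show "(\<Sum>v\<in>V. of_bool (v \<in> e)) = (2 :: nat)"
      using finV \<open>u \<noteq> v\<close> by simp
  qed
  finally show ?thesis by simp
qed

text \<open>Discharging: every vertex starts with charge \<open>4 d - 10\<close>, and a vertex of degree at least 3 gives
  one unit to each neighbor of degree 2.\<close>

lemma sparse_configuration:
  assumes graph: "simple_graph V E" and sparse: "4 * card E < 5 * card V"
  defines "N \<equiv> \<lambda>v. {w. {v, w} \<in> E}"
  shows "(\<exists>x\<in>V. card (N x) \<le> 1) \<or> (\<exists>x y. {x, y} \<in> E \<and> card (N x) = 2 \<and> card (N y) = 2) \<or>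
    (\<exists>v\<in>V. card (N v) = 3 \<and> (\<forall>i\<in>N v. card (N i) = 2))"
proof (rule ccontr)
  assume "\<not> ?thesis"
  then have d2: "\<And>x. x \<in> V \<Longrightarrow> card (N x) \<ge> 2"
    and no22: "\<And>x y. {x, y} \<in> E \<Longrightarrow> card (N x) = 2 \<Longrightarrow> card (N y) \<noteq> 2"
    and no3: "\<And>v. v \<in> V \<Longrightarrow> card (N v) = 3 \<Longrightarrow> \<exists>i\<in>N v. card (N i) \<noteq> 2" by (force simp: not_le)+
  have finV: "finite V" using graph by (simp add: simple_graph_def)
  have N_V: "N v \<subseteq> V" for v using graph unfolding N_def simple_graph_def by (auto simp: doubleton_eq_iff)
  have finN: "finite (N v)" for v using N_V finV finite_subset by blast
  define D where "D = {v \<in> V. card (N v) = 2}"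
  \<comment> \<open>The final charge is nonnegative. Degree 2: 8 - 10 + 2, with nothing to give.
    Degree 3: 2 units for at most two receivers, as one neighbor is outside \<open>D\<close>. Degree
    d >= 4: 4d - 10 >= d. Summed up, this contradicts \<open>8 |E| < 10 |V|\<close>.\<close>
  have local: "int (card (N v \<inter> D)) \<le> 4 * int (card (N v)) - 10 + 2 * of_bool (v \<in> D)" if v: "v \<in> V" for v
  proof -
    consider "card (N v) = 2" | "card (N v) = 3" | "card (N v) \<ge> 4" using d2[OF v] by linarith
    then show ?thesis
    proof cases
      case 1
      then have "N v \<inter> D = {}" using no22 by (auto simp: N_def D_def)
      then show ?thesis using 1 v by (simp add: D_def)
    next
      case 2
      then obtain i where "i \<in> N v" "i \<notin> D" using no3[OF v] by (auto simp: D_def)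
      then have "card (N v \<inter> D) < card (N v)" using finN by (intro psubset_card_mono) auto
      then show ?thesis using 2 by simp
    next
      case 3
      have "card (N v \<inter> D) \<le> card (N v)" using finN by (intro card_mono) auto
      then show ?thesis using 3 by simp
    qed
  qed
  have "(\<Sum>v\<in>V. card (N v \<inter> D)) = (\<Sum>v\<in>V. \<Sum>w\<in>D. of_bool ({v, w} \<in> E))"
  proof (rule sum.cong[OF refl])
    fix v
    have "finite D" using finV by (simp add: D_def)
    moreover have "N v \<inter> D = D \<inter> {w. {v, w} \<in> E}" by (auto simp: N_def)
    ultimately show "card (N v \<inter> D) = (\<Sum>w\<in>D. of_bool ({v, w} \<in> E))" by simp
  qed
  also have "\<dots> = (\<Sum>w\<in>D. \<Sum>v\<in>V. of_bool ({v, w} \<in> E))" by (rule sum.swap)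
  also have "\<dots> = (\<Sum>w\<in>D. 2)"
  proof (rule sum.cong[OF refl])
    fix w assume "w \<in> D"
    moreover have "{v. {v, w} \<in> E} = N w" by (simp add: N_def insert_commute)
    then have "V \<inter> {v. {v, w} \<in> E} = N w" using N_V[of w] by blast
    ultimately show "(\<Sum>v\<in>V. of_bool ({v, w} \<in> E)) = (2 :: nat)" using finV by (simp add: D_def)
  qed
  finally have "(\<Sum>v\<in>V. int (card (N v \<inter> D))) = 2 * int (card D)"
    by (simp flip: of_nat_sum)
  moreover have "(\<Sum>v\<in>V. int (card (N v \<inter> D))) \<le> (\<Sum>v\<in>V. 4 * int (card (N v)) - 10 + 2 * of_bool (v \<in> D))"
    using local by (rule sum_mono)
  moreover have "(\<Sum>v\<in>V. 4 * int (card (N v)) - 10 + 2 * of_bool (v \<in> D))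
      = 8 * int (card E) - 10 * int (card V) + 2 * int (card D)"
  proof -
    have "(\<Sum>v\<in>V. int (card (N v))) = 2 * int (card E)"
      using sum_degrees[OF graph] by (simp add: N_def flip: of_nat_sum)
    moreover have "V \<inter> D = D" by (auto simp: D_def)
    ultimately show ?thesis
      using finV by (simp add: sum.distrib sum_subtractf flip: sum_distrib_left)
  qed
  ultimately show False using sparse by linarith
qed

lemma delete_edges_graph:
  assumes "simple_graph V E"
  shows "simple_graph (V - S) (delete_edges E S)"
  using assms unfolding simple_graph_def delete_edges_def by (auto 4 4)

text \<open>Sparsity is demanded of every induced subgraph, so that it passes to
  \<open>V - S\<close> and no version of \<open>mad\<close> has to be maintained.\<close>

lemma sparse_recoloring:
  assumes "simple_graph V E"
    and "\<And>W. W \<subseteq> V \<Longrightarrow> W \<noteq> {} \<Longrightarrow> 4 * card {e \<in> E. e \<subseteq> W} < 5 * card W"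
    and "list_assignment 4 V L" "list_coloring V E L \<alpha>" "list_coloring V E L \<beta>"
  shows "\<exists>s. recoloring_sequence V E L \<alpha> \<beta> s \<and> (\<forall>v\<in>V. recolor_count s v \<le> 18)"
  using assms
proof (induction "card V" arbitrary: V E \<alpha> \<beta> rule: less_induct)
  case less
  note graph = less.prems(1)
  have finV: "finite V" and EV: "\<And>e. e \<in> E \<Longrightarrow> e \<subseteq> V"
    using graph by (auto simp: simple_graph_def)
  have del: "\<exists>s. deletion V E L \<alpha> \<beta> S s" if S: "S \<subseteq> V" "S \<noteq> {}" for S
  proof -
    have "card (V - S) < card V" using S finV by (intro psubset_card_mono) auto
    moreover have "4 * card {e \<in> delete_edges E S. e \<subseteq> W} < 5 * card W" if "W \<subseteq> V - S" "W \<noteq> {}" for W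
    proof -
      have "{e \<in> delete_edges E S. e \<subseteq> W} = {e \<in> E. e \<subseteq> W}"
        using that by (auto simp: delete_edges_def)
      then show ?thesis using less.prems(2)[of W] that by auto
    qed
    moreover have "list_assignment 4 (V - S) L" using less.prems(3) by (simp add: list_assignment_def)
    moreover have "list_coloring (V - S) (delete_edges E S) L (restrict \<phi> (V - S))"
      if "list_coloring V E L \<phi>" for \<phi>
      using that EV unfolding list_coloring_def delete_edges_def by (fastforce simp: restrict_def)
    ultimately have "\<exists>s. recoloring_sequence (V - S) (delete_edges E S) L
        (restrict \<alpha> (V - S)) (restrict \<beta> (V - S)) s \<and> (\<forall>v\<in>V - S. recolor_count s v \<le> 18)"
      using delete_edges_graph[OF graph] less.prems(4,5) by (intro less.hyps)
    then obtain s where "recoloring_sequence (V - S) (delete_edges E S) L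
        (restrict \<alpha> (V - S)) (restrict \<beta> (V - S)) s" "\<forall>v\<in>V - S. recolor_count s v \<le> 18"
      by blast
    then have "deletion V E L \<alpha> \<beta> S s"
      using less.prems S by (intro deletion.intro) auto
    then show ?thesis by blast
  qed
  show ?case
  proof (cases "V = {}")
    case True
    then have "\<alpha> = \<beta>" using less.prems(4,5) by (auto simp: list_coloring_def)
    then show ?thesis using True less.prems(4)
      by (intro exI[of _ "[\<alpha>]"]) (simp add: recoloring_sequence_def)
  next
    case False
    have "{e \<in> E. e \<subseteq> V} = E" using EV by auto
    then have "4 * card E < 5 * card V" using less.prems(2)[of V] False by simp
    from sparse_configuration[OF graph this]
    consider x where "x \<in> V" "card {w. {x, w} \<in> E} \<le> 1"
      | x y where "{x, y} \<in> E" "card {w. {x, w} \<in> E} = 2" "card {w. {y, w} \<in> E} = 2"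
      | v where "v \<in> V" "card {w. {v, w} \<in> E} = 3" "\<And>i. {v, i} \<in> E \<Longrightarrow> card {w. {i, w} \<in> E} = 2"
        "\<And>x y. {x, y} \<in> E \<Longrightarrow> card {w. {x, w} \<in> E} = 2 \<Longrightarrow> card {w. {y, w} \<in> E} \<noteq> 2"
      by blast
    then show ?thesis
    proof cases
      case 1
      then obtain s where "deletion V E L \<alpha> \<beta> {x} s" using del[of "{x}"] by auto
      then show ?thesis using deletion.extend_leaf 1 by metis
    next
      case 2
      then obtain s where "deletion V E L \<alpha> \<beta> {x, y} s" using del[of "{x, y}"] EV by blast
      then show ?thesis using deletion.extend_edge 2 by metis
    next
      \<comment> \<open>The last fact of this case, the failure of the previous configuration, makes
        the three neighbors pairwise nonadjacent, as \<open>extend_star\<close> requires.\<close>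
      case 3
      have "insert v {w. {v, w} \<in> E} \<subseteq> V" using 3(1) EV by blast
      then obtain s where "deletion V E L \<alpha> \<beta> (insert v {w. {v, w} \<in> E}) s"
        using del[of "insert v {w. {v, w} \<in> E}"] by blast
      then show ?thesis
        by (rule deletion.extend_star) (use 3 in auto)
    qed
  qed
qed

lemma mad_recoloring:
  assumes graph: "simple_graph V E" and mad: "mad V E < 5 / 2"
    and "list_assignment 4 V L" "list_coloring V E L \<alpha>" "list_coloring V E L \<beta>"
  shows "\<exists>s. recoloring_sequence V E L \<alpha> \<beta> s \<and> (\<forall>v\<in>V. recolor_count s v \<le> 18)"
proof (rule sparse_recoloring[OF graph _ assms(3-5)])
  fix W assume W: "W \<subseteq> V" "W \<noteq> {}"
  let ?F = "{e \<in> E. e \<subseteq> W}" and ?M = "{2 * real (card F) / real (card W) | W F. is_subgraph W F V E \<and> W \<noteq> {}}"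
  have fin: "finite V" using graph by (simp add: simple_graph_def)
  moreover have "E \<subseteq> Pow V" using graph by (auto simp: simple_graph_def)
  ultimately have fin: "finite V" "finite E" using finite_subset by auto
  have "?M \<subseteq> (\<lambda>(W, F). 2 * real (card F) / real (card W)) ` (Pow V \<times> Pow E)"
    by (auto simp: is_subgraph_def)
  then have "finite ?M" by (rule finite_subset) (use fin in auto)
  moreover have "is_subgraph W ?F V E"
    using graph W fin finite_subset[of W V] unfolding is_subgraph_def simple_graph_def by fastforce
  then have "2 * real (card ?F) / real (card W) \<in> ?M" using W by blast
  ultimately have "2 * real (card ?F) / real (card W) < 5 / 2"
    using mad Max_ge unfolding mad_def by (meson le_less_trans)
  moreover have "card W > 0" using W fin finite_subset[of W V] by (simp add: card_gt_0_iff)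
  ultimately show "4 * card ?F < 5 * card W" by (simp add: field_simps)
qed

section \<open>Plane theta graphs\<close>

text \<open>A point is in the inside according to its component of the complement, and a connected
  set off the curve stays in one component.\<close>

lemma connected_disjoint_Jordan:
  fixes c :: "real \<Rightarrow> complex"
  assumes "connected S" "S \<inter> path_image c = {}"
  shows "S \<subseteq> inside (path_image c) \<or> S \<subseteq> outside (path_image c)"
proof (cases "S \<inter> inside (path_image c) = {}")
  case True
  then show ?thesis using assms(2) inside_Un_outside[of "path_image c"] by blast
next
  case False
  then obtain x where x: "x \<in> S" "x \<in> inside (path_image c)" by blast
  have "y \<in> inside (path_image c)" if "y \<in> S" for y
  proof -
    have "connected_component (- path_image c) x y"
      unfolding connected_component_def using assms x that by blast
    then show ?thesis using inside_same_component x(2) by metis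
  qed
  then show ?thesis by blast
qed

text \<open>The picture of an ear: \<open>c1\<close> and \<open>c2\<close> form a cycle, and
  \<open>c3\<close> joins two of its points.\<close>

locale theta =
  fixes c1 c2 c3 :: "real \<Rightarrow> complex" and a b :: complex
  assumes arcs: "arc c1" "arc c2" "arc c3"
    and ends: "pathstart c1 = a" "pathfinish c1 = b" "pathstart c2 = a" "pathfinish c2 = b"
      "pathstart c3 = a" "pathfinish c3 = b"
    and meet: "path_image c1 \<inter> path_image c2 = {a, b}" "path_image c1 \<inter> path_image c3 = {a, b}"
      "path_image c2 \<inter> path_image c3 = {a, b}"
begin

lemma neq: "a \<noteq> b"
  using arc_distinct_ends[OF arcs(1)] ends by simp

lemma loop: "simple_path (c1 +++ reversepath c2)" "path_image (c1 +++ reversepath c2) = path_image c1 \<union> path_image c2"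
    "pathfinish (c1 +++ reversepath c2) = pathstart (c1 +++ reversepath c2)"
  using arcs ends meet
  by (auto simp: simple_path_join_loop_eq arc_reversepath path_image_join)

lemma Jordan:
  "inside (path_image c1 \<union> path_image c2) \<noteq> {}"
  "connected (inside (path_image c1 \<union> path_image c2))"
  "connected (outside (path_image c1 \<union> path_image c2))"
  "frontier (inside (path_image c1 \<union> path_image c2)) = path_image c1 \<union> path_image c2"
  using Jordan_inside_outside[OF loop(1,3)] by (simp_all add: loop(2))

lemma permute: "theta c2 c1 c3 a b" "theta c1 c3 c2 a b" "theta c2 c3 c1 a b"
  using arcs ends meet by (unfold_locales; auto)+

lemma third_not_subset: "\<not> path_image c3 \<subseteq> path_image c1 \<union> path_image c2"
proof
  assume "path_image c3 \<subseteq> path_image c1 \<union> path_image c2"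
  then have "path_image c3 \<subseteq> {a, b}" using meet by blast
  moreover have "path_image c3 - {a, b} \<noteq> {}"
    using simple_path_endless[OF arc_imp_simple_path[OF arcs(3)]] ends by auto
  ultimately show False by blast
qed

text \<open>Each inside is connected and avoids the other cycle. If they met, each would contain the
  other; equal insides have equal frontiers, and \<open>c3\<close> would be covered by the other two
  arcs.\<close>

lemma insides_disjoint:
  assumes "path_image c3 \<inter> inside (path_image c1 \<union> path_image c2) = {}"
    and "path_image c2 \<inter> inside (path_image c1 \<union> path_image c3) = {}"
  shows "inside (path_image c1 \<union> path_image c2) \<inter> inside (path_image c1 \<union> path_image c3) = {}"
proof (rule ccontr)
  assume ne: "\<not> ?thesis"
  interpret q: theta c1 c3 c2 a b by (rule permute)
  have "inside (path_image c1 \<union> path_image c2) \<inter> (path_image c1 \<union> path_image c3) = {}"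
    using assms(1) inside_no_overlap[of "path_image c1 \<union> path_image c2"] by blast
  then have "inside (path_image c1 \<union> path_image c2) \<subseteq> inside (path_image c1 \<union> path_image c3)"
    using connected_disjoint_Jordan[OF Jordan(2), of "c1 +++ reversepath c3", unfolded q.loop(2)] ne
      inside_Int_outside[of "path_image c1 \<union> path_image c3"] by blast
  moreover have "inside (path_image c1 \<union> path_image c3) \<inter> (path_image c1 \<union> path_image c2) = {}"
    using assms(2) inside_no_overlap[of "path_image c1 \<union> path_image c3"] by blast
  then have "inside (path_image c1 \<union> path_image c3) \<subseteq> inside (path_image c1 \<union> path_image c2)"
    using connected_disjoint_Jordan[OF q.Jordan(2), of "c1 +++ reversepath c2", unfolded loop(2)] ne
      inside_Int_outside[of "path_image c1 \<union> path_image c2"] by blast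
  ultimately have "path_image c1 \<union> path_image c2 = path_image c1 \<union> path_image c3"
    using Jordan(4) q.Jordan(4) by (metis subset_antisym)
  then show False using third_not_subset by blast
qed

text \<open>Otherwise a point enclosed by \<open>c1\<close> and \<open>c2\<close> can be joined to infinity in the complements of both
  other curves, hence by Janiszewski's theorem in the complement of all three arcs.\<close>

lemma some_arc_inside:
  "path_image c3 \<inter> inside (path_image c1 \<union> path_image c2) \<noteq> {} \<or>
   path_image c2 \<inter> inside (path_image c1 \<union> path_image c3) \<noteq> {} \<or>
   path_image c1 \<inter> inside (path_image c2 \<union> path_image c3) \<noteq> {}"
proof (rule ccontr)
  assume "\<not> ?thesis"
  then have none: "path_image c3 \<inter> inside (path_image c1 \<union> path_image c2) = {}"
    "path_image c2 \<inter> inside (path_image c1 \<union> path_image c3) = {}"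
    "path_image c1 \<inter> inside (path_image c2 \<union> path_image c3) = {}" by auto
  interpret q: theta c1 c3 c2 a b by (rule permute)
  interpret r: theta c2 c3 c1 a b by (rule permute)
  interpret s: theta c2 c1 c3 a b by (rule permute)
  obtain x where x: "x \<in> inside (path_image c1 \<union> path_image c2)" using Jordan(1) by blast
  have "x \<notin> inside (path_image c1 \<union> path_image c3)" "x \<notin> inside (path_image c2 \<union> path_image c3)"
    using insides_disjoint s.insides_disjoint none x by (auto simp: Un_commute)
  moreover have "x \<notin> path_image c1 \<union> path_image c2 \<union> path_image c3"
    using x none inside_no_overlap[of "path_image c1 \<union> path_image c2"] by blast
  ultimately have out: "x \<in> outside (path_image c1 \<union> path_image c3)" "x \<in> outside (path_image c2 \<union> path_image c3)"
    by (auto simp: outside_inside)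
  have comp: "compact (path_image c1 \<union> path_image c3)" "compact (path_image c2 \<union> path_image c3)"
    using arcs by (auto intro!: compact_Un compact_arc_image)
  have "bounded (path_image c1 \<union> path_image c2 \<union> path_image c3)"
    using arcs by (auto simp: bounded_arc_image)
  then obtain z where z: "z \<in> outside (path_image c1 \<union> path_image c2 \<union> path_image c3)"
    using outside_bounded_nonempty by blast
  have zo: "z \<in> outside (path_image c1 \<union> path_image c2)" "z \<in> outside (path_image c1 \<union> path_image c3)"
    "z \<in> outside (path_image c2 \<union> path_image c3)"
    by (rule subsetD[OF outside_mono z], blast)+
  have "connected_component (- (path_image c1 \<union> path_image c3)) x z"
    unfolding connected_component_def using q.Jordan(3) out(1) zo(2) outside_no_overlap by blast
  moreover have "connected_component (- (path_image c2 \<union> path_image c3)) x z"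
    unfolding connected_component_def using r.Jordan(3) out(2) zo(3) outside_no_overlap by blast
  \<comment> \<open>Janiszewski's theorem needs a connected intersection of the two cycles; here it
    is the arc \<open>c3\<close>.\<close>
  moreover have "(path_image c1 \<union> path_image c3) \<inter> (path_image c2 \<union> path_image c3) = path_image c3"
    using meet ends pathstart_in_path_image[of c3] pathfinish_in_path_image[of c3] by auto
  then have "connected ((path_image c1 \<union> path_image c3) \<inter> (path_image c2 \<union> path_image c3))"
    using connected_arc_image[OF arcs(3)] by simp
  ultimately have "connected_component (- ((path_image c1 \<union> path_image c3) \<union> (path_image c2 \<union> path_image c3))) x z"
    using Janiszewski[OF comp(1) compact_imp_closed[OF comp(2)]] by blast
  then have "connected_component (- (path_image c1 \<union> path_image c2)) x z"
    by (rule connected_component_of_subset) blast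
  then have "z \<in> inside (path_image c1 \<union> path_image c2)"
    using inside_same_component x by metis
  then show False using zo(1) inside_Int_outside by blast
qed

lemma split:
  assumes "path_image c3 \<inter> inside (path_image c1 \<union> path_image c2) \<noteq> {}"
  shows "inside (path_image c1 \<union> path_image c3) \<inter> inside (path_image c2 \<union> path_image c3) = {}"
    "inside (path_image c1 \<union> path_image c3) \<union> inside (path_image c2 \<union> path_image c3) \<union>
      (path_image c3 - {a, b}) = inside (path_image c1 \<union> path_image c2)"
  using split_inside_simple_closed_curve[OF arc_imp_simple_path[OF arcs(1)] ends(1,2)
      arc_imp_simple_path[OF arcs(2)] ends(3,4) arc_imp_simple_path[OF arcs(3)] ends(5,6) neq meet assms]
  by metis+

lemma split_inside_face:
  assumes "path_image c3 - {a, b} \<subseteq> inside (path_image c1 \<union> path_image c2)"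
  shows "inside (path_image c1 \<union> path_image c3) \<inter> inside (path_image c2 \<union> path_image c3) = {}"
    "inside (path_image c1 \<union> path_image c3) \<union> inside (path_image c2 \<union> path_image c3)
      = inside (path_image c1 \<union> path_image c2) - path_image c3"
proof -
  have ne: "path_image c3 \<inter> inside (path_image c1 \<union> path_image c2) \<noteq> {}"
    using assms third_not_subset ends pathstart_in_path_image[of c1] pathfinish_in_path_image[of c1] by blast
  show "inside (path_image c1 \<union> path_image c3) \<inter> inside (path_image c2 \<union> path_image c3) = {}"
    by (rule split(1)[OF ne])
  have "{a, b} \<inter> inside (path_image c1 \<union> path_image c2) = {}"
    using ends pathstart_in_path_image[of c1] pathfinish_in_path_image[of c1]
      inside_no_overlap[of "path_image c1 \<union> path_image c2"] by blast
  then show "inside (path_image c1 \<union> path_image c3) \<union> inside (path_image c2 \<union> path_image c3)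
      = inside (path_image c1 \<union> path_image c2) - path_image c3"
    using split(2)[OF ne] inside_no_overlap[of "path_image c1 \<union> path_image c3"]
      inside_no_overlap[of "path_image c2 \<union> path_image c3"] by blast
qed

text \<open>When \<open>c2\<close> runs inside the cycle of \<open>c1\<close> and \<open>c3\<close>,
  that cycle is the outer boundary. The split of its inside by \<open>c2\<close>, read in the
  complement, becomes a split of the outside of \<open>c1\<close> and \<open>c2\<close> by
  \<open>c3\<close>.\<close>

lemma split_outside_face:
  assumes "path_image c2 \<inter> inside (path_image c1 \<union> path_image c3) \<noteq> {}"
  shows "outside (path_image c1 \<union> path_image c3) \<inter> inside (path_image c2 \<union> path_image c3) = {}"
    "outside (path_image c1 \<union> path_image c3) \<union> inside (path_image c2 \<union> path_image c3)
      = outside (path_image c1 \<union> path_image c2) - path_image c3"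
proof -
  interpret q: theta c1 c3 c2 a b by (rule permute)
  note s = q.split[OF assms, unfolded Un_commute[of "path_image c3" "path_image c2"]]
  show 1: "outside (path_image c1 \<union> path_image c3) \<inter> inside (path_image c2 \<union> path_image c3) = {}"
    using s(2) inside_Int_outside by blast
  have o: "outside (path_image c1 \<union> path_image c3) = - (path_image c1 \<union> path_image c3 \<union> inside (path_image c1 \<union> path_image c3))"
    "outside (path_image c1 \<union> path_image c2) = - (path_image c1 \<union> path_image c2 \<union> inside (path_image c1 \<union> path_image c2))"
    by (rule outside_inside)+
  have aux: "- (P1 \<union> P3 \<union> I13) \<union> I23 = - (P1 \<union> P2 \<union> I12) - P3"
    if "I12 \<inter> I23 = {}" "I12 \<union> I23 \<union> (P2 - {a, b}) = I13" "I13 \<inter> (P1 \<union> P3) = {}"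
      "I23 \<inter> (P2 \<union> P3) = {}" "a \<in> P1" "b \<in> P1" for P1 P2 P3 I12 I13 I23 :: "complex set"
    using that by blast
  have "a \<in> path_image c1" "b \<in> path_image c1"
    using ends pathstart_in_path_image[of c1] pathfinish_in_path_image[of c1] by auto
  then show "outside (path_image c1 \<union> path_image c3) \<union> inside (path_image c2 \<union> path_image c3)
      = outside (path_image c1 \<union> path_image c2) - path_image c3"
    unfolding o by (intro aux[OF s inside_no_overlap inside_no_overlap])
qed

text \<open>If \<open>f\<close> is the outside, then \<open>c3\<close> misses the inside of the
  other two arcs, and \<open>some_arc_inside\<close> puts \<open>c1\<close> or \<open>c2\<close>
  inside a cycle. Which one decides which of the two new faces is the outside of its
  boundary.\<close>

lemma split_face:
  assumes f: "f = inside (path_image c1 \<union> path_image c2) \<or> f = outside (path_image c1 \<union> path_image c2)"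
    and sub: "path_image c3 - {a, b} \<subseteq> f"
  obtains f1 f2 where
    "f1 = inside (path_image c1 \<union> path_image c3) \<or> f1 = outside (path_image c1 \<union> path_image c3)"
    "f2 = inside (path_image c2 \<union> path_image c3) \<or> f2 = outside (path_image c2 \<union> path_image c3)"
    "f1 \<inter> f2 = {}" "f1 \<union> f2 = f - path_image c3"
proof -
  interpret s: theta c2 c1 c3 a b by (rule permute)
  consider "f = inside (path_image c1 \<union> path_image c2)"
    | "f = outside (path_image c1 \<union> path_image c2)" "path_image c2 \<inter> inside (path_image c1 \<union> path_image c3) \<noteq> {}"
    | "f = outside (path_image c1 \<union> path_image c2)" "path_image c1 \<inter> inside (path_image c2 \<union> path_image c3) \<noteq> {}"
  proof -
    have "path_image c3 \<inter> inside (path_image c1 \<union> path_image c2) = {}"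
      if "f = outside (path_image c1 \<union> path_image c2)"
    proof -
      have "{a, b} \<subseteq> path_image c1 \<union> path_image c2" using meet by blast
      then show ?thesis using sub that inside_Int_outside[of "path_image c1 \<union> path_image c2"]
          inside_no_overlap[of "path_image c1 \<union> path_image c2"] by blast
    qed
    then show thesis using that f some_arc_inside by blast
  qed
  then show thesis
  proof cases
    case 1
    then have "path_image c3 - {a, b} \<subseteq> inside (path_image c1 \<union> path_image c2)" using sub by simp
    from split_inside_face[OF this] 1 show thesis by (intro that) auto
  next
    case 2
    from split_outside_face[OF 2(2)] 2(1) show thesis by (intro that) auto
  next
    case 3
    show thesis
      by (rule that[of "inside (path_image c1 \<union> path_image c3)" "outside (path_image c2 \<union> path_image c3)"])
        (use 3 s.split_outside_face in \<open>auto simp: Un_commute\<close>)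
  qed
qed

end

section \<open>Edge sets of paths and cycles\<close>

fun path_edges :: "'a list \<Rightarrow> 'a set set" where
  "path_edges (x # y # zs) = insert {x, y} (path_edges (y # zs))"
| "path_edges _ = {}"

lemma path_edges_append: "path_edges (xs @ z # ys) = path_edges (xs @ [z]) \<union> path_edges (z # ys)"
proof (induction xs)
  case Nil
  show ?case by simp
next
  case (Cons x xs)
  then show ?case by (cases xs) auto
qed

lemma path_edges_rev [simp]: "path_edges (rev xs) = path_edges xs"
proof (induction xs rule: path_edges.induct)
  case (1 x y zs)
  have "path_edges (rev (x # y # zs)) = path_edges (rev zs @ [y]) \<union> path_edges [y, x]"
    using path_edges_append[of "rev zs" y "[x]"] by simp
  then show ?case using 1 by (auto simp: insert_commute)
qed auto

lemma path_edges_subset: "e \<in> path_edges xs \<Longrightarrow> e \<subseteq> set xs"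
  by (induction xs rule: path_edges.induct) auto

lemma path_edges_nonempty: "e \<in> path_edges xs \<Longrightarrow> e \<noteq> {}"
  by (induction xs rule: path_edges.induct) auto

lemma Union_path_edges: "length xs \<ge> 2 \<Longrightarrow> \<Union> (path_edges xs) = set xs"
proof (induction xs rule: path_edges.induct)
  case (1 x y zs)
  then show ?case by (cases zs) auto
qed auto

lemma finite_path_edges [simp]: "finite (path_edges xs)"
  by (induction xs rule: path_edges.induct) auto

lemma card_path_edges: "distinct xs \<Longrightarrow> card (path_edges xs) = length xs - 1"
proof (induction xs rule: path_edges.induct)
  case (1 x y zs)
  have "{x, y} \<notin> path_edges (y # zs)" using 1(2) path_edges_subset by fastforce
  then show ?case using 1 by simp
qed auto

text \<open>The path is closed by repeating its first vertex. Lists of length 1 and 2 give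
  \<open>{{x}}\<close> and a single edge, hence the recurring condition
  \<open>length c >= 3\<close>.\<close>

fun cycle_edges :: "'a list \<Rightarrow> 'a set set" where
  "cycle_edges (x # xs) = path_edges (x # xs @ [x])"
| "cycle_edges [] = {}"

lemma cycle_edges_rotate1: "cycle_edges (rotate1 c) = cycle_edges c"
proof (cases c)
  case (Cons x xs)
  then show ?thesis
  proof (cases xs)
    case (Cons y ys)
    have "cycle_edges (rotate1 c) = path_edges (y # ys @ [x]) \<union> path_edges [x, y]"
      using path_edges_append[of "y # ys" x "[y]"] \<open>c = x # xs\<close> Cons by simp
    also have "\<dots> = cycle_edges c" using \<open>c = x # xs\<close> Cons by auto
    finally show ?thesis .
  qed simp
qed simp

lemma cycle_edges_rotate: "cycle_edges (rotate n c) = cycle_edges c"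
  by (induction n) (simp_all add: cycle_edges_rotate1)

lemma cycle_edges_split:
  "cycle_edges (u # xs @ w # ys) = path_edges (u # xs @ [w]) \<union> path_edges (w # ys @ [u])"
  using path_edges_append[of "u # xs" w "ys @ [u]"] by simp

lemma cycle_through_two:
  assumes "distinct c" "u \<in> set c" "w \<in> set c" "u \<noteq> w"
  obtains xs ys where "distinct (u # xs @ w # ys)" "set (u # xs @ w # ys) = set c"
    "cycle_edges c = cycle_edges (u # xs @ w # ys)"
proof -
  obtain l1 l2 where c: "c = l1 @ u # l2" using assms(2) split_list by metis
  have r: "rotate (length l1) c = u # l2 @ l1" unfolding c by (simp add: rotate_append)
  have "w \<in> set (l2 @ l1)" using assms(3,4) c by auto
  then obtain xs ys where xy: "l2 @ l1 = xs @ w # ys" using split_list by metis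
  show thesis
  proof (rule that[of xs ys])
    have "distinct (rotate (length l1) c)" "set (rotate (length l1) c) = set c" using assms(1) by simp_all
    then show "distinct (u # xs @ w # ys)" "set (u # xs @ w # ys) = set c" unfolding r xy .
    show "cycle_edges c = cycle_edges (u # xs @ w # ys)"
      using cycle_edges_rotate[of "length l1" c] unfolding r xy by simp
  qed
qed

text \<open>The two paths share only \<open>u\<close> and \<open>w\<close>, so a common edge would
  lie within \<open>{u, w}\<close>; a path with an inner vertex has no such edge.\<close>

lemma path_edges_disjoint:
  assumes "distinct (u # xs @ w # ys)" "xs \<noteq> [] \<or> ys \<noteq> []"
  shows "path_edges (u # xs @ [w]) \<inter> path_edges (w # ys @ [u]) = {}"
proof (rule ccontr)
  assume "\<not> ?thesis"
  then obtain e where e: "e \<in> path_edges (u # xs @ [w])" "e \<in> path_edges (w # ys @ [u])" by blast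
  then have sub: "e \<subseteq> {u, w}" using assms(1) path_edges_subset by fastforce
  have not: "\<not> e \<subseteq> {a, b}" if prem: "e \<in> path_edges (a # zs @ [b])" "zs \<noteq> []" "distinct (a # zs @ [b])" for a b zs
  proof -
    obtain z zs' where zs: "zs = z # zs'" using prem(2) by (cases zs) auto
    obtain q qs where q: "zs = qs @ [q]" using prem(2) by (cases zs rule: rev_cases) auto
    have "e = {a, z} \<or> e \<in> path_edges (zs @ [b])" using prem(1) zs by auto
    moreover have "path_edges (zs @ [b]) = path_edges zs \<union> {{q, b}}"
      using path_edges_append[of qs q "[b]"] q by auto
    ultimately have "e = {a, z} \<or> e \<subseteq> set zs \<and> e \<noteq> {} \<or> e = {q, b}"
      using path_edges_subset path_edges_nonempty by blast
    moreover have "z \<in> set zs" using zs by simp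
    moreover have "q \<in> set zs" using q by simp
    moreover have "a \<notin> set zs" "b \<notin> set zs" using prem(3) by auto
    ultimately show ?thesis by blast
  qed
  show False
    using assms not[OF e(1)] not[OF e(2)] sub by (auto simp: insert_commute)
qed

lemma card_cycle_edges:
  assumes "distinct c" "length c \<ge> 3"
  shows "card (cycle_edges c) = length c"
proof -
  obtain x y z zs where c: "c = x # y # z # zs"
    using assms(2) by (metis Suc_le_length_iff numeral_3_eq_3)
  have "path_edges (x # [] @ [y]) \<inter> path_edges (y # (z # zs) @ [x]) = {}"
    by (rule path_edges_disjoint) (use assms c in auto)
  moreover have "cycle_edges c = path_edges [x, y] \<union> path_edges (y # (z # zs) @ [x])" using c by auto
  moreover have "card (path_edges (y # (z # zs) @ [x])) = length c - 1"
    using assms c by (subst card_path_edges) auto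
  ultimately have "card (cycle_edges c) = card (path_edges [x, y]) + (length c - 1)"
    by (metis append_Nil card_Un_disjoint finite_path_edges)
  then show ?thesis using c by simp
qed

lemma Union_cycle_edges: "length c \<ge> 2 \<Longrightarrow> \<Union> (cycle_edges c) = set c"
  by (cases c) (auto simp: Union_path_edges simp del: path_edges.simps)

lemma is_cycle_cycle_edges:
  assumes "distinct c" "length c \<ge> 3" "cycle_edges c \<subseteq> E" "set c \<subseteq> V"
  shows "is_cycle V E c"
proof -
  have nth: "{xs ! i, xs ! Suc i} \<in> path_edges xs" if "Suc i < length xs" for xs :: "'a list" and i
    using that
  proof (induction xs arbitrary: i rule: path_edges.induct)
    case (1 x y zs)
    then show ?case by (cases i) auto
  qed auto
  obtain x xs where c: "c = x # xs" using assms(2) by (cases c) auto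
  have "{c ! i, c ! (Suc i mod length c)} \<in> E" if i: "i < length c" for i
  proof -
    have "{(c @ [x]) ! i, (c @ [x]) ! Suc i} \<in> cycle_edges c"
      using nth[of i "c @ [x]"] i c by simp
    moreover have "(c @ [x]) ! i = c ! i" using i by (simp add: nth_append)
    moreover have "(c @ [x]) ! Suc i = c ! (Suc i mod length c)"
      using i c by (cases "Suc i = length c") (auto simp: nth_append)
    ultimately show ?thesis using assms(3) by auto
  qed
  then show ?thesis using assms by (simp add: is_cycle_def)
qed

section \<open>Faces of plane graphs\<close>

definition drawn :: "('a set \<Rightarrow> real \<Rightarrow> complex) \<Rightarrow> 'a set set \<Rightarrow> complex set" where
  "drawn \<gamma> F = (\<Union>e\<in>F. path_image (\<gamma> e))"

lemma drawn_Un: "drawn \<gamma> (F \<union> G) = drawn \<gamma> F \<union> drawn \<gamma> G"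
  by (auto simp: drawn_def)

lemma drawn_mono: "F \<subseteq> G \<Longrightarrow> drawn \<gamma> F \<subseteq> drawn \<gamma> G"
  by (auto simp: drawn_def)

text \<open>Prepares the ears: a connected open arc stays in one face, and its ends, being limits of
  it, lie in the closure of that face.\<close>

lemma arc_interior:
  fixes g :: "real \<Rightarrow> complex"
  assumes "arc g" and i: "I = path_image g - {pathstart g, pathfinish g}"
  shows "connected I" "I \<noteq> {}" "pathstart g \<in> closure I" "pathfinish g \<in> closure I"
proof -
  have simple: "simple_path g" using assms(1) by (rule arc_imp_simple_path)
  show "connected I" unfolding i by (rule connected_simple_path_endless[OF simple])
  have eq: "I = g ` {0<..<1}" unfolding i by (rule simple_path_endless[OF simple])
  then show "I \<noteq> {}" by simp
  have "continuous_on (closure {0<..<1}) g"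
    using assms(1) by (simp add: arc_def path_def)
  then have "g ` closure {0<..<1} \<subseteq> closure (g ` {0<..<1})"
    by (rule image_closure_subset) (auto simp: closure_subset)
  then have "g ` {0..1} \<subseteq> closure I" unfolding eq by simp
  then show "pathstart g \<in> closure I" "pathfinish g \<in> closure I"
    by (auto simp: pathstart_def pathfinish_def)
qed

locale drawing =
  fixes V :: "'a set" and E :: "'a set set" and p :: "'a \<Rightarrow> complex"
    and \<gamma> :: "'a set \<Rightarrow> real \<Rightarrow> complex"
  assumes graph: "simple_graph V E" and drawing: "plane_drawing V E p \<gamma>"
begin

lemma inj: "inj_on p V"
  using drawing by (simp add: plane_drawing_def)

lemma edge_arc: "e \<in> E \<Longrightarrow> arc (\<gamma> e)"
  and edge_ends: "e \<in> E \<Longrightarrow> {pathstart (\<gamma> e), pathfinish (\<gamma> e)} = p ` e"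
  and edge_vertices: "e \<in> E \<Longrightarrow> path_image (\<gamma> e) \<inter> p ` V = p ` e"
  and edges_meet: "e \<in> E \<Longrightarrow> f \<in> E \<Longrightarrow> e \<noteq> f \<Longrightarrow> path_image (\<gamma> e) \<inter> path_image (\<gamma> f) = p ` (e \<inter> f)"
  using drawing by (auto simp: plane_drawing_def)

lemma edge_subset: "e \<in> E \<Longrightarrow> e \<subseteq> V"
  using graph by (auto simp: simple_graph_def)

lemma vertex_drawn_iff:
  assumes "F \<subseteq> E" "v \<in> V"
  shows "p v \<in> drawn \<gamma> F \<longleftrightarrow> v \<in> \<Union>F"
proof
  assume "p v \<in> drawn \<gamma> F"
  then obtain e where e: "e \<in> F" "p v \<in> path_image (\<gamma> e)" by (auto simp: drawn_def)
  then have "p v \<in> p ` e" using edge_vertices[of e] assms by blast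
  then have "v \<in> e" using inj assms(2) edge_subset[of e] e(1) assms(1) by (auto dest: inj_onD)
  then show "v \<in> \<Union>F" using e by blast
next
  assume "v \<in> \<Union>F"
  then obtain e where "e \<in> F" "v \<in> e" by blast
  then have "p v \<in> path_image (\<gamma> e)" using edge_vertices[of e] assms by blast
  then show "p v \<in> drawn \<gamma> F" using \<open>e \<in> F\<close> by (auto simp: drawn_def)
qed

lemma drawn_meet:
  assumes "F \<subseteq> E" "G \<subseteq> E" "F \<inter> G = {}"
  shows "drawn \<gamma> F \<inter> drawn \<gamma> G = p ` (\<Union>F \<inter> \<Union>G)"
proof
  show "drawn \<gamma> F \<inter> drawn \<gamma> G \<subseteq> p ` (\<Union>F \<inter> \<Union>G)"
  proof
    fix x assume "x \<in> drawn \<gamma> F \<inter> drawn \<gamma> G"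
    then obtain e f where ef: "e \<in> F" "f \<in> G" "x \<in> path_image (\<gamma> e) \<inter> path_image (\<gamma> f)"
      by (auto simp: drawn_def)
    then have "x \<in> p ` (e \<inter> f)" using edges_meet[of e f] assms by blast
    then show "x \<in> p ` (\<Union>F \<inter> \<Union>G)" using ef by blast
  qed
  show "p ` (\<Union>F \<inter> \<Union>G) \<subseteq> drawn \<gamma> F \<inter> drawn \<gamma> G"
  proof
    fix x assume "x \<in> p ` (\<Union>F \<inter> \<Union>G)"
    then obtain v where v: "x = p v" "v \<in> \<Union>F" "v \<in> \<Union>G" by blast
    then have "v \<in> V" using edge_subset assms by blast
    then show "x \<in> drawn \<gamma> F \<inter> drawn \<gamma> G" using v vertex_drawn_iff assms by blast
  qed
qed

text \<open>A drawing does not prescribe the direction of \<open>\<gamma> e\<close>, so the curve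
  may have to be reversed.\<close>

lemma edge_path:
  assumes "{x, y} \<in> E" "x \<noteq> y"
  obtains g where "arc g" "pathstart g = p x" "pathfinish g = p y" "path_image g = path_image (\<gamma> {x, y})"
proof -
  have "{pathstart (\<gamma> {x, y}), pathfinish (\<gamma> {x, y})} = {p x, p y}" using edge_ends[OF assms(1)] by simp
  then consider "pathstart (\<gamma> {x, y}) = p x" "pathfinish (\<gamma> {x, y}) = p y"
    | "pathstart (\<gamma> {x, y}) = p y" "pathfinish (\<gamma> {x, y}) = p x" by (auto simp: doubleton_eq_iff)
  then show thesis
  proof cases
    case 1
    then show thesis using that[of "\<gamma> {x, y}"] edge_arc[OF assms(1)] by simp
  next
    case 2
    then show thesis using that[of "reversepath (\<gamma> {x, y})"] edge_arc[OF assms(1)]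
      by (simp add: arc_reversepath)
  qed
qed

lemma path_arc:
  assumes "distinct (x # xs)" "xs \<noteq> []" "path_edges (x # xs) \<subseteq> E"
  shows "\<exists>g. arc g \<and> pathstart g = p x \<and> pathfinish g = p (last xs) \<and>
    path_image g = drawn \<gamma> (path_edges (x # xs))"
  using assms
proof (induction xs arbitrary: x)
  case (Cons y ys)
  have e: "{x, y} \<in> E" "x \<noteq> y" using Cons.prems by auto
  obtain g where g: "arc g" "pathstart g = p x" "pathfinish g = p y" "path_image g = path_image (\<gamma> {x, y})"
    using edge_path[OF e] by blast
  show ?case
  proof (cases "ys = []")
    case True
    then show ?thesis using g by (auto simp: drawn_def)
  next
    case False
    then obtain h where h: "arc h" "pathstart h = p y" "pathfinish h = p (last ys)"
      "path_image h = drawn \<gamma> (path_edges (y # ys))" using Cons.IH[of y] Cons.prems by auto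
    have notin: "{x, y} \<notin> path_edges (y # ys)"
      using Cons.prems(1) path_edges_subset[of "{x, y}" "y # ys"] by auto
    have "path_image g \<inter> path_image h = drawn \<gamma> {{x, y}} \<inter> drawn \<gamma> (path_edges (y # ys))"
      using g h by (simp add: drawn_def)
    also have "\<dots> = p ` ({x, y} \<inter> \<Union> (path_edges (y # ys)))"
      using e notin Cons.prems(3) by (subst drawn_meet) auto
    also have "\<Union> (path_edges (y # ys)) = set (y # ys)"
      using False by (intro Union_path_edges) (cases ys, auto)
    finally have "path_image g \<inter> path_image h \<subseteq> {p y}" using Cons.prems(1) by auto
    then have "arc (g +++ h)" using g h by (intro arc_join) auto
    moreover have "path_image (g +++ h) = drawn \<gamma> (path_edges (x # y # ys))"
      using g h by (simp add: path_image_join drawn_def)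
    ultimately show ?thesis using g h False by (intro exI[of _ "g +++ h"]) simp
  qed
qed simp

text \<open>Each pair consists of a face and the edges of its boundary cycle. The two equations are Euler's
  formula and the double counting of edges by faces.\<close>

definition face_system :: "'a set \<Rightarrow> 'a set set \<Rightarrow> (complex set \<times> 'a set set) set \<Rightarrow> bool" where
  "face_system W F \<F> \<longleftrightarrow>
     W = \<Union>F \<and> F \<subseteq> E \<and> finite \<F> \<and> card \<F> + card W = card F + 2 \<and>
     (\<Sum>(f, D)\<in>\<F>. card D) = 2 * card F \<and>
     (\<forall>(f, D)\<in>\<F>. D \<subseteq> F \<and> (\<exists>c. distinct c \<and> length c \<ge> 3 \<and> D = cycle_edges c) \<and>
        (f = inside (drawn \<gamma> D) \<or> f = outside (drawn \<gamma> D))) \<and>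
     (\<forall>x\<in>\<F>. \<forall>y\<in>\<F>. x \<noteq> y \<longrightarrow> fst x \<inter> fst y = {}) \<and>
     (\<Union>(f, D)\<in>\<F>. f) = - drawn \<gamma> F"

lemma cycle_arcs:
  assumes c: "distinct (u # xs @ w # ys)" "xs \<noteq> [] \<or> ys \<noteq> []"
    and E: "cycle_edges (u # xs @ w # ys) \<subseteq> E"
  obtains g h where "arc g" "arc h" "pathstart g = p u" "pathfinish g = p w"
    "pathstart h = p u" "pathfinish h = p w"
    "path_image g = drawn \<gamma> (path_edges (u # xs @ [w]))"
    "path_image h = drawn \<gamma> (path_edges (w # ys @ [u]))"
    "path_image g \<inter> path_image h = {p u, p w}"
proof -
  note split = cycle_edges_split[of u xs w ys]
  obtain g where g: "arc g" "pathstart g = p u" "pathfinish g = p w"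
    "path_image g = drawn \<gamma> (path_edges (u # xs @ [w]))"
    using path_arc[of u "xs @ [w]"] c(1) E split by auto
  obtain h where h: "arc h" "pathstart h = p w" "pathfinish h = p u"
    "path_image h = drawn \<gamma> (path_edges (w # ys @ [u]))"
    using path_arc[of w "ys @ [u]"] c(1) E split by auto
  have U: "\<Union> (path_edges (u # xs @ [w])) = set (u # xs @ [w])"
    "\<Union> (path_edges (w # ys @ [u])) = set (w # ys @ [u])"
    by (rule Union_path_edges, simp)+
  have sub: "path_edges (u # xs @ [w]) \<subseteq> E" "path_edges (w # ys @ [u]) \<subseteq> E"
    using E split by simp_all
  have "path_image g \<inter> path_image h = p ` (set (u # xs @ [w]) \<inter> set (w # ys @ [u]))"
    unfolding g(4) h(4) U[symmetric] by (rule drawn_meet[OF sub path_edges_disjoint[OF c]])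
  also have "set (u # xs @ [w]) \<inter> set (w # ys @ [u]) = {u, w}" using c(1) by auto
  finally have "path_image g \<inter> path_image h = {p u, p w}" by simp
  then show thesis
    using that[of g "reversepath h"] g h by (simp add: arc_reversepath)
qed

lemma cycle_Jordan:
  assumes "distinct c" "length c \<ge> 3" "cycle_edges c \<subseteq> E"
  shows "inside (drawn \<gamma> (cycle_edges c)) \<noteq> {}"
    "open (inside (drawn \<gamma> (cycle_edges c)))" "open (outside (drawn \<gamma> (cycle_edges c)))"
    "frontier (inside (drawn \<gamma> (cycle_edges c))) = drawn \<gamma> (cycle_edges c)"
    "frontier (outside (drawn \<gamma> (cycle_edges c))) = drawn \<gamma> (cycle_edges c)"
proof -
  obtain u w y ys where c: "c = u # [] @ w # y # ys"
    using assms(2) by (metis Suc_le_length_iff append_Nil numeral_3_eq_3)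
  obtain g h where gh: "arc g" "arc h" "pathstart g = p u" "pathfinish g = p w"
    "pathstart h = p u" "pathfinish h = p w"
    "path_image g = drawn \<gamma> (path_edges (u # [] @ [w]))"
    "path_image h = drawn \<gamma> (path_edges (w # (y # ys) @ [u]))"
    "path_image g \<inter> path_image h = {p u, p w}"
    using cycle_arcs[of u "[]" w "y # ys"] assms(1,3) c by blast
  have sp: "simple_path (g +++ reversepath h)"
    "pathfinish (g +++ reversepath h) = pathstart (g +++ reversepath h)"
    using gh by (auto simp: simple_path_join_loop_eq arc_reversepath)
  have "path_image (g +++ reversepath h) = drawn \<gamma> (cycle_edges c)"
    using gh cycle_edges_split[of u "[]" w "y # ys"] c by (simp add: path_image_join drawn_Un[symmetric])
  then show "inside (drawn \<gamma> (cycle_edges c)) \<noteq> {}"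
    "open (inside (drawn \<gamma> (cycle_edges c)))" "open (outside (drawn \<gamma> (cycle_edges c)))"
    "frontier (inside (drawn \<gamma> (cycle_edges c))) = drawn \<gamma> (cycle_edges c)"
    "frontier (outside (drawn \<gamma> (cycle_edges c))) = drawn \<gamma> (cycle_edges c)"
    using Jordan_inside_outside[OF sp] by simp_all
qed

text \<open>The start of the construction: inside and outside share one boundary. They still count
  as two pairs, as the inside is nonempty and disjoint from the outside.\<close>

lemma face_system_cycle:
  assumes c: "distinct c" "length c \<ge> 3" "cycle_edges c \<subseteq> E"
  shows "\<exists>\<F>. face_system (set c) (cycle_edges c) \<F>"
proof -
  let ?D = "cycle_edges c"
  let ?i = "inside (drawn \<gamma> ?D)" and ?o = "outside (drawn \<gamma> ?D)"
  have ne: "(?i, ?D) \<noteq> (?o, ?D)"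
    using cycle_Jordan(1)[OF c] inside_Int_outside[of "drawn \<gamma> ?D"] by (metis Int_absorb prod.inject)
  have "card (set c) = card ?D" using card_cycle_edges[OF c(1,2)] distinct_card[OF c(1)] by simp
  moreover have "set c = \<Union>?D" using Union_cycle_edges[of c] c(2) by simp
  ultimately have "face_system (set c) ?D {(?i, ?D), (?o, ?D)}"
    unfolding face_system_def using c ne by (auto simp: Int_commute)
  then show ?thesis by blast
qed


text \<open>Only one pair is replaced: the boundary \<open>D = A \<union> B\<close> of the face
  containing the ear gives way to \<open>A \<union> P\<close> and \<open>B \<union> P\<close>. There
  is one more face, \<open>length zs\<close> more vertices and one more edge than that, and the
  boundary total grows by \<open>2 * card P\<close>.\<close>

lemma face_system_ear:
  assumes FS: "face_system W F \<F>" and uw: "u \<in> W" "w \<in> W"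
    and zs: "distinct (u # zs @ [w])" "set zs \<inter> W = {}"
    and ear: "path_edges (u # zs @ [w]) \<subseteq> E - F"
  shows "\<exists>\<F>'. face_system (W \<union> set zs) (F \<union> path_edges (u # zs @ [w])) \<F>'"
proof -
  define P where "P = path_edges (u # zs @ [w])"
  have W: "W = \<Union>F" and FE: "F \<subseteq> E" and finFF: "finite \<F>"
    and count: "card \<F> + card W = card F + 2" and sum: "(\<Sum>(f, D)\<in>\<F>. card D) = 2 * card F"
    and cover: "(\<Union>(f, D)\<in>\<F>. f) = - drawn \<gamma> F"
    using FS unfolding face_system_def by - (elim conjE, assumption)+
  have "\<forall>(f, D)\<in>\<F>. D \<subseteq> F \<and> (\<exists>c. distinct c \<and> length c \<ge> 3 \<and> D = cycle_edges c) \<and>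
      (f = inside (drawn \<gamma> D) \<or> f = outside (drawn \<gamma> D))"
    using FS unfolding face_system_def by (elim conjE)
  then have faces: "D \<subseteq> F" "\<exists>c. distinct c \<and> length c \<ge> 3 \<and> D = cycle_edges c"
    "f = inside (drawn \<gamma> D) \<or> f = outside (drawn \<gamma> D)" if "(f, D) \<in> \<F>" for f D
    using that by fastforce+
  have "\<forall>x\<in>\<F>. \<forall>y\<in>\<F>. x \<noteq> y \<longrightarrow> fst x \<inter> fst y = {}"
    using FS unfolding face_system_def by (elim conjE)
  then have disj: "fst x \<inter> fst y = {}" if "x \<in> \<F>" "y \<in> \<F>" "x \<noteq> y" for x y
    using that by blast
  have finV: "finite V" using graph by (simp add: simple_graph_def)
  have "E \<subseteq> Pow V" using edge_subset by blast
  then have finE: "finite E" using finV finite_subset by auto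
  have finF: "finite F" using FE finE finite_subset by blast
  have WV: "W \<subseteq> V" using W FE edge_subset by blast
  have finW: "finite W" using WV finV finite_subset by blast
  have neq: "u \<noteq> w" using zs(1) by auto
  have PE: "P \<subseteq> E" and PF: "P \<inter> F = {}" using ear by (auto simp: P_def)
  have UP: "\<Union>P = insert u (insert w (set zs))" unfolding P_def by (subst Union_path_edges) auto
  have finP: "finite P" by (simp add: P_def)
  obtain gP where gP: "arc gP" "pathstart gP = p u" "pathfinish gP = p w" "path_image gP = drawn \<gamma> P"
    using path_arc[of u "zs @ [w]"] zs(1) PE by (auto simp: P_def)
  define I where "I = drawn \<gamma> P - {p u, p w}"
  note I = arc_interior[OF gP(1), of I, unfolded gP(2-4), OF I_def]
  have meetPF: "drawn \<gamma> P \<inter> drawn \<gamma> F = {p u, p w}"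
  proof -
    have "\<Union>P \<inter> \<Union>F = {u, w}" using UP W uw zs(2) by auto
    then show ?thesis using drawn_meet[OF PE FE PF] by simp
  qed
  have IF: "I \<inter> drawn \<gamma> F = {}" using meetPF by (auto simp: I_def)
  then have "I \<subseteq> (\<Union>(f, D)\<in>\<F>. f)" using cover by blast
  then obtain f D where fD: "(f, D) \<in> \<F>" "I \<inter> f \<noteq> {}" using I(2) by blast
  have DF: "D \<subseteq> F" and face: "f = inside (drawn \<gamma> D) \<or> f = outside (drawn \<gamma> D)"
    using faces[OF fD(1)] by auto
  obtain c where c: "distinct c" "length c \<ge> 3" "D = cycle_edges c" using faces[OF fD(1)] by blast
  have fr: "frontier f = drawn \<gamma> D"
    using face cycle_Jordan(4,5)[OF c(1,2)] c(3) DF FE by auto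
  have fF: "f \<inter> drawn \<gamma> F = {}" using cover fD(1) by blast
  \<comment> \<open>To leave \<open>f\<close> the open ear would have to cross its frontier, which
    is drawn by edges of \<open>F\<close>.\<close>
  have If: "I \<subseteq> f"
  proof (rule ccontr)
    assume "\<not> I \<subseteq> f"
    then have "I \<inter> frontier f \<noteq> {}" using connected_Int_frontier[OF I(1) fD(2)] by blast
    then show False using IF fr drawn_mono[OF DF, of \<gamma>] by blast
  qed
  \<comment> \<open>An end of the ear is a limit of points of \<open>f\<close> but lies on
    \<open>drawn \<gamma> F\<close>, which \<open>f\<close> avoids. So it is on the frontier, that
    is, on the cycle \<open>D\<close>.\<close>
  have in_D: "v \<in> \<Union>D" if v: "v \<in> W" "p v \<in> closure I" for v
  proof -
    have "p v \<in> closure f" using v(2) closure_mono[OF If] by blast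
    moreover have "p v \<in> drawn \<gamma> F" using v(1) vertex_drawn_iff[OF FE] W WV by blast
    ultimately have "p v \<in> drawn \<gamma> D" using fF fr closure_Un_frontier[of f] by blast
    then show ?thesis using vertex_drawn_iff[of D v] DF FE v(1) WV by blast
  qed
  have "\<Union>D = set c" using Union_cycle_edges[of c] c by simp
  then have "u \<in> set c" "w \<in> set c" using in_D uw I(3,4) by auto
  then obtain xs ys where xy: "distinct (u # xs @ w # ys)" "set (u # xs @ w # ys) = set c"
    "cycle_edges c = cycle_edges (u # xs @ w # ys)"
    using cycle_through_two[OF c(1) _ _ neq] by metis
  have "set c \<subseteq> W" using Union_mono[OF DF] \<open>\<Union>D = set c\<close> W by simp
  then have xyW: "set xs \<subseteq> W" "set ys \<subseteq> W" unfolding xy(2)[symmetric] by auto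
  have "length (u # xs @ w # ys) = length c"
    using xy(1,2) c(1) by (metis distinct_card)
  then have ne: "xs \<noteq> [] \<or> ys \<noteq> []" using c(2) by auto
  define A where "A = path_edges (u # xs @ [w])"
  define B where "B = path_edges (w # ys @ [u])"
  have D_AB: "D = A \<union> B" using c(3) xy(3) cycle_edges_split[of u xs w ys] by (simp add: A_def B_def)
  have AB: "A \<inter> B = {}" unfolding A_def B_def by (rule path_edges_disjoint[OF xy(1) ne])
  have finAB: "finite A" "finite B" by (simp_all add: A_def B_def)
  have A_ne: "A \<noteq> {}" unfolding A_def by (cases xs) auto
  have P_ne: "P \<noteq> {}" unfolding P_def by (cases zs) auto
  have UA: "\<Union>A = insert u (insert w (set xs))" unfolding A_def by (subst Union_path_edges) auto
  have UB: "\<Union>B = insert u (insert w (set ys))" unfolding B_def by (subst Union_path_edges) auto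
  have ABF: "A \<subseteq> F" "B \<subseteq> F" using D_AB DF by auto
  have ABP: "A \<inter> P = {}" "B \<inter> P = {}" using ABF PF by auto
  obtain g h where gh: "arc g" "arc h" "pathstart g = p u" "pathfinish g = p w"
    "pathstart h = p u" "pathfinish h = p w" "path_image g = drawn \<gamma> A" "path_image h = drawn \<gamma> B"
    "path_image g \<inter> path_image h = {p u, p w}"
    using cycle_arcs[OF xy(1) ne] xy(3) c(3) DF FE unfolding A_def B_def by blast
  have "\<Union>A \<inter> \<Union>P = {u, w}" "\<Union>B \<inter> \<Union>P = {u, w}"
    using UA UB UP xyW zs(2) by auto
  then have meets: "drawn \<gamma> A \<inter> drawn \<gamma> P = {p u, p w}" "drawn \<gamma> B \<inter> drawn \<gamma> P = {p u, p w}"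
    using drawn_meet[of A P] drawn_meet[of B P] ABF FE PE ABP by auto
  interpret t: theta g h gP "p u" "p w"
    using gh gP meets by unfold_locales auto
  have "f = inside (path_image g \<union> path_image h) \<or> f = outside (path_image g \<union> path_image h)"
    using face gh D_AB by (simp add: drawn_Un)
  moreover have "path_image gP - {p u, p w} \<subseteq> f" using If gP by (simp add: I_def)
  ultimately obtain f1 f2 where
    f1: "f1 = inside (drawn \<gamma> (A \<union> P)) \<or> f1 = outside (drawn \<gamma> (A \<union> P))" and
    f2: "f2 = inside (drawn \<gamma> (B \<union> P)) \<or> f2 = outside (drawn \<gamma> (B \<union> P))" and
    f12: "f1 \<inter> f2 = {}" "f1 \<union> f2 = f - drawn \<gamma> P"
    using t.split_face[of f] unfolding gh(7,8) gP(4) drawn_Un by blast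
  \<comment> \<open>An ear without inner vertices is the edge \<open>{u, w}\<close>, which is not in
    \<open>F\<close>; then both parts of the old cycle have inner vertices. So the new cycles have
    length at least 3.\<close>
  have not_both: "\<not> (zs = [] \<and> xs = [])" "\<not> (zs = [] \<and> ys = [])"
    using ABP by (auto simp: A_def B_def P_def insert_commute)
  have c1: "\<exists>c. distinct c \<and> length c \<ge> 3 \<and> A \<union> P = cycle_edges c"
  proof (intro exI conjI)
    show "distinct (u # xs @ w # rev zs)" using xy(1) zs xyW uw by auto
    show "3 \<le> length (u # xs @ w # rev zs)" using not_both by (cases xs; cases zs) auto
    have "path_edges (w # rev zs @ [u]) = P"
      using path_edges_rev[of "u # zs @ [w]"] by (simp add: P_def)
    then show "A \<union> P = cycle_edges (u # xs @ w # rev zs)" by (simp only: cycle_edges_split A_def)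
  qed
  have c2: "\<exists>c. distinct c \<and> length c \<ge> 3 \<and> B \<union> P = cycle_edges c"
  proof (intro exI conjI)
    show "distinct (u # zs @ w # ys)" using xy(1) zs xyW uw by auto
    show "3 \<le> length (u # zs @ w # ys)" using not_both by (cases ys; cases zs) auto
    show "B \<union> P = cycle_edges (u # zs @ w # ys)" by (simp only: cycle_edges_split B_def P_def Un_commute)
  qed
  define G where "G = \<F> - {(f, D)}"
  have G: "\<F> = insert (f, D) G" "(f, D) \<notin> G" "finite G" using fD(1) finFF by (auto simp: G_def)
  have new: "(f1, A \<union> P) \<notin> G" "(f2, B \<union> P) \<notin> G"
    using faces P_ne PF unfolding G_def by blast+
  have "A \<union> P \<noteq> B \<union> P" using A_ne AB ABP by blast
  then have ne12: "(f1, A \<union> P) \<noteq> (f2, B \<union> P)" by simp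
  have cardP: "card P = Suc (length zs)" using card_path_edges[OF zs(1)] by (simp add: P_def)
  have cardF: "card (F \<union> P) = card F + Suc (length zs)"
    using card_Un_disjoint[OF finF finP] PF cardP by (simp add: Int_commute)
  have cardW: "card (W \<union> set zs) = card W + length zs"
    using card_Un_disjoint[OF finW, of "set zs"] zs distinct_card[of zs] by (auto simp: Int_commute)
  have cardU: "card (A \<union> P) = card A + card P" "card (B \<union> P) = card B + card P" "card D = card A + card B"
    using card_Un_disjoint finAB finP ABP AB D_AB by auto
  let ?F = "insert (f1, A \<union> P) (insert (f2, B \<union> P) G)"
  have sumG: "(\<Sum>(f, D)\<in>\<F>. card D) = card D + (\<Sum>(f, D)\<in>G. card D)"
    using G by simp
  have G_f: "f' \<inter> f = {}" if "(f', D') \<in> G" for f' D'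
    using disj[of "(f', D')" "(f, D)"] that fD(1) G_def by auto
  have G_F: "f' \<inter> drawn \<gamma> F = {}" if "(f', D') \<in> G" for f' D'
    using that cover G(1) by blast
  have G_P: "f' \<inter> drawn \<gamma> P = {}" if g: "(f', D') \<in> G" for f' D'
  proof -
    have "drawn \<gamma> P \<subseteq> f \<union> drawn \<gamma> F" using If meetPF by (auto simp: I_def)
    then show ?thesis using G_f[OF g] G_F[OF g] by blast
  qed
  have "face_system (W \<union> set zs) (F \<union> P) ?F"
    unfolding face_system_def
  proof (intro conjI)
    show "W \<union> set zs = \<Union> (F \<union> P)" using W UP uw by auto
    show "F \<union> P \<subseteq> E" using FE PE by blast
    show "finite ?F" using G(3) by simp
    show "card ?F + card (W \<union> set zs) = card (F \<union> P) + 2"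
      using count cardF cardW G new ne12 by simp
    show "(\<Sum>(f, D)\<in>?F. card D) = 2 * card (F \<union> P)"
      using sum sumG cardU cardF cardP G(3) new ne12 by simp
    show "\<forall>(f, D)\<in>?F. D \<subseteq> F \<union> P \<and> (\<exists>c. distinct c \<and> 3 \<le> length c \<and> D = cycle_edges c) \<and>
      (f = inside (drawn \<gamma> D) \<or> f = outside (drawn \<gamma> D))"
    proof
      fix x assume "x \<in> ?F"
      then consider "x = (f1, A \<union> P)" | "x = (f2, B \<union> P)" | "x \<in> \<F>" using G(1) by blast
      then show "case x of (f, D) \<Rightarrow> D \<subseteq> F \<union> P \<and> (\<exists>c. distinct c \<and> 3 \<le> length c \<and> D = cycle_edges c) \<and>
        (f = inside (drawn \<gamma> D) \<or> f = outside (drawn \<gamma> D))"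
      proof cases
        case 1
        then show ?thesis using c1 f1 ABF(1) by auto
      next
        case 2
        then show ?thesis using c2 f2 ABF(2) by auto
      next
        case 3
        obtain f' D' where x: "x = (f', D')" by (cases x)
        then show ?thesis using faces[of f' D'] 3 by auto
      qed
    qed
    have g1: "f1 \<inter> fst x = {}" and g2: "f2 \<inter> fst x = {}" if "x \<in> G" for x
      using G_f[of "fst x" "snd x"] that f12(2) by auto
    have g3: "fst x \<inter> fst y = {}" if "x \<in> G" "y \<in> G" "x \<noteq> y" for x y
      using disj that G(1) by blast
    have "fst x \<inter> fst y = {}" if "x \<in> ?F" "y \<in> ?F" "x \<noteq> y" for x y
      using that g1[of x] g1[of y] g2[of x] g2[of y] g3[of x y] f12(1)
      by (elim insertE) (simp_all add: Int_commute)
    then show "\<forall>x\<in>?F. \<forall>y\<in>?F. x \<noteq> y \<longrightarrow> fst x \<inter> fst y = {}" by (intro ballI impI)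
    have "(\<Union>(f, D)\<in>?F. f) = (f1 \<union> f2) \<union> (\<Union>(f, D)\<in>G. f)" by auto
    also have "\<dots> = (f \<union> (\<Union>(f, D)\<in>G. f)) - drawn \<gamma> P"
      using f12(2) G_P by auto
    also have "f \<union> (\<Union>(f, D)\<in>G. f) = - drawn \<gamma> F" using cover G(1) by auto
    finally show "(\<Union>(f, D)\<in>?F. f) = - drawn \<gamma> (F \<union> P)" by (auto simp: drawn_Un)
  qed
  then show ?thesis unfolding P_def by blast
qed


text \<open>Boundary cycles have at least 10 edges, so ten times the number of faces is at most
  \<open>2 * card F\<close>; Euler's formula eliminates the faces.\<close>

lemma face_system_bound:
  assumes FS: "face_system W F \<F>" and girth: "10 \<le> girth V E"
  shows "4 * card F + 10 \<le> 5 * card W"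
proof -
  have W: "W = \<Union>F" and FE: "F \<subseteq> E" and fin: "finite \<F>"
    and count: "card \<F> + card W = card F + 2" and sum: "(\<Sum>(f, D)\<in>\<F>. card D) = 2 * card F"
    using FS unfolding face_system_def by - (elim conjE, assumption)+
  have faces: "\<forall>(f, D)\<in>\<F>. D \<subseteq> F \<and> (\<exists>c. distinct c \<and> length c \<ge> 3 \<and> D = cycle_edges c) \<and>
      (f = inside (drawn \<gamma> D) \<or> f = outside (drawn \<gamma> D))"
    using FS unfolding face_system_def by (elim conjE)
  have "10 \<le> card (snd x)" if x: "x \<in> \<F>" for x
  proof -
    obtain c where c: "snd x \<subseteq> F" "distinct c" "length c \<ge> 3" "snd x = cycle_edges c"
      using faces x by fastforce
    have "cycle_edges c \<subseteq> E" using c(1,4) FE by simp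
    moreover have "set c \<subseteq> V"
      using Union_cycle_edges[of c] c(3) calculation edge_subset by fastforce
    ultimately have "is_cycle V E c" using is_cycle_cycle_edges c(2,3) by blast
    then have "girth V E \<le> enat (length c)" unfolding girth_def by (intro INF_lower) simp
    then have "10 \<le> enat (length c)" using girth order_trans by blast
    then have "10 \<le> length c" by (simp add: numeral_eq_enat)
    then show ?thesis using c(4) card_cycle_edges[OF c(2,3)] by simp
  qed
  then have "(\<Sum>x\<in>\<F>. 10) \<le> (\<Sum>x\<in>\<F>. card (snd x))" by (rule sum_mono)
  also have "\<dots> = 2 * card F" using sum by (simp add: case_prod_unfold)
  finally have "10 * card \<F> \<le> 2 * card F" by simp
  then show ?thesis using count by linarith
qed

end

section \<open>Ears\<close>

definition linked :: "'a set set \<Rightarrow> 'a \<Rightarrow> 'a \<Rightarrow> bool" where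
  "linked F = (\<lambda>x y. {x, y} \<in> F)\<^sup>*\<^sup>*"

lemma linked_path:
  assumes "linked F x y"
  obtains zs where "distinct (x # zs)" "last (x # zs) = y" "path_edges (x # zs) \<subseteq> F"
proof -
  have "\<exists>zs. distinct (x # zs) \<and> last (x # zs) = y \<and> path_edges (x # zs) \<subseteq> F"
    using assms unfolding linked_def
  proof (induction rule: converse_rtranclp_induct)
    case base
    show ?case by (intro exI[of _ "[]"]) simp
  next
    case (step x w)
    then obtain zs where zs: "distinct (w # zs)" "last (w # zs) = y" "path_edges (w # zs) \<subseteq> F" by blast
    show ?case
    proof (cases "x \<in> set (w # zs)")
      case False
      then show ?thesis using zs step(1) by (intro exI[of _ "w # zs"]) auto
    next
      case True
      \<comment> \<open>If \<open>x\<close> already occurs on the path, the part before that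
        occurrence is cut off.\<close>
      then obtain l r where lr: "w # zs = l @ x # r" using split_list by metis
      have "path_edges (x # r) \<subseteq> F" using zs(3) path_edges_append[of l x r] lr by simp
      moreover have "distinct (x # r)" using zs(1) lr by (metis distinct_append)
      moreover have "last (x # r) = y" using zs(2) lr by (metis last_appendR list.discI)
      ultimately show ?thesis by blast
    qed
  qed
  then show thesis using that by blast
qed

lemma linked_refl: "linked F x x"
  by (simp add: linked_def)

lemma linked_step: "linked F x y \<Longrightarrow> {y, z} \<in> F \<Longrightarrow> linked F x z"
  unfolding linked_def by (rule rtranclp.rtrancl_into_rtrancl)

lemma linked_sym: "linked F x y \<Longrightarrow> linked F y x"
proof -
  have "symp (\<lambda>x y. {x, y} \<in> F)" by (auto intro: sympI simp: insert_commute)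
  then show "linked F x y \<Longrightarrow> linked F y x"
    unfolding linked_def by (meson symp_rtranclp sympD)
qed

lemma linked_trans: "linked F x y \<Longrightarrow> linked F y z \<Longrightarrow> linked F x z"
  unfolding linked_def by (rule rtranclp_trans)

text \<open>An empty overlap means disconnected, an overlap of one vertex means a cut vertex. A
  single edge is not separable.\<close>

definition separable :: "'a set \<Rightarrow> 'a set set \<Rightarrow> bool" where
  "separable W F \<longleftrightarrow> (\<exists>A B. A \<union> B = W \<and> A \<noteq> W \<and> B \<noteq> W \<and> A \<noteq> {} \<and> B \<noteq> {} \<and> card (A \<inter> B) \<le> 1 \<and>
     (\<forall>e\<in>F. e \<subseteq> A \<or> e \<subseteq> B))"

section \<open>Cycles and ears in graphs that no vertex cuts\<close>

context drawing
begin

definition subgraph :: "'a set \<Rightarrow> 'a set set \<Rightarrow> bool" where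
  "subgraph W F \<longleftrightarrow> W \<subseteq> V \<and> F \<subseteq> E \<and> \<Union>F \<subseteq> W"

lemma edge_pair: "e \<in> E \<Longrightarrow> \<exists>x y. x \<noteq> y \<and> e = {x, y}"
  using graph unfolding simple_graph_def by blast

text \<open>An edge \<open>uv\<close> on no cycle is a bridge. Then \<open>u\<close> separates if
  its side contains another vertex; otherwise \<open>v\<close> cuts off \<open>u\<close>, a third
  vertex being present.\<close>

lemma exists_cycle:
  assumes sub: "subgraph W F" and ns: "\<not> separable W F" and W: "card W \<ge> 3" and F: "F \<noteq> {}"
  obtains c where "distinct c" "length c \<ge> 3" "cycle_edges c \<subseteq> F"
proof -
  obtain e where "e \<in> F" using F by blast
  then obtain u v where uv: "u \<noteq> v" "{u, v} \<in> F"
    using edge_pair[of e] sub unfolding subgraph_def by blast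
  have uvW: "u \<in> W" "v \<in> W" using uv(2) sub by (auto simp: subgraph_def)
  let ?F = "F - {{u, v}}"
  show thesis
  proof (cases "linked ?F u v")
    case True
    then obtain zs where zs: "distinct (u # zs)" "last (u # zs) = v" "path_edges (u # zs) \<subseteq> ?F"
      by (rule linked_path)
    then obtain ys where ys: "zs = ys @ [v]" using uv(1) by (cases zs rule: rev_cases) auto
    have "ys \<noteq> []" using zs(3) ys by auto
    moreover have "cycle_edges (u # zs) = path_edges (u # zs) \<union> {{u, v}}"
      using cycle_edges_split[of u ys v "[]"] ys by (auto simp: insert_commute)
    ultimately show thesis using that[of "u # zs"] zs ys uv(2) by (cases ys) auto
  next
    case False
    define A where "A = {w \<in> W. linked ?F u w}"
    have A: "u \<in> A" "v \<notin> A" "A \<subseteq> W" using False uvW by (auto simp: A_def linked_refl)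
    have edge_A: "y \<in> A" if "x \<in> A" "{x, y} \<in> F" "{x, y} \<noteq> {u, v}" for x y
      using that linked_step[of ?F u x y] sub by (auto simp: A_def subgraph_def)
    have edges: "e \<subseteq> A \<or> e \<subseteq> W - A \<or> e = {u, v}" if eF: "e \<in> F" for e
    proof -
      obtain x y where e: "e = {x, y}" "x \<in> W" "y \<in> W"
        using edge_pair[of e] eF sub unfolding subgraph_def by blast
      then have "{y, x} \<in> F" using eF by (simp add: insert_commute)
      then show ?thesis using edge_A[of x y] edge_A[of y x] e eF by (auto simp: insert_commute)
    qed
    have finW: "finite W" using W card.infinite by force
    have "separable W F"
    proof (cases "A = {u}")
      case False
      have "insert u (W - A) \<noteq> W" using False A by blast
      moreover have "A \<inter> insert u (W - A) = {u}" using A by blast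
      moreover have "\<forall>e\<in>F. e \<subseteq> A \<or> e \<subseteq> insert u (W - A)" using edges A uvW by blast
      ultimately show ?thesis unfolding separable_def using A uvW
        by (intro exI[of _ A] exI[of _ "insert u (W - A)"]) auto
    next
      case True
      have "\<not> W \<subseteq> {u, v}" using W card_mono[of "{u, v}" W] uv(1) by auto
      moreover have "{u, v} \<inter> (W - {u}) = {v}" using uvW uv(1) by blast
      moreover have "\<forall>e\<in>F. e \<subseteq> {u, v} \<or> e \<subseteq> W - {u}" using edges True by blast
      ultimately show ?thesis unfolding separable_def using uvW uv(1)
        by (intro exI[of _ "{u, v}"] exI[of _ "W - {u}"]) auto
    qed
    then show thesis using ns by blast
  qed
qed

text \<open>If \<open>U\<close> is everything, a missing edge is an ear. Otherwise a component
  \<open>K\<close> outside \<open>U\<close> has at least two attachments in \<open>U\<close>, since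
  \<open>K \<union> N\<close> and \<open>W - K\<close> would separate if \<open>N\<close> had at
  most one vertex; a path through \<open>K\<close> joins two of them.\<close>

lemma exists_ear:
  assumes sub: "subgraph W F" and ns: "\<not> separable W F" and H: "subgraph U H" "U \<subseteq> W" "H \<subseteq> F" "card U \<ge> 2"
    and proper: "U \<noteq> W \<or> H \<noteq> F"
  obtains u w zs where "u \<in> U" "w \<in> U" "distinct (u # zs @ [w])" "set zs \<inter> U = {}"
    "path_edges (u # zs @ [w]) \<subseteq> F - H"
proof (cases "U = W")
  case True
  then obtain e where e: "e \<in> F" "e \<notin> H" using proper H(3) by blast
  then obtain x y where "x \<noteq> y" "e = {x, y}" using edge_pair[of e] sub unfolding subgraph_def by blast
  then show thesis using that[of x y "[]"] e sub True by (auto simp: subgraph_def)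
next
  case False
  then obtain x where x: "x \<in> W" "x \<notin> U" using H(2) by blast
  let ?F = "{e \<in> F. e \<inter> U = {}}"
  define K where "K = {w \<in> W. linked ?F x w}"
  define N where "N = {h \<in> U. \<exists>k\<in>K. {h, k} \<in> F}"
  have KU: "w \<notin> U" if "linked ?F x w" for w
    using that unfolding linked_def by (induction rule: rtranclp_induct) (use x in auto)
  have xK: "x \<in> K" using x by (simp add: K_def linked_refl)
  have edge_K: "z \<in> K \<union> N" if "y \<in> K" "{y, z} \<in> F" for y z
  proof (cases "z \<in> U")
    case True
    then show ?thesis using that by (auto simp: N_def insert_commute)
  next
    case False
    have "y \<notin> U" using KU that(1) by (auto simp: K_def)
    then have "linked ?F x z" using that False linked_step[of ?F x y z] by (auto simp: K_def)
    moreover have "z \<in> W" using that(2) sub by (auto simp: subgraph_def)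
    ultimately show ?thesis by (simp add: K_def)
  qed
  have finU: "finite U" using H(4) card.infinite by force
  have finN: "finite N" using finU by (simp add: N_def)
  have "\<not> card N \<le> 1"
  proof
    assume card: "card N \<le> 1"
    have "K \<union> N \<union> (W - K) = W" using H(2) by (auto simp: K_def N_def)
    moreover have "\<not> U \<subseteq> N" using card H(4) card_mono[OF finN, of U] by linarith
    then have "K \<union> N \<noteq> W" using H(2) KU by (auto simp: K_def N_def)
    moreover have "(K \<union> N) \<inter> (W - K) \<subseteq> N" by blast
    then have "card ((K \<union> N) \<inter> (W - K)) \<le> 1" using card card_mono[OF finN] le_trans by blast
    moreover have "\<forall>e\<in>F. e \<subseteq> K \<union> N \<or> e \<subseteq> W - K"
    proof
      fix e assume e: "e \<in> F"
      then obtain y z where yz: "e = {y, z}" "y \<in> W" "z \<in> W"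
        using edge_pair[of e] sub unfolding subgraph_def by blast
      then have "{z, y} \<in> F" using e by (simp add: insert_commute)
      then show "e \<subseteq> K \<union> N \<or> e \<subseteq> W - K"
        using edge_K[of y z] edge_K[of z y] yz e by blast
    qed
    moreover have "W - K \<noteq> W" "K \<union> N \<noteq> {}" using xK x(1) by auto
    moreover have "U \<noteq> {}" using H(4) by auto
    then have "W - K \<noteq> {}" using H(2) KU by (auto simp: K_def)
    ultimately show False using ns unfolding separable_def by blast
  qed
  then obtain u w where uw: "u \<in> N" "w \<in> N" "u \<noteq> w"
    using card_le_Suc0_iff_eq[OF finN] by auto
  then obtain k l where kl: "k \<in> K" "{u, k} \<in> F" "l \<in> K" "{w, l} \<in> F" by (auto simp: N_def)
  have "linked ?F k l" using kl linked_sym linked_trans by (metis (no_types, lifting) K_def mem_Collect_eq)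
  then obtain zs where zs: "distinct (k # zs)" "last (k # zs) = l" "path_edges (k # zs) \<subseteq> ?F"
    by (rule linked_path)
  have kU: "k \<notin> U" using kl KU by (auto simp: K_def)
  have zsU: "set (k # zs) \<inter> U = {}"
  proof (cases zs)
    case Nil
    then show ?thesis using kU by simp
  next
    case Cons
    then have "set (k # zs) = \<Union> (path_edges (k # zs))" by (subst Union_path_edges) auto
    then show ?thesis using zs(3) by blast
  qed
  have uwU: "u \<in> U" "w \<in> U" using uw by (auto simp: N_def)
  obtain ys where ys: "k # zs = ys @ [l]" using zs(2) by (metis append_butlast_last_id list.discI)
  have "path_edges (u # (k # zs) @ [w]) = {{u, k}} \<union> path_edges (k # zs) \<union> {{l, w}}"
    using path_edges_append[of ys l "[w]"] ys by (cases ys) auto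
  moreover have "{{u, k}} \<union> path_edges (k # zs) \<union> {{l, w}} \<subseteq> F - H"
  proof -
    have "e \<subseteq> U" if "e \<in> H" for e using that H(1) by (auto simp: subgraph_def)
    moreover have "l \<notin> U" using kl KU by (auto simp: K_def)
    moreover have "e \<inter> U = {} \<and> e \<noteq> {} \<and> e \<in> F" if "e \<in> path_edges (k # zs)" for e
      using that zs(3) path_edges_nonempty by blast
    ultimately show ?thesis using kU kl(2,4) by (fastforce simp: insert_commute)
  qed
  ultimately show thesis
    using that[of u w "k # zs"] uwU uw(3) zs(1) zsU by auto
qed

text \<open>The summand 5 is the most that a single vertex allows, and it makes the bound pass
  through a cut: for two parts sharing at most one vertex,
  \<open>5 |A| + 5 |B| - 10 <= 5 |W| - 5\<close>.\<close>

theorem planar_girth_bound: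
  assumes girth: "10 \<le> girth V E" and "subgraph W F" "W \<noteq> {}"
  shows "4 * card F + 5 \<le> 5 * card W"
  using assms(2,3)
proof (induction "card W" arbitrary: W F rule: less_induct)
  case less
  have finV: "finite V" using graph by (simp add: simple_graph_def)
  moreover have "E \<subseteq> Pow V" using edge_subset by blast
  ultimately have finE: "finite E" using finite_subset by auto
  have finW: "finite W" and finF: "finite F"
    using less.prems(1) finV finE finite_subset by (auto simp: subgraph_def)
  consider "separable W F" | "\<not> separable W F" "card W \<le> 2" | "\<not> separable W F" "card W \<ge> 3" "F = {}"
    | "\<not> separable W F" "card W \<ge> 3" "F \<noteq> {}" by linarith
  then show ?case
  proof cases
    case 1
    then obtain A B where AB: "A \<union> B = W" "A \<noteq> W" "B \<noteq> W" "A \<noteq> {}" "B \<noteq> {}" "card (A \<inter> B) \<le> 1"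
      "\<forall>e\<in>F. e \<subseteq> A \<or> e \<subseteq> B" unfolding separable_def by blast
    let ?FA = "{e \<in> F. e \<subseteq> A}" and ?FB = "{e \<in> F. e \<subseteq> B}"
    have fin: "finite A" "finite B" using AB(1) finW by auto
    have "card A < card W" "card B < card W"
      using AB(1-3) finW by (auto intro!: psubset_card_mono)
    moreover have "subgraph A ?FA" "subgraph B ?FB"
      using AB(1) less.prems(1) by (auto simp: subgraph_def)
    ultimately have "4 * card ?FA + 5 \<le> 5 * card A" "4 * card ?FB + 5 \<le> 5 * card B"
      using less.hyps AB(4,5) by blast+
    moreover have "card F \<le> card ?FA + card ?FB"
    proof -
      have "F = ?FA \<union> ?FB" using AB(7) by blast
      then show ?thesis using card_Un_le[of ?FA ?FB] by simp
    qed
    moreover have "card A + card B = card W + card (A \<inter> B)"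
      using card_Un_Int[OF fin] AB(1) by simp
    ultimately show ?thesis using AB(6) by linarith
  next
    case 2
    have pairs: "\<exists>x y. x \<noteq> y \<and> e = {x, y} \<and> x \<in> W \<and> y \<in> W" if "e \<in> F" for e
      using edge_pair[of e] that less.prems(1) unfolding subgraph_def by blast
    have "F \<subseteq> {W} \<and> (card W \<le> 1 \<longrightarrow> F = {})"
    proof (intro conjI impI subsetI)
      fix e assume "e \<in> F"
      then obtain x y where e: "x \<noteq> y" "e = {x, y}" "e \<subseteq> W" using pairs by blast
      then have "card e = 2" by simp
      then have "e = W" using card_subset_eq[OF finW e(3)] card_mono[OF finW e(3)] 2(2) by simp
      then show "e \<in> {W}" by simp
    next
      assume "card W \<le> 1"
      then show "F = {}" using pairs card_le_Suc0_iff_eq[OF finW] by fastforce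
    qed
    then have "card F \<le> 1" "card W \<le> 1 \<Longrightarrow> card F = 0"
      using card_mono[of "{W}" F] by auto
    moreover have "card W \<ge> 1" using finW less.prems(2) by (simp add: Suc_leI card_gt_0_iff)
    ultimately show ?thesis by (cases "card W \<le> 1") auto
  next
    case 3
    then show ?thesis by simp
  next
    case 4
    \<comment> \<open>The bound is read off from a subgraph with a face system and the most edges.
      It is the whole graph, since an ear would enlarge it.\<close>
    define P where "P H \<longleftrightarrow> H \<subseteq> F \<and> (\<exists>\<F>. face_system (\<Union>H) H \<F>)" for H
    obtain c where c: "distinct c" "length c \<ge> 3" "cycle_edges c \<subseteq> F"
      using exists_cycle[OF less.prems(1) 4] by blast
    have FE: "F \<subseteq> E" and FW: "\<Union>F \<subseteq> W" using less.prems(1) by (auto simp: subgraph_def)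
    have "P (cycle_edges c)"
      using face_system_cycle[OF c(1,2)] c(3) FE Union_cycle_edges[of c] c(2) by (auto simp: P_def)
    moreover have "card H \<le> card F" if "P H" for H
      using that finF by (auto simp: P_def card_mono)
    ultimately obtain H where H: "P H" "\<And>H'. P H' \<Longrightarrow> card H' \<le> card H"
      using ex_has_greatest_nat[of P "cycle_edges c" card "Suc (card F)"] by (metis le_imp_less_Suc)
    then obtain \<F> where FS: "face_system (\<Union>H) H \<F>" and HF: "H \<subseteq> F" by (auto simp: P_def)
    have bound: "4 * card H + 10 \<le> 5 * card (\<Union>H)" by (rule face_system_bound[OF FS girth])
    have finH: "finite H" using HF finF finite_subset by blast
    have "\<Union>H = W \<and> H = F"
    proof (rule ccontr)
      assume "\<not> ?thesis"
      then have proper: "\<Union>H \<noteq> W \<or> H \<noteq> F" by blast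
      have sub: "subgraph (\<Union>H) H" "\<Union>H \<subseteq> W" using HF FE FW less.prems(1) by (auto simp: subgraph_def)
      have "card (\<Union>H) \<ge> 2" using bound by linarith
      then obtain u w zs where ear: "u \<in> \<Union>H" "w \<in> \<Union>H" "distinct (u # zs @ [w])" "set zs \<inter> \<Union>H = {}"
        "path_edges (u # zs @ [w]) \<subseteq> F - H"
        using exists_ear[OF less.prems(1) 4(1) sub HF _ proper] by metis
      let ?P = "path_edges (u # zs @ [w])"
      have "?P \<subseteq> E - H" using ear(5) FE by blast
      then obtain \<F>' where FS': "face_system (\<Union>H \<union> set zs) (H \<union> ?P) \<F>'"
        using face_system_ear[OF FS ear(1-4)] by blast
      then have "\<Union>H \<union> set zs = \<Union>(H \<union> ?P)" unfolding face_system_def by (elim conjE)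
      then have "P (H \<union> ?P)" using FS' HF ear(5) by (auto simp: P_def)
      moreover have "card (H \<union> ?P) > card H"
      proof (rule psubset_card_mono)
        have "?P \<noteq> {}" by (cases zs) auto
        then show "H \<subset> H \<union> ?P" using ear(5) by blast
      qed (use finH in simp)
      ultimately show False using H(2) by fastforce
    qed
    then show ?thesis using bound by auto
  qed
qed

end

theorem theorem1p4:
  fixes V :: "'a set" and E :: "'a set set"
    and L :: "'a \<Rightarrow> 'c set" and \<alpha> \<beta> :: "'a \<Rightarrow> 'c"
  assumes "simple_graph V E"
    and "list_assignment 4 V L"
    and "list_coloring V E L \<alpha>"
    and "list_coloring V E L \<beta>"
  shows "(mad V E < 5 / 2 \<longrightarrow>
            (\<exists>s. recoloring_sequence V E L \<alpha> \<beta> s \<and> (\<forall>v\<in>V. recolor_count s v \<le> 18))) \<and>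
         (planar V E \<and> girth V E \<ge> 10 \<longrightarrow>
            (\<exists>s. recoloring_sequence V E L \<alpha> \<beta> s \<and> (\<forall>v\<in>V. recolor_count s v \<le> 18)))"
proof (intro conjI impI)
  assume "mad V E < 5 / 2"
  then show "\<exists>s. recoloring_sequence V E L \<alpha> \<beta> s \<and> (\<forall>v\<in>V. recolor_count s v \<le> 18)"
    using mad_recoloring assms by blast
next
  assume "planar V E \<and> girth V E \<ge> 10"
  then obtain p \<gamma> where d: "plane_drawing V E p \<gamma>" and girth: "10 \<le> girth V E"
    by (auto simp: planar_def)
  interpret drawing V E p \<gamma> using assms(1) d by unfold_locales
  show "\<exists>s. recoloring_sequence V E L \<alpha> \<beta> s \<and> (\<forall>v\<in>V. recolor_count s v \<le> 18)"
  proof (rule sparse_recoloring[OF assms(1) _ assms(2-4)])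
    fix W assume W: "W \<subseteq> V" "W \<noteq> {}"
    then have "subgraph W {e \<in> E. e \<subseteq> W}" by (auto simp: subgraph_def)
    from planar_girth_bound[OF girth this W(2)]
    show "4 * card {e \<in> E. e \<subseteq> W} < 5 * card W" by simp
  qed
qed

end
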